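(* Let $\Bbbk$ be a field of characteristic not $2$, let $\delta\in\Bbbk$ with $\delta\neq-2$, and let $\alpha\in\Bbbk^\times$. If $\mathcal I$ is a tensor ideal of $\mathcal T_{\delta,\alpha}$ such that $$\dim_{\Bbbk}\left((\mathcal T_{\delta,\alpha}/\mathcal I)(X^{\otimes 2},X^{\otimes 2})\right)=4,$$ then $\delta\neq1$ and the relation $$K+H=\frac{\alpha}{1-\delta}\left(2s-1_{X\otimes X}-\eta\varepsilon\right)$$ holds in the quotient $\mathcal T_{\delta,\alpha}/\mathcal I$. In particular, $X$, with multiplication $m$, is a vector product algebra object in $\mathcal T_{\delta,\alpha}/\mathcal I$ (for a suitable cup and cap).
   Context: All categories are $\Bbbk$-linear; $\mathcal C(Y,Z)$ denotes the space of morphisms $Y\to Z$ in $\mathcal C$. $\mathcal T_{\delta,\alpha}$ is the strict $\Bbbk$-linear monoidal category (unit object $\mathbf 1$) generated by one object $X$ and morphisms $$m\colon X\otimes X\to X,\quad s\colon X\otimes X\to X\otimes X,\quad \eta\colon\mathbf 1\to X\otimes X,\quad \varepsilon\colon X\otimes X\to\mathbf 1,$$ subject to the following relations (writing $1$ for $\mathrm{id}_X$ and composing right to left): (i) $(\varepsilon\otimes1)(1\otimes\eta)=1=(1\otimes\varepsilon)(\eta\otimes1)$; (ii) $\sigma:=(1\otimes m)(\eta\otimes 1)=(m\otimes1)(1\otimes\eta)\colon X\to X\otimes X$; (iii) $(1\otimes\varepsilon)(s\otimes1)=(\varepsilon\otimes1)(1\otimes s)$; (iv) $s\circ s=1\otimes1$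 and $(s\otimes1)(1\otimes s)(s\otimes1)=(1\otimes s)(s\otimes1)(1\otimes s)$; (v) $(1\otimes m)(s\otimes1)(1\otimes s)=s(m\otimes1)$ and $(1\otimes s)(s\otimes1)(1\otimes\sigma)=(\sigma\otimes1)s$; (vi) $\varepsilon s=\varepsilon$, $\; m s=-m$, $\; m\sigma=\alpha\,1$, $\;\varepsilon\eta=\delta\,\mathrm{id}_{\mathbf 1}$. It is symmetric monoidal with braiding determined by $s$. Put $K:=\sigma m$ and $H:=(m\otimes1)(1\otimes\sigma)=(1\otimes m)(\sigma\otimes1)$. A tensor ideal $\mathcal I$ of a $\Bbbk$-linear monoidal category $\mathcal C$ is a collection of subspaces $\mathcal I(Y,Z)\subseteq\mathcal C(Y,Z)$, for all objects $Y,Z$, closed under composition on either side with arbitrary morphisms of $\mathcal C$ and under tensoring on either side with identity morphisms. The quotient $\mathcal C/\mathcal I$ has the same objects as $\mathcal C$ and morphism spaces $\mathcal C(Y,Z)/\mathcal I(Y,Z)$. A vector product algebra object in a symmetric monoidal $\Bbbk$-linear category with braiding $s$ is an object $V$ with morphisms (multiplication) $m'\colon V\otimes V\to V$, (cup) $\eta'\colon\mathbf 1\to V\otimes V$, (cap) $\varepsilon'\colon V\otimes V\to\mathbf 1$ satisfying the analogues of relations (i), (ii), (iii), $\varepsilon's=\varepsilon'$, $m's=-m'$, and $$m'(m'\otimes1)+m'(1\otimes m')=2\,(1\otimes\varepsilon')(s\otimes1)-(1\otimes\varepsilon')-(\varepsilon'\otimes1)$$ as morphisms $V^{\otimes3}\to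 V$. *)

theory Defs
  imports "HOL-Algebra.AbelCoset" "Jordan_Normal_Form.VS_Connect"
begin

section \<open>Strict linear monoidal categories\<close>

text \<open>Every element of the type \<open>'o\<close> is an object.  The \<open>mult\<close> and \<open>one\<close> fields of the
  HOL-Algebra module records \<open>Hom C Y Z\<close> carry no meaning.  Composition is written
  right to left: \<open>g \<cdot> f\<close> is \<open>g\<close> after \<open>f\<close>.\<close>

record ('o, 'm, 'k) lin_cat =
  Hom :: "'o \<Rightarrow> 'o \<Rightarrow> ('k, 'm) module"
  cmp :: "'m \<Rightarrow> 'm \<Rightarrow> 'm" (infixr \<open>\<cdot>\<index>\<close> 70)
  idm :: "'o \<Rightarrow> 'm"
  otens :: "'o \<Rightarrow> 'o \<Rightarrow> 'o" (infixr \<open>\<boxdot>\<index>\<close> 80)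
  ounit :: "'o"
  tens :: "'m \<Rightarrow> 'm \<Rightarrow> 'm" (infixr \<open>\<boxtimes>\<index>\<close> 75)
  braiding :: "'o \<Rightarrow> 'o \<Rightarrow> 'm"

abbreviation mor :: "('o, 'm, 'k) lin_cat \<Rightarrow> 'o \<Rightarrow> 'o \<Rightarrow> 'm set"
  where "mor C Y Z \<equiv> carrier (Hom C Y Z)"

locale strict_monoidal_lin_cat =
  fixes C :: "('o, 'm, 'k::field) lin_cat" (structure)
  assumes hom_vectorspace: "vectorspace class_ring (Hom C Y Z)"
    and hom_disjoint: "\<lbrakk>f \<in> mor C Y Z; f \<in> mor C Y' Z'\<rbrakk> \<Longrightarrow> Y = Y' \<and> Z = Z'"
    and idm_mor: "idm C Y \<in> mor C Y Y"
    and cmp_mor: "\<lbrakk>f \<in> mor C Y Z; g \<in> mor C Z W\<rbrakk> \<Longrightarrow> g \<cdot> f \<in> mor C Y W"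
    and cmp_idm_right: "f \<in> mor C Y Z \<Longrightarrow> f \<cdot> idm C Y = f"
    and cmp_idm_left: "f \<in> mor C Y Z \<Longrightarrow> idm C Z \<cdot> f = f"
    and cmp_assoc: "\<lbrakk>f \<in> mor C Y Z; g \<in> mor C Z W; h \<in> mor C W V\<rbrakk>
      \<Longrightarrow> (h \<cdot> g) \<cdot> f = h \<cdot> (g \<cdot> f)"
    and cmp_add_left: "\<lbrakk>f \<in> mor C Y Z; g \<in> mor C Z W; g' \<in> mor C Z W\<rbrakk>
      \<Longrightarrow> (g \<oplus>\<^bsub>Hom C Z W\<^esub> g') \<cdot> f = g \<cdot> f \<oplus>\<^bsub>Hom C Y W\<^esub> g' \<cdot> f"
    and cmp_add_right: "\<lbrakk>f \<in> mor C Y Z; f' \<in> mor C Y Z; g \<in> mor C Z W\<rbrakk>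
      \<Longrightarrow> g \<cdot> (f \<oplus>\<^bsub>Hom C Y Z\<^esub> f') = g \<cdot> f \<oplus>\<^bsub>Hom C Y W\<^esub> g \<cdot> f'"
    and cmp_smult_left: "\<lbrakk>f \<in> mor C Y Z; g \<in> mor C Z W\<rbrakk>
      \<Longrightarrow> (c \<odot>\<^bsub>Hom C Z W\<^esub> g) \<cdot> f = c \<odot>\<^bsub>Hom C Y W\<^esub> (g \<cdot> f)"
    and cmp_smult_right: "\<lbrakk>f \<in> mor C Y Z; g \<in> mor C Z W\<rbrakk>
      \<Longrightarrow> g \<cdot> (c \<odot>\<^bsub>Hom C Y Z\<^esub> f) = c \<odot>\<^bsub>Hom C Y W\<^esub> (g \<cdot> f)"
    and otens_assoc: "(Y \<boxdot> Z) \<boxdot> W = Y \<boxdot> (Z \<boxdot> W)"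
    and otens_unit_left: "ounit C \<boxdot> Y = Y"
    and otens_unit_right: "Y \<boxdot> ounit C = Y"
    and tens_mor: "\<lbrakk>f \<in> mor C Y Z; g \<in> mor C Y' Z'\<rbrakk> \<Longrightarrow> f \<boxtimes> g \<in> mor C (Y \<boxdot> Y') (Z \<boxdot> Z')"
    and tens_idm: "idm C Y \<boxtimes> idm C Z = idm C (Y \<boxdot> Z)"
    and interchange: "\<lbrakk>f \<in> mor C Y Z; g \<in> mor C Z W; f' \<in> mor C Y' Z'; g' \<in> mor C Z' W'\<rbrakk>
      \<Longrightarrow> (g \<boxtimes> g') \<cdot> (f \<boxtimes> f') = (g \<cdot> f) \<boxtimes> (g' \<cdot> f')"
    and tens_assoc: "\<lbrakk>f \<in> mor C Y Z; g \<in> mor C Y' Z'; h \<in> mor C Y'' Z''\<rbrakk>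
      \<Longrightarrow> (f \<boxtimes> g) \<boxtimes> h = f \<boxtimes> (g \<boxtimes> h)"
    and tens_unit_left: "f \<in> mor C Y Z \<Longrightarrow> idm C (ounit C) \<boxtimes> f = f"
    and tens_unit_right: "f \<in> mor C Y Z \<Longrightarrow> f \<boxtimes> idm C (ounit C) = f"
    and tens_add_left: "\<lbrakk>f \<in> mor C Y Z; f' \<in> mor C Y Z; g \<in> mor C Y' Z'\<rbrakk>
      \<Longrightarrow> (f \<oplus>\<^bsub>Hom C Y Z\<^esub> f') \<boxtimes> g = f \<boxtimes> g \<oplus>\<^bsub>Hom C (Y \<boxdot> Y') (Z \<boxdot> Z')\<^esub> f' \<boxtimes> g"
    and tens_add_right: "\<lbrakk>f \<in> mor C Y Z; g \<in> mor C Y' Z'; g' \<in> mor C Y' Z'\<rbrakk>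
      \<Longrightarrow> f \<boxtimes> (g \<oplus>\<^bsub>Hom C Y' Z'\<^esub> g') = f \<boxtimes> g \<oplus>\<^bsub>Hom C (Y \<boxdot> Y') (Z \<boxdot> Z')\<^esub> f \<boxtimes> g'"
    and tens_smult_left: "\<lbrakk>f \<in> mor C Y Z; g \<in> mor C Y' Z'\<rbrakk>
      \<Longrightarrow> (c \<odot>\<^bsub>Hom C Y Z\<^esub> f) \<boxtimes> g = c \<odot>\<^bsub>Hom C (Y \<boxdot> Y') (Z \<boxdot> Z')\<^esub> (f \<boxtimes> g)"
    and tens_smult_right: "\<lbrakk>f \<in> mor C Y Z; g \<in> mor C Y' Z'\<rbrakk>
      \<Longrightarrow> f \<boxtimes> (c \<odot>\<^bsub>Hom C Y' Z'\<^esub> g) = c \<odot>\<^bsub>Hom C (Y \<boxdot> Y') (Z \<boxdot> Z')\<^esub> (f \<boxtimes> g)"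

text \<open>By symmetry one of the two hexagon identities suffices.\<close>

locale symmetric_monoidal_lin_cat = strict_monoidal_lin_cat +
  assumes braiding_mor: "braiding C Y Z \<in> mor C (Y \<boxdot> Z) (Z \<boxdot> Y)"
    and braiding_natural: "\<lbrakk>f \<in> mor C Y Y'; g \<in> mor C Z Z'\<rbrakk>
      \<Longrightarrow> braiding C Y' Z' \<cdot> (f \<boxtimes> g) = (g \<boxtimes> f) \<cdot> braiding C Y Z"
    and braiding_hexagon: "braiding C Y (Z \<boxdot> W)
      = (idm C Z \<boxtimes> braiding C Y W) \<cdot> (braiding C Y Z \<boxtimes> idm C W)"
    and braiding_symmetric: "braiding C Z Y \<cdot> braiding C Y Z = idm C (Y \<boxdot> Z)"

section \<open>Tensor ideals and quotients\<close>

definition tensor_ideal :: "('o, 'm, 'k::field) lin_cat \<Rightarrow> ('o \<Rightarrow> 'o \<Rightarrow> 'm set) \<Rightarrow> bool"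
  where "tensor_ideal C I \<longleftrightarrow>
    (\<forall>Y Z. subspace class_ring (I Y Z) (Hom C Y Z)) \<and>
    (\<forall>Y Z W f g. f \<in> I Y Z \<longrightarrow> g \<in> mor C Z W \<longrightarrow> g \<cdot>\<^bsub>C\<^esub> f \<in> I Y W) \<and>
    (\<forall>Y Z W f g. f \<in> mor C Y Z \<longrightarrow> g \<in> I Z W \<longrightarrow> g \<cdot>\<^bsub>C\<^esub> f \<in> I Y W) \<and>
    (\<forall>Y Z W f. f \<in> I Y Z \<longrightarrow> idm C W \<boxtimes>\<^bsub>C\<^esub> f \<in> I (W \<boxdot>\<^bsub>C\<^esub> Y) (W \<boxdot>\<^bsub>C\<^esub> Z)) \<and>
    (\<forall>Y Z W f. f \<in> I Y Z \<longrightarrow> f \<boxtimes>\<^bsub>C\<^esub> idm C W \<in> I (Y \<boxdot>\<^bsub>C\<^esub> W) (Z \<boxdot>\<^bsub>C\<^esub> W))"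

definition quot_module :: "('k, 'm) module \<Rightarrow> 'm set \<Rightarrow> ('k, 'm set) module"
  where "quot_module V N =
    \<lparr>carrier = a_rcosets\<^bsub>V\<^esub> N, mult = undefined, one = undefined,
     zero = N, add = set_add V,
     smult = (\<lambda>c A. \<Union>a\<in>A. N +>\<^bsub>V\<^esub> (c \<odot>\<^bsub>V\<^esub> a))\<rparr>"

text \<open>The image in \<open>C/I\<close> of a morphism \<open>f\<close> of \<open>C\<close>; the union has exactly one
  nonempty member, since \<open>f\<close> determines its source and target.\<close>

definition proj :: "('o, 'm, 'k) lin_cat \<Rightarrow> ('o \<Rightarrow> 'o \<Rightarrow> 'm set) \<Rightarrow> 'm \<Rightarrow> 'm set"
  where "proj C I f = \<Union>{I Y Z +>\<^bsub>Hom C Y Z\<^esub> f | Y Z. f \<in> mor C Y Z}"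

definition quot_cat ::
  "('o, 'm, 'k) lin_cat \<Rightarrow> ('o \<Rightarrow> 'o \<Rightarrow> 'm set) \<Rightarrow> ('o, 'm set, 'k) lin_cat"
  where "quot_cat C I =
    \<lparr>Hom = (\<lambda>Y Z. quot_module (Hom C Y Z) (I Y Z)),
     cmp = (\<lambda>B A. \<Union>b\<in>B. \<Union>a\<in>A. proj C I (b \<cdot>\<^bsub>C\<^esub> a)),
     idm = (\<lambda>Y. proj C I (idm C Y)),
     otens = otens C,
     ounit = ounit C,
     tens = (\<lambda>A B. \<Union>a\<in>A. \<Union>b\<in>B. proj C I (a \<boxtimes>\<^bsub>C\<^esub> b)),
     braiding = (\<lambda>Y Z. proj C I (braiding C Y Z))\<rparr>"

section \<open>Vector product algebra objects\<close>

locale vector_product_algebra = symmetric_monoidal_lin_cat +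
  fixes V and m and \<eta> and \<epsilon>
  assumes mult_mor: "m \<in> mor C (V \<boxdot> V) V"
    and cup_mor: "\<eta> \<in> mor C (ounit C) (V \<boxdot> V)"
    and cap_mor: "\<epsilon> \<in> mor C (V \<boxdot> V) (ounit C)"
    and zigzag_left: "(\<epsilon> \<boxtimes> idm C V) \<cdot> (idm C V \<boxtimes> \<eta>) = idm C V"
    and zigzag_right: "(idm C V \<boxtimes> \<epsilon>) \<cdot> (\<eta> \<boxtimes> idm C V) = idm C V"
    and mult_rotate: "(idm C V \<boxtimes> m) \<cdot> (\<eta> \<boxtimes> idm C V) = (m \<boxtimes> idm C V) \<cdot> (idm C V \<boxtimes> \<eta>)"
    and cap_slide: "(idm C V \<boxtimes> \<epsilon>) \<cdot> (braiding C V V \<boxtimes> idm C V)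
      = (\<epsilon> \<boxtimes> idm C V) \<cdot> (idm C V \<boxtimes> braiding C V V)"
    and cap_symmetric: "\<epsilon> \<cdot> braiding C V V = \<epsilon>"
    and mult_skew: "m \<cdot> braiding C V V = \<ominus>\<^bsub>Hom C (V \<boxdot> V) V\<^esub> m"
    and vector_product:
      "m \<cdot> (m \<boxtimes> idm C V) \<oplus>\<^bsub>Hom C (V \<boxdot> V \<boxdot> V) V\<^esub> m \<cdot> (idm C V \<boxtimes> m)
       = 2 \<odot>\<^bsub>Hom C (V \<boxdot> V \<boxdot> V) V\<^esub> ((idm C V \<boxtimes> \<epsilon>) \<cdot> (braiding C V V \<boxtimes> idm C V))
         \<ominus>\<^bsub>Hom C (V \<boxdot> V \<boxdot> V) V\<^esub> (idm C V \<boxtimes> \<epsilon>)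
         \<ominus>\<^bsub>Hom C (V \<boxdot> V \<boxdot> V) V\<^esub> (\<epsilon> \<boxtimes> idm C V)"

section \<open>The category \<open>T(\<delta>,\<alpha>)\<close>\<close>

text \<open>The object \<open>X\<^sup>\<otimes>\<^sup>n\<close> is the number \<open>n\<close>; in particular \<open>X\<close> is 1 and the unit object is 0.
  Morphisms are formal expressions in the generators modulo the least congruence
  containing the axioms of a strict linear monoidal category and the defining relations.\<close>

datatype 'k expr =
    EId nat
  | EMult
  | ESwap
  | ECup
  | ECap
  | EComp "'k expr" "'k expr"
  | ETens "'k expr" "'k expr"
  | EZero nat nat
  | EAdd "'k expr" "'k expr"
  | EScale 'k "'k expr"

inductive typed :: "'k expr \<Rightarrow> nat \<Rightarrow> nat \<Rightarrow> bool"
  where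
    "typed (EId n) n n"
  | "typed EMult 2 1"
  | "typed ESwap 2 2"
  | "typed ECup 0 2"
  | "typed ECap 2 0"
  | "\<lbrakk>typed t k l; typed u n k\<rbrakk> \<Longrightarrow> typed (EComp t u) n l"
  | "\<lbrakk>typed t k l; typed u n p\<rbrakk> \<Longrightarrow> typed (ETens t u) (k + n) (l + p)"
  | "typed (EZero n k) n k"
  | "\<lbrakk>typed t n k; typed u n k\<rbrakk> \<Longrightarrow> typed (EAdd t u) n k"
  | "typed t n k \<Longrightarrow> typed (EScale c t) n k"

abbreviation EIdX :: "'k expr"
  where "EIdX \<equiv> EId 1"

abbreviation ESigma :: "'k expr"
  where "ESigma \<equiv> EComp (ETens EIdX EMult) (ETens ECup EIdX)"

inductive T_rel :: "'k::field \<Rightarrow> 'k \<Rightarrow> 'k expr \<Rightarrow> 'k expr \<Rightarrow> bool" for \<delta> \<alpha>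
  where
    "T_rel \<delta> \<alpha> (EComp (ETens ECap EIdX) (ETens EIdX ECup)) EIdX"
  | "T_rel \<delta> \<alpha> (EComp (ETens EIdX ECap) (ETens ECup EIdX)) EIdX"
  | "T_rel \<delta> \<alpha> ESigma (EComp (ETens EMult EIdX) (ETens EIdX ECup))"
  | "T_rel \<delta> \<alpha> (EComp (ETens EIdX ECap) (ETens ESwap EIdX)) (EComp (ETens ECap EIdX) (ETens EIdX ESwap))"
  | "T_rel \<delta> \<alpha> (EComp ESwap ESwap) (ETens EIdX EIdX)"
  | "T_rel \<delta> \<alpha> (EComp (ETens ESwap EIdX) (EComp (ETens EIdX ESwap) (ETens ESwap EIdX)))
               (EComp (ETens EIdX ESwap) (EComp (ETens ESwap EIdX) (ETens EIdX ESwap)))"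
  | "T_rel \<delta> \<alpha> (EComp (ETens EIdX EMult) (EComp (ETens ESwap EIdX) (ETens EIdX ESwap)))
               (EComp ESwap (ETens EMult EIdX))"
  | "T_rel \<delta> \<alpha> (EComp (ETens EIdX ESwap) (EComp (ETens ESwap EIdX) (ETens EIdX ESigma)))
               (EComp (ETens ESigma EIdX) ESwap)"
  | "T_rel \<delta> \<alpha> (EComp ECap ESwap) ECap"
  | "T_rel \<delta> \<alpha> (EComp EMult ESwap) (EScale (- 1) EMult)"
  | "T_rel \<delta> \<alpha> (EComp EMult ESigma) (EScale \<alpha> EIdX)"
  | "T_rel \<delta> \<alpha> (EComp ECap ECup) (EScale \<delta> (EId 0))"

inductive T_eq :: "'k::field \<Rightarrow> 'k \<Rightarrow> 'k expr \<Rightarrow> 'k expr \<Rightarrow> bool" for \<delta> \<alpha>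
  where
    \<comment> \<open>equivalence relation, containing the defining relations\<close>
    "typed t n k \<Longrightarrow> T_eq \<delta> \<alpha> t t"
  | "T_eq \<delta> \<alpha> t u \<Longrightarrow> T_eq \<delta> \<alpha> u t"
  | "\<lbrakk>T_eq \<delta> \<alpha> t u; T_eq \<delta> \<alpha> u v\<rbrakk> \<Longrightarrow> T_eq \<delta> \<alpha> t v"
  | "T_rel \<delta> \<alpha> t u \<Longrightarrow> T_eq \<delta> \<alpha> t u"
    \<comment> \<open>compatibility with the operations\<close>
  | "\<lbrakk>T_eq \<delta> \<alpha> t t'; T_eq \<delta> \<alpha> u u'; typed t k l; typed u n k\<rbrakk>
      \<Longrightarrow> T_eq \<delta> \<alpha> (EComp t u) (EComp t' u')"
  | "\<lbrakk>T_eq \<delta> \<alpha> t t'; T_eq \<delta> \<alpha> u u'\<rbrakk> \<Longrightarrow> T_eq \<delta> \<alpha> (ETens t u) (ETens t' u')"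
  | "\<lbrakk>T_eq \<delta> \<alpha> t t'; T_eq \<delta> \<alpha> u u'; typed t n k; typed u n k\<rbrakk>
      \<Longrightarrow> T_eq \<delta> \<alpha> (EAdd t u) (EAdd t' u')"
  | "T_eq \<delta> \<alpha> t t' \<Longrightarrow> T_eq \<delta> \<alpha> (EScale c t) (EScale c t')"
    \<comment> \<open>vector spaces of morphisms\<close>
  | "\<lbrakk>typed t n k; typed u n k; typed v n k\<rbrakk>
      \<Longrightarrow> T_eq \<delta> \<alpha> (EAdd (EAdd t u) v) (EAdd t (EAdd u v))"
  | "\<lbrakk>typed t n k; typed u n k\<rbrakk> \<Longrightarrow> T_eq \<delta> \<alpha> (EAdd t u) (EAdd u t)"
  | "typed t n k \<Longrightarrow> T_eq \<delta> \<alpha> (EAdd t (EZero n k)) t"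
  | "typed t n k \<Longrightarrow> T_eq \<delta> \<alpha> (EAdd t (EScale (- 1) t)) (EZero n k)"
  | "\<lbrakk>typed t n k; typed u n k\<rbrakk>
      \<Longrightarrow> T_eq \<delta> \<alpha> (EScale c (EAdd t u)) (EAdd (EScale c t) (EScale c u))"
  | "typed t n k \<Longrightarrow> T_eq \<delta> \<alpha> (EScale (c + d) t) (EAdd (EScale c t) (EScale d t))"
  | "typed t n k \<Longrightarrow> T_eq \<delta> \<alpha> (EScale (c * d) t) (EScale c (EScale d t))"
  | "typed t n k \<Longrightarrow> T_eq \<delta> \<alpha> (EScale 1 t) t"
    \<comment> \<open>category\<close>
  | "typed t n k \<Longrightarrow> T_eq \<delta> \<alpha> (EComp t (EId n)) t"
  | "typed t n k \<Longrightarrow> T_eq \<delta> \<alpha> (EComp (EId k) t) t"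
  | "\<lbrakk>typed t l p; typed u k l; typed v n k\<rbrakk>
      \<Longrightarrow> T_eq \<delta> \<alpha> (EComp (EComp t u) v) (EComp t (EComp u v))"
    \<comment> \<open>strict monoidal structure\<close>
  | "T_eq \<delta> \<alpha> (ETens (EId n) (EId k)) (EId (n + k))"
  | "\<lbrakk>typed t k l; typed u n k; typed t' k' l'; typed u' n' k'\<rbrakk>
      \<Longrightarrow> T_eq \<delta> \<alpha> (EComp (ETens t t') (ETens u u')) (ETens (EComp t u) (EComp t' u'))"
  | "\<lbrakk>typed t n k; typed u n' k'; typed v n'' k''\<rbrakk>
      \<Longrightarrow> T_eq \<delta> \<alpha> (ETens (ETens t u) v) (ETens t (ETens u v))"
  | "typed t n k \<Longrightarrow> T_eq \<delta> \<alpha> (ETens (EId 0) t) t"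
  | "typed t n k \<Longrightarrow> T_eq \<delta> \<alpha> (ETens t (EId 0)) t"
    \<comment> \<open>bilinearity of composition and tensor product\<close>
  | "\<lbrakk>typed t k l; typed t' k l; typed u n k\<rbrakk>
      \<Longrightarrow> T_eq \<delta> \<alpha> (EComp (EAdd t t') u) (EAdd (EComp t u) (EComp t' u))"
  | "\<lbrakk>typed t k l; typed u n k; typed u' n k\<rbrakk>
      \<Longrightarrow> T_eq \<delta> \<alpha> (EComp t (EAdd u u')) (EAdd (EComp t u) (EComp t u'))"
  | "\<lbrakk>typed t k l; typed u n k\<rbrakk> \<Longrightarrow> T_eq \<delta> \<alpha> (EComp (EScale c t) u) (EScale c (EComp t u))"
  | "\<lbrakk>typed t k l; typed u n k\<rbrakk> \<Longrightarrow> T_eq \<delta> \<alpha> (EComp t (EScale c u)) (EScale c (EComp t u))"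
  | "\<lbrakk>typed t n k; typed t' n k; typed u n' k'\<rbrakk>
      \<Longrightarrow> T_eq \<delta> \<alpha> (ETens (EAdd t t') u) (EAdd (ETens t u) (ETens t' u))"
  | "\<lbrakk>typed t n k; typed u n' k'; typed u' n' k'\<rbrakk>
      \<Longrightarrow> T_eq \<delta> \<alpha> (ETens t (EAdd u u')) (EAdd (ETens t u) (ETens t u'))"
  | "\<lbrakk>typed t n k; typed u n' k'\<rbrakk> \<Longrightarrow> T_eq \<delta> \<alpha> (ETens (EScale c t) u) (EScale c (ETens t u))"
  | "\<lbrakk>typed t n k; typed u n' k'\<rbrakk> \<Longrightarrow> T_eq \<delta> \<alpha> (ETens t (EScale c u)) (EScale c (ETens t u))"

text \<open>The braiding built from the generator \<open>s\<close>: first moving one strand past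
  \<open>k\<close> strands, then \<open>n\<close> strands past \<open>k\<close> strands.\<close>

primrec EBraid1 :: "nat \<Rightarrow> 'k expr"
  where
    "EBraid1 0 = EIdX"
  | "EBraid1 (Suc k) = EComp (ETens (EId k) ESwap) (ETens (EBraid1 k) EIdX)"

primrec EBraid :: "nat \<Rightarrow> nat \<Rightarrow> 'k expr"
  where
    "EBraid 0 k = EId k"
  | "EBraid (Suc n) k = EComp (ETens (EBraid n k) EIdX) (ETens (EId n) (EBraid1 k))"

definition T_class :: "'k::field \<Rightarrow> 'k \<Rightarrow> 'k expr \<Rightarrow> 'k expr set"
  where "T_class \<delta> \<alpha> t = {u. T_eq \<delta> \<alpha> t u}"

definition T_cat :: "'k::field \<Rightarrow> 'k \<Rightarrow> (nat, 'k expr set, 'k) lin_cat"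
  where "T_cat \<delta> \<alpha> =
    \<lparr>Hom = (\<lambda>n k. \<lparr>carrier = {T_class \<delta> \<alpha> t | t. typed t n k},
       mult = undefined, one = undefined,
       zero = T_class \<delta> \<alpha> (EZero n k),
       add = (\<lambda>A B. \<Union>t\<in>A. \<Union>u\<in>B. T_class \<delta> \<alpha> (EAdd t u)),
       smult = (\<lambda>c A. \<Union>t\<in>A. T_class \<delta> \<alpha> (EScale c t))\<rparr>),
     cmp = (\<lambda>A B. \<Union>t\<in>A. \<Union>u\<in>B. T_class \<delta> \<alpha> (EComp t u)),
     idm = (\<lambda>n. T_class \<delta> \<alpha> (EId n)),
     otens = (+),
     ounit = 0,
     tens = (\<lambda>A B. \<Union>t\<in>A. \<Union>u\<in>B. T_class \<delta> \<alpha> (ETens t u)),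
     braiding = (\<lambda>n k. T_class \<delta> \<alpha> (EBraid n k))\<rparr>"

definition T_m :: "'k::field \<Rightarrow> 'k \<Rightarrow> 'k expr set"
  where "T_m \<delta> \<alpha> = T_class \<delta> \<alpha> EMult"

definition T_s :: "'k::field \<Rightarrow> 'k \<Rightarrow> 'k expr set"
  where "T_s \<delta> \<alpha> = T_class \<delta> \<alpha> ESwap"

definition T_cup :: "'k::field \<Rightarrow> 'k \<Rightarrow> 'k expr set"
  where "T_cup \<delta> \<alpha> = T_class \<delta> \<alpha> ECup"

definition T_cap :: "'k::field \<Rightarrow> 'k \<Rightarrow> 'k expr set"
  where "T_cap \<delta> \<alpha> = T_class \<delta> \<alpha> ECap"

definition T_sigma :: "'k::field \<Rightarrow> 'k \<Rightarrow> 'k expr set"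
  where "T_sigma \<delta> \<alpha> =
    (idm (T_cat \<delta> \<alpha>) 1 \<boxtimes>\<^bsub>T_cat \<delta> \<alpha>\<^esub> T_m \<delta> \<alpha>) \<cdot>\<^bsub>T_cat \<delta> \<alpha>\<^esub> (T_cup \<delta> \<alpha> \<boxtimes>\<^bsub>T_cat \<delta> \<alpha>\<^esub> idm (T_cat \<delta> \<alpha>) 1)"

definition T_K :: "'k::field \<Rightarrow> 'k \<Rightarrow> 'k expr set"
  where "T_K \<delta> \<alpha> = T_sigma \<delta> \<alpha> \<cdot>\<^bsub>T_cat \<delta> \<alpha>\<^esub> T_m \<delta> \<alpha>"

text \<open>This equals \<open>(1 \<otimes> m) (\<sigma> \<otimes> 1)\<close>, by the two expressions for \<open>\<sigma>\<close>.\<close>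

definition T_H :: "'k::field \<Rightarrow> 'k \<Rightarrow> 'k expr set"
  where "T_H \<delta> \<alpha> =
    (T_m \<delta> \<alpha> \<boxtimes>\<^bsub>T_cat \<delta> \<alpha>\<^esub> idm (T_cat \<delta> \<alpha>) 1) \<cdot>\<^bsub>T_cat \<delta> \<alpha>\<^esub> (idm (T_cat \<delta> \<alpha>) 1 \<boxtimes>\<^bsub>T_cat \<delta> \<alpha>\<^esub> T_sigma \<delta> \<alpha>)"

end

theory Submission
  imports Defs
begin

text \<open>Write \<open>U = \<eta> \<epsilon>\<close>.  In the quotient the endomorphisms of \<open>X \<otimes> X\<close> form a space of dimension
  four, so the five diagrams \<open>1, s, U, K, H\<close> satisfy a nontrivial linear relation
  \<open>a 1 + b s + c U + d K + e H = 0\<close>.  Three operations act on relations among these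
  diagrams and \<open>s H\<close>:

  \<^item> rotation by a quarter turn, which exchanges \<open>1\<close> with \<open>U\<close> and \<open>K\<close> with \<open>H\<close>, fixes \<open>s\<close> and
    negates \<open>s H\<close> (\<open>rotate_comb\<close>);
  \<^item> composition with \<open>s\<close>, which exchanges \<open>1\<close> with \<open>s\<close> and \<open>H\<close> with \<open>s H\<close>, fixes \<open>U\<close> and
    negates \<open>K\<close> (\<open>s_comb\<close>);
  \<^item> composition with \<open>\<epsilon>\<close>, which yields the scalar equation \<open>a + b + \<delta> c + \<alpha> e = 0\<close> when \<open>s H\<close>
    does not occur (\<open>cap_comb\<close>).

  Composing with \<open>s\<close>, rotating the result, and adding both relations cancels \<open>s H\<close> and leaves the
  coefficients \<open>(b + c, 2a, b + c, -d, -d)\<close>.  Applied to a relation \<open>(p, q, p, r, r)\<close> and added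
  to it, this step gives \<open>(q + 2p) (1 + s + U) = 0\<close>, whence \<open>(q + 2p) (2 + \<delta>) = 0\<close> by capping off
  and \<open>q = -2p\<close> because \<open>\<delta> \<noteq> -2\<close>.  Capping off the relation \<open>(p, -2p, p, r, r)\<close> gives
  \<open>p (1 - \<delta>) = \<alpha> r\<close>.  If \<open>r \<noteq> 0\<close> this proves \<open>\<delta> \<noteq> 1\<close>, and the relation is a multiple of the
  desired one.  Some relation has \<open>r \<noteq> 0\<close>: otherwise \<open>1, s, U\<close> would be dependent, which rotation,
  capping off and composition with \<open>m\<close> exclude (\<open>five_diagrams_relation\<close>).

  Bending a leg of a diagram turns \<open>K\<close> and \<open>H\<close> into \<open>m (m \<otimes> 1)\<close> and \<open>m (1 \<otimes> m)\<close>, so the relation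
  becomes the vector product identity once \<open>\<epsilon>\<close> is multiplied by \<open>\<alpha> / (1 - \<delta>)\<close> and \<open>\<eta>\<close> by its
  inverse (\<open>vector_product_algebra_if_skein\<close>).

  These calculations take place in an arbitrary strict linear monoidal category with object
  monoid \<open>(\<nat>, +)\<close> in which \<open>m, s, \<eta>, \<epsilon>\<close> satisfy the relations of \<open>T(\<delta>,\<alpha>)\<close>.  They apply to the
  quotient because the relations descend from \<open>T(\<delta>,\<alpha>)\<close> along the projection, which is a strict
  monoidal functor (\<open>quotient_trivalent_algebra\<close>).  A vector product algebra also requires a
  symmetric braiding: in \<open>T(\<delta>,\<alpha>)\<close> the morphisms that slide through a strand are closed under all
  operations and contain the generators (\<open>T_symmetric\<close>), and the braiding descends to the quotient
  (\<open>quotient_symmetric\<close>).\<close>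

(* Numbers of strands are written as numerals; normalising them to Suc-terms would keep the
   arithmetic side conditions of the diagrammatic rewrite rules from matching. *)
declare One_nat_def [simp del] One_nat_def [symmetric, simp]
  add_2_eq_Suc [simp del] add_2_eq_Suc' [simp del]

section \<open>Source and target of a morphism\<close>

context strict_monoidal_lin_cat
begin

text \<open>A morphism determines its source and target.  Expressing typing by the total functions below,
  instead of by membership in a hom space, lets the simplifier discharge the side conditions of the
  category laws by computation.\<close>

definition arr :: "'m \<Rightarrow> bool"
  where "arr f \<longleftrightarrow> (\<exists>Y Z. f \<in> mor C Y Z)"

definition src :: "'m \<Rightarrow> 'o"
  where "src f = (THE Y. \<exists>Z. f \<in> mor C Y Z)"

definition tgt :: "'m \<Rightarrow> 'o"
  where "tgt f = (THE Z. \<exists>Y. f \<in> mor C Y Z)"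

lemma src_eq: "f \<in> mor C Y Z \<Longrightarrow> src f = Y"
  unfolding src_def using hom_disjoint by blast

lemma tgt_eq: "f \<in> mor C Y Z \<Longrightarrow> tgt f = Z"
  unfolding tgt_def using hom_disjoint by blast

lemma mor_iff: "f \<in> mor C Y Z \<longleftrightarrow> arr f \<and> src f = Y \<and> tgt f = Z"
  using src_eq tgt_eq unfolding arr_def by blast

lemma arr_mor: "arr f \<Longrightarrow> f \<in> mor C (src f) (tgt f)"
  by (simp add: mor_iff)

lemma arr_idm [simp]: "arr (idm C Y)" "src (idm C Y) = Y" "tgt (idm C Y) = Y"
  using idm_mor mor_iff by blast+

lemma arr_cmp [simp]:
  assumes "arr f" "arr g" "tgt f = src g"
  shows "arr (g \<cdot> f)" "src (g \<cdot> f) = src f" "tgt (g \<cdot> f) = tgt g"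
proof -
  have "g \<cdot> f \<in> mor C (src f) (tgt g)"
    using assms cmp_mor[of f "src f" "tgt f" g "tgt g"] by (simp add: mor_iff)
  then show "arr (g \<cdot> f)" "src (g \<cdot> f) = src f" "tgt (g \<cdot> f) = tgt g"
    using mor_iff by blast+
qed

lemma arr_tens [simp]:
  assumes "arr f" "arr g"
  shows "arr (f \<boxtimes> g)" "src (f \<boxtimes> g) = src f \<boxdot> src g" "tgt (f \<boxtimes> g) = tgt f \<boxdot> tgt g"
proof -
  have "f \<boxtimes> g \<in> mor C (src f \<boxdot> src g) (tgt f \<boxdot> tgt g)"
    using assms by (intro tens_mor arr_mor)
  then show "arr (f \<boxtimes> g)" "src (f \<boxtimes> g) = src f \<boxdot> src g" "tgt (f \<boxtimes> g) = tgt f \<boxdot> tgt g"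
    using mor_iff by blast+
qed

lemma hom_module: "Module.module class_ring (Hom C Y Z)"
  using hom_vectorspace by (rule vectorspace.axioms)

lemma arr_smult [simp]:
  assumes "arr f" "src f = Y" "tgt f = Z"
  shows "arr (c \<odot>\<^bsub>Hom C Y Z\<^esub> f)" "src (c \<odot>\<^bsub>Hom C Y Z\<^esub> f) = Y" "tgt (c \<odot>\<^bsub>Hom C Y Z\<^esub> f) = Z"
proof -
  have "c \<odot>\<^bsub>Hom C Y Z\<^esub> f \<in> mor C Y Z"
    using Module.module.smult_closed[OF hom_module, of c f] assms by (simp add: mor_iff)
  then show "arr (c \<odot>\<^bsub>Hom C Y Z\<^esub> f)" "src (c \<odot>\<^bsub>Hom C Y Z\<^esub> f) = Y" "tgt (c \<odot>\<^bsub>Hom C Y Z\<^esub> f) = Z"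
    using mor_iff by blast+
qed

lemma arr_add [simp]:
  assumes "arr f" "src f = Y" "tgt f = Z" "arr g" "src g = Y" "tgt g = Z"
  shows "arr (f \<oplus>\<^bsub>Hom C Y Z\<^esub> g)" "src (f \<oplus>\<^bsub>Hom C Y Z\<^esub> g) = Y" "tgt (f \<oplus>\<^bsub>Hom C Y Z\<^esub> g) = Z"
proof -
  interpret M: Module.module class_ring "Hom C Y Z" by (rule hom_module)
  have "f \<oplus>\<^bsub>Hom C Y Z\<^esub> g \<in> mor C Y Z"
    using assms by (intro M.add.m_closed) (simp_all add: mor_iff)
  then show "arr (f \<oplus>\<^bsub>Hom C Y Z\<^esub> g)" "src (f \<oplus>\<^bsub>Hom C Y Z\<^esub> g) = Y" "tgt (f \<oplus>\<^bsub>Hom C Y Z\<^esub> g) = Z"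
    using mor_iff by blast+
qed

lemma comp_assoc:
  "\<lbrakk>arr f; arr g; arr h; tgt f = src g; tgt g = src h\<rbrakk> \<Longrightarrow> (h \<cdot> g) \<cdot> f = h \<cdot> (g \<cdot> f)"
  by (rule cmp_assoc[of f "src f" "tgt f" g "tgt g" h "tgt h"]) (simp_all add: mor_iff)

lemma comp_ident [simp]:
  "arr f \<Longrightarrow> src f = Y \<Longrightarrow> f \<cdot> idm C Y = f"
  "arr f \<Longrightarrow> tgt f = Y \<Longrightarrow> idm C Y \<cdot> f = f"
  using cmp_idm_right[of f "src f" "tgt f"] cmp_idm_left[of f "src f" "tgt f"] by (auto simp: mor_iff)

lemma tens_comp:
  "\<lbrakk>arr f; arr g; arr f'; arr g'; tgt f = src g; tgt f' = src g'\<rbrakk>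
    \<Longrightarrow> (g \<cdot> f) \<boxtimes> (g' \<cdot> f') = (g \<boxtimes> g') \<cdot> (f \<boxtimes> f')"
  using interchange[of f "src f" "tgt f" g "tgt g" f' "src f'" "tgt f'" g' "tgt g'"] by (simp add: mor_iff)

lemma tensor_assoc: "\<lbrakk>arr f; arr g; arr h\<rbrakk> \<Longrightarrow> (f \<boxtimes> g) \<boxtimes> h = f \<boxtimes> (g \<boxtimes> h)"
  by (rule tens_assoc[OF arr_mor arr_mor arr_mor])

lemma tensor_unit [simp]: "arr f \<Longrightarrow> idm C (ounit C) \<boxtimes> f = f" "arr f \<Longrightarrow> f \<boxtimes> idm C (ounit C) = f"
  by (rule tens_unit_left[OF arr_mor] tens_unit_right[OF arr_mor], assumption)+

text \<open>Evaluating on \<open>idm C Y\<close> proves this.  Equations between diagrams are stated below in the form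
  \<open>f \<cdot> g \<cdot> x = h \<cdot> x\<close> for arbitrary \<open>x\<close>: in a composite bracketed to the right they rewrite any
  consecutive factors without reassociation.\<close>

lemma arr_eqI:
  assumes "arr f" "arr g" "src f = Y" "src g = Y"
    and "\<And>x. arr x \<Longrightarrow> tgt x = Y \<Longrightarrow> f \<cdot> x = g \<cdot> x"
  shows "f = g"
  using assms(5)[of "idm C Y"] assms by simp

lemma comp_smult:
  "\<lbrakk>arr f; arr g; tgt f = src g; src g = n; tgt g = k\<rbrakk>
    \<Longrightarrow> (c \<odot>\<^bsub>Hom C n k\<^esub> g) \<cdot> f = c \<odot>\<^bsub>Hom C (src f) k\<^esub> (g \<cdot> f)"
  "\<lbrakk>arr f; arr g; tgt f = src g; src f = n; tgt f = k\<rbrakk>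
    \<Longrightarrow> g \<cdot> (c \<odot>\<^bsub>Hom C n k\<^esub> f) = c \<odot>\<^bsub>Hom C n (tgt g)\<^esub> (g \<cdot> f)"
  using cmp_smult_left[of f "src f" n g k c] cmp_smult_right[of f n k g "tgt g" c] by (simp_all add: mor_iff)

lemma comp_add:
  "\<lbrakk>arr f; arr g; arr h; tgt f = n; src g = n; tgt g = k; src h = n; tgt h = k\<rbrakk>
    \<Longrightarrow> (g \<oplus>\<^bsub>Hom C n k\<^esub> h) \<cdot> f = g \<cdot> f \<oplus>\<^bsub>Hom C (src f) k\<^esub> h \<cdot> f"
  "\<lbrakk>arr f; arr g; arr h; src g = k; src f = n; tgt f = k; src h = n; tgt h = k\<rbrakk>
    \<Longrightarrow> g \<cdot> (f \<oplus>\<^bsub>Hom C n k\<^esub> h) = g \<cdot> f \<oplus>\<^bsub>Hom C n (tgt g)\<^esub> g \<cdot> h"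
  using cmp_add_left[of f "src f" n g k h] cmp_add_right[of f n k h g "tgt g"] by (simp_all add: mor_iff)

lemma tensor_smult:
  "\<lbrakk>arr f; arr g; src f = n; tgt f = k\<rbrakk>
    \<Longrightarrow> (c \<odot>\<^bsub>Hom C n k\<^esub> f) \<boxtimes> g = c \<odot>\<^bsub>Hom C (n \<boxdot> src g) (k \<boxdot> tgt g)\<^esub> (f \<boxtimes> g)"
  "\<lbrakk>arr f; arr g; src g = n; tgt g = k\<rbrakk>
    \<Longrightarrow> f \<boxtimes> (c \<odot>\<^bsub>Hom C n k\<^esub> g) = c \<odot>\<^bsub>Hom C (src f \<boxdot> n) (tgt f \<boxdot> k)\<^esub> (f \<boxtimes> g)"
  using tens_smult_left[of f n k g "src g" "tgt g" c] tens_smult_right[of f "src f" "tgt f" g n k c]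
  by (simp_all add: mor_iff)

lemma tensor_add:
  "\<lbrakk>arr f; arr f'; arr g; src f = n; tgt f = k; src f' = n; tgt f' = k\<rbrakk>
    \<Longrightarrow> (f \<oplus>\<^bsub>Hom C n k\<^esub> f') \<boxtimes> g = f \<boxtimes> g \<oplus>\<^bsub>Hom C (n \<boxdot> src g) (k \<boxdot> tgt g)\<^esub> f' \<boxtimes> g"
  "\<lbrakk>arr f; arr g; arr g'; src g = n; tgt g = k; src g' = n; tgt g' = k\<rbrakk>
    \<Longrightarrow> f \<boxtimes> (g \<oplus>\<^bsub>Hom C n k\<^esub> g') = f \<boxtimes> g \<oplus>\<^bsub>Hom C (src f \<boxdot> n) (tgt f \<boxdot> k)\<^esub> f \<boxtimes> g'"
  using tens_add_left[of f n k f' g "src g" "tgt g"] tens_add_right[of f "src f" "tgt f" g n k g']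
  by (simp_all add: mor_iff)

lemma smult_simps:
  assumes "arr f" "src f = n" "tgt f = k"
  shows smult_zero: "0 \<odot>\<^bsub>Hom C n k\<^esub> f = \<zero>\<^bsub>Hom C n k\<^esub>"
    and smult_one: "1 \<odot>\<^bsub>Hom C n k\<^esub> f = f"
    and smult_smult: "a \<odot>\<^bsub>Hom C n k\<^esub> (b \<odot>\<^bsub>Hom C n k\<^esub> f) = (a * b) \<odot>\<^bsub>Hom C n k\<^esub> f"
    and smult_plus: "(a + b) \<odot>\<^bsub>Hom C n k\<^esub> f = a \<odot>\<^bsub>Hom C n k\<^esub> f \<oplus>\<^bsub>Hom C n k\<^esub> b \<odot>\<^bsub>Hom C n k\<^esub> f"
proof -
  interpret M: Module.module class_ring "Hom C n k" by (rule hom_module)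
  have f: "f \<in> mor C n k"
    using assms by (simp add: mor_iff)
  show "0 \<odot>\<^bsub>Hom C n k\<^esub> f = \<zero>\<^bsub>Hom C n k\<^esub>" "1 \<odot>\<^bsub>Hom C n k\<^esub> f = f"
    using f M.smult_l_null M.smult_one by simp_all
  show "a \<odot>\<^bsub>Hom C n k\<^esub> (b \<odot>\<^bsub>Hom C n k\<^esub> f) = (a * b) \<odot>\<^bsub>Hom C n k\<^esub> f"
    using f M.smult_assoc1[of a b f] by simp
  show "(a + b) \<odot>\<^bsub>Hom C n k\<^esub> f = a \<odot>\<^bsub>Hom C n k\<^esub> f \<oplus>\<^bsub>Hom C n k\<^esub> b \<odot>\<^bsub>Hom C n k\<^esub> f"
    using f M.smult_l_distr[of a b f] by simp
qed

lemma neg_one_smult: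
  assumes "arr f" "src f = n" "tgt f = k"
  shows "(- 1) \<odot>\<^bsub>Hom C n k\<^esub> f = \<ominus>\<^bsub>Hom C n k\<^esub> f"
proof -
  interpret M: Module.module class_ring "Hom C n k" by (rule hom_module)
  show ?thesis
    using assms M.smult_l_minus[of 1 f] smult_one[of f n k] by (simp add: mor_iff class_ring_simps)
qed

lemma minus_smult:
  assumes "arr f" "src f = n" "tgt f = k" "arr g" "src g = n" "tgt g = k"
  shows "f \<ominus>\<^bsub>Hom C n k\<^esub> g = f \<oplus>\<^bsub>Hom C n k\<^esub> (- 1) \<odot>\<^bsub>Hom C n k\<^esub> g"
  using assms by (simp add: a_minus_def neg_one_smult)

lemma arr_minus [simp]:
  assumes "arr f" "src f = Y" "tgt f = Z" "arr g" "src g = Y" "tgt g = Z"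
  shows "arr (f \<ominus>\<^bsub>Hom C Y Z\<^esub> g)" "src (f \<ominus>\<^bsub>Hom C Y Z\<^esub> g) = Y" "tgt (f \<ominus>\<^bsub>Hom C Y Z\<^esub> g) = Z"
  using assms by (simp_all add: minus_smult)

lemma smult_eq_zeroD:
  assumes "c \<odot>\<^bsub>Hom C n k\<^esub> f = \<zero>\<^bsub>Hom C n k\<^esub>" "arr f" "src f = n" "tgt f = k" "f \<noteq> \<zero>\<^bsub>Hom C n k\<^esub>"
  shows "c = 0"
proof (rule ccontr)
  assume "c \<noteq> 0"
  interpret M: Module.module class_ring "Hom C n k" by (rule hom_module)
  have "f = inverse c \<odot>\<^bsub>Hom C n k\<^esub> (c \<odot>\<^bsub>Hom C n k\<^esub> f)"
    using assms(2-4) \<open>c \<noteq> 0\<close> by (simp add: smult_simps)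
  also have "\<dots> = \<zero>\<^bsub>Hom C n k\<^esub>"
    using assms(1) M.smult_r_null by simp
  finally show False
    using assms(5) by simp
qed

text \<open>The source of all vanishing statements such as \<open>m \<eta> = 0\<close>; it is the place where characteristic
  two has to be excluded.\<close>

lemma neg_self_zero:
  assumes "(2::'k) \<noteq> 0" "arr f" "src f = n" "tgt f = k" "f = (- 1) \<odot>\<^bsub>Hom C n k\<^esub> f"
  shows "f = \<zero>\<^bsub>Hom C n k\<^esub>"
proof (rule ccontr)
  assume "f \<noteq> \<zero>\<^bsub>Hom C n k\<^esub>"
  have "f \<oplus>\<^bsub>Hom C n k\<^esub> f = f \<oplus>\<^bsub>Hom C n k\<^esub> (- 1) \<odot>\<^bsub>Hom C n k\<^esub> f"
    using assms(5) by (rule arg_cong)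
  then have "(1 + 1) \<odot>\<^bsub>Hom C n k\<^esub> f = (1 + - 1) \<odot>\<^bsub>Hom C n k\<^esub> f"
    using assms(2-4) by (simp only: smult_plus smult_one)
  then show False
    using smult_eq_zeroD[where c = 2 and n = n and k = k and f = f] assms(1-4) \<open>f \<noteq> \<zero>\<^bsub>Hom C n k\<^esub>\<close> by (simp add: smult_zero)
qed

lemma zero_arr [simp]:
  "arr \<zero>\<^bsub>Hom C n k\<^esub>" "src \<zero>\<^bsub>Hom C n k\<^esub> = n" "tgt \<zero>\<^bsub>Hom C n k\<^esub> = k"
proof -
  interpret M: Module.module class_ring "Hom C n k" by (rule hom_module)
  show "arr \<zero>\<^bsub>Hom C n k\<^esub>" "src \<zero>\<^bsub>Hom C n k\<^esub> = n" "tgt \<zero>\<^bsub>Hom C n k\<^esub> = k"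
    using M.zero_closed mor_iff by blast+
qed

lemma comp_zero:
  "arr f \<Longrightarrow> tgt f = n \<Longrightarrow> \<zero>\<^bsub>Hom C n k\<^esub> \<cdot> f = \<zero>\<^bsub>Hom C (src f) k\<^esub>"
  "arr f \<Longrightarrow> src f = k \<Longrightarrow> f \<cdot> \<zero>\<^bsub>Hom C n k\<^esub> = \<zero>\<^bsub>Hom C n (tgt f)\<^esub>"
  using comp_smult(1)[of f "\<zero>\<^bsub>Hom C n k\<^esub>" n k 0] comp_smult(2)[of "\<zero>\<^bsub>Hom C n k\<^esub>" f n k 0]
  by (simp_all add: smult_zero)

text \<open>One generator \<open>f\<close> with identity strands to its left and right: a horizontal slice of a string
  diagram.\<close>

definition layer :: "'o \<Rightarrow> 'm \<Rightarrow> 'o \<Rightarrow> 'm"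
  where "layer Y f Z = idm C Y \<boxtimes> f \<boxtimes> idm C Z"

end

section \<open>String diagrams as composites of layers\<close>

locale linear_pro = strict_monoidal_lin_cat C for C :: "(nat, 'm, 'k::field) lin_cat" (structure) +
  assumes otens_add [simp]: "Y \<boxdot> Z = Y + Z"
    and ounit_zero [simp]: "ounit C = 0"
begin

lemma tensor_zero [simp]: "arr f \<Longrightarrow> idm C 0 \<boxtimes> f = f" "arr f \<Longrightarrow> f \<boxtimes> idm C 0 = f"
  using tensor_unit by simp_all

lemma idm_tens: "idm C i \<boxtimes> idm C j = idm C (i + j)"
  using tens_idm by simp

lemma arr_layer [simp]:
  "arr f \<Longrightarrow> arr (layer i f j)"
  "arr f \<Longrightarrow> src (layer i f j) = i + src f + j"
  "arr f \<Longrightarrow> tgt (layer i f j) = i + tgt f + j"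
  by (simp_all add: layer_def)

text \<open>Not a rewrite rule: with a generator always displayed as \<open>layer 0 f 0\<close>, the equations for general
  indices apply to it uniformly.\<close>

lemma layer_zero: "arr f \<Longrightarrow> layer 0 f 0 = f"
  by (simp add: layer_def)

lemma layer_idm [simp]: "layer i (idm C n) j = idm C (i + n + j)"
  by (simp add: layer_def idm_tens add.assoc)

lemma layer_layer [simp]: "arr f \<Longrightarrow> layer i (layer k f l) j = layer (i + k) f (l + j)"
  by (simp add: layer_def tensor_assoc flip: idm_tens)

lemma layer_comp:
  "\<lbrakk>arr f; arr g; tgt f = src g\<rbrakk> \<Longrightarrow> layer i (g \<cdot> f) j = layer i g j \<cdot> layer i f j"
  using tens_comp[of "idm C i" "idm C i" "f \<boxtimes> idm C j" "g \<boxtimes> idm C j"] 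
    tens_comp[of f g "idm C j" "idm C j"]
  by (simp add: layer_def)

lemma tens_layer: 
  "arr f \<Longrightarrow> idm C i \<boxtimes> f = layer i f 0"
  "arr f \<Longrightarrow> f \<boxtimes> idm C j = layer 0 f j"
  by (simp_all add: layer_def)

lemma tens_eq_layers: "arr f \<Longrightarrow> arr g \<Longrightarrow> f \<boxtimes> g = layer 0 f (tgt g) \<cdot> layer (src f) g 0"
  "arr f \<Longrightarrow> arr g \<Longrightarrow> f \<boxtimes> g = layer (tgt f) g 0 \<cdot> layer 0 f (src g)"
  using tens_comp[of "idm C (src f)" f g "idm C (tgt g)"]
   tens_comp[of f "idm C (tgt f)" "idm C (src g)" g]
  by (simp_all add: layer_def)

lemma layer_smult:
  assumes "arr f" "src f = n" "tgt f = k"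
  shows "layer i (c \<odot>\<^bsub>Hom C n k\<^esub> f) j = c \<odot>\<^bsub>Hom C (i + n + j) (i + k + j)\<^esub> layer i f j"
  using assms by (simp add: layer_def tensor_smult add.assoc)

lemma layer_add:
  assumes "arr f" "src f = n" "tgt f = k" "arr g" "src g = n" "tgt g = k"
  shows "layer i (f \<oplus>\<^bsub>Hom C n k\<^esub> g) j = layer i f j \<oplus>\<^bsub>Hom C (i + n + j) (i + k + j)\<^esub> layer i g j"
  using assms by (simp add: layer_def tensor_add add.assoc)

lemma layer_zero_mor: "layer i \<zero>\<^bsub>Hom C n k\<^esub> j = \<zero>\<^bsub>Hom C (i + n + j) (i + k + j)\<^esub>"
  using layer_smult[of "\<zero>\<^bsub>Hom C n k\<^esub>" n k i 0 j] by (simp add: smult_zero)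

text \<open>Both sides are two ways to cut \<open>f \<boxtimes> idm C l \<boxtimes> g\<close> into layers: generators on disjoint strands may
  change their order.\<close>

lemma exchange_comp:
  assumes "arr f" "arr g" "arr x" "i' = i + src f + l" "j = l + tgt g + j'"
    "tgt x = i' + src g + j'"
  shows "layer i f j \<cdot> layer i' g j' \<cdot> x
    = layer (i + tgt f + l) g j' \<cdot> layer i f (l + src g + j') \<cdot> x"
proof -
  have "f \<boxtimes> layer l g 0 = layer 0 f (l + tgt g) \<cdot> layer (src f + l) g 0"
    "f \<boxtimes> layer l g 0 = layer (tgt f + l) g 0 \<cdot> layer 0 f (l + src g)"
    using assms tens_eq_layers[of f "layer l g 0"] by simp_all
  then have "layer i (layer 0 f (l + tgt g) \<cdot> layer (src f + l) g 0) j' \<cdot> x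
    = layer i (layer (tgt f + l) g 0 \<cdot> layer 0 f (l + src g)) j' \<cdot> x"
    by simp
  then show ?thesis
    using assms by (simp add: layer_comp comp_assoc add.assoc)
qed

text \<open>The two orientations of the exchange law, with the widths on the right-hand side computed from
  those on the left.  In the first, \<open>f\<close> lies to the left of \<open>g\<close> and is moved before it.  Instantiated
  with specific generators they serve as terminating rewrite rules.\<close>

lemma swap_left_first:
  assumes "arr f" "arr g" "arr x" "i + src f \<le> i'" "i + src f + j = i' + tgt g + j'"
    "tgt x = i' + src g + j'"
  shows "layer i f j \<cdot> layer i' g j' \<cdot> x
    = layer (i' - src f + tgt f) g j' \<cdot> layer i f (j - tgt g + src g) \<cdot> x"
proof -
  obtain l where l: "i' = i + src f + l"
    using assms(4) le_Suc_ex by blast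
  then have "j = l + tgt g + j'"
    using assms(5) by simp
  then show ?thesis
    using exchange_comp[OF assms(1-3) l, of j j'] assms(6) l by (simp add: add_ac)
qed

lemma swap_right_first:
  assumes "arr f" "arr g" "arr x" "i' + tgt g \<le> i" "i + src f + j = i' + tgt g + j'"
    "tgt x = i' + src g + j'"
  shows "layer i f j \<cdot> layer i' g j' \<cdot> x
    = layer i' g (j' - src f + tgt f) \<cdot> layer (i - tgt g + src g) f j \<cdot> x"
proof -
  obtain l where l: "i = i' + tgt g + l"
    using assms(4) le_Suc_ex by blast
  then have "j' = l + src f + j"
    using assms(5) by simp
  then show ?thesis
    using exchange_comp[OF assms(2,1,3), of "i' + src g + l" i' l "l + tgt f + j" j] assms(6) l
    by (simp add: add_ac)
qed

lemma whisker: "f = g \<Longrightarrow> layer i f j \<cdot> x = layer i g j \<cdot> x"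
  by simp

end

section \<open>Trivalent objects\<close>

locale trivalent_object = linear_pro C for C :: "(nat, 'm, 'k::field) lin_cat" (structure) +
  fixes m s \<eta> \<epsilon> :: 'm
  assumes m_mor: "m \<in> mor C 2 1"
    and s_mor: "s \<in> mor C 2 2"
    and cup_mor: "\<eta> \<in> mor C 0 2"
    and cap_mor: "\<epsilon> \<in> mor C 2 0"
    and snake_left: "(\<epsilon> \<boxtimes> idm C 1) \<cdot> (idm C 1 \<boxtimes> \<eta>) = idm C 1"
    and snake_right: "(idm C 1 \<boxtimes> \<epsilon>) \<cdot> (\<eta> \<boxtimes> idm C 1) = idm C 1"
    and m_rotation: "(idm C 1 \<boxtimes> m) \<cdot> (\<eta> \<boxtimes> idm C 1) = (m \<boxtimes> idm C 1) \<cdot> (idm C 1 \<boxtimes> \<eta>)"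
    and cap_slide: "(idm C 1 \<boxtimes> \<epsilon>) \<cdot> (s \<boxtimes> idm C 1) = (\<epsilon> \<boxtimes> idm C 1) \<cdot> (idm C 1 \<boxtimes> s)"
    and s_involution: "s \<cdot> s = idm C 1 \<boxtimes> idm C 1"
    and s_braid: "(s \<boxtimes> idm C 1) \<cdot> (idm C 1 \<boxtimes> s) \<cdot> (s \<boxtimes> idm C 1)
      = (idm C 1 \<boxtimes> s) \<cdot> (s \<boxtimes> idm C 1) \<cdot> (idm C 1 \<boxtimes> s)"
    and m_slide: "(idm C 1 \<boxtimes> m) \<cdot> (s \<boxtimes> idm C 1) \<cdot> (idm C 1 \<boxtimes> s) = s \<cdot> (m \<boxtimes> idm C 1)"
    and cap_symmetric: "\<epsilon> \<cdot> s = \<epsilon>"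
    and m_skew: "m \<cdot> s = (- 1) \<odot>\<^bsub>Hom C 2 1\<^esub> m"
begin

lemma gens [simp]:
  "arr m" "src m = 2" "tgt m = 1" "arr s" "src s = 2" "tgt s = 2"
  "arr \<eta>" "src \<eta> = 0" "tgt \<eta> = 2" "arr \<epsilon>" "src \<epsilon> = 2" "tgt \<epsilon> = 0"
  using m_mor s_mor cup_mor cap_mor by (auto simp: mor_iff)

text \<open>The indices \<open>i'\<close> and \<open>j'\<close> with an equation as premise, here and below, make the rules match
  layers whose positions are numerals.\<close>

lemma snake_left_layer [simp]:
  assumes "arr x" "i' = i + 1" "j' = j + 1" "tgt x = i + 1 + j"
  shows "layer i \<epsilon> j' \<cdot> layer i' \<eta> j \<cdot> x = x"
  using whisker[OF snake_left, of i j x] assms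
  by (simp add: tens_layer layer_comp comp_assoc add_ac)

lemma snake_right_layer [simp]:
  assumes "arr x" "i' = i + 1" "j' = j + 1" "tgt x = i + 1 + j"
  shows "layer i' \<epsilon> j \<cdot> layer i \<eta> j' \<cdot> x = x"
  using whisker[OF snake_right, of i j x] assms
  by (simp add: tens_layer layer_comp comp_assoc add_ac)

lemma s_involution_layer [simp]:
  assumes "arr x" "tgt x = i + 2 + j"
  shows "layer i s j \<cdot> layer i s j \<cdot> x = x"
  using whisker[OF s_involution, of i j x] assms
  by (simp add: tens_layer layer_comp comp_assoc add_ac)

lemma cap_slide_layer:
  assumes "arr x" "i' = i + 1" "j' = j + 1" "tgt x = i + 3 + j"
  shows "layer i' \<epsilon> j \<cdot> layer i s j' \<cdot> x = layer i \<epsilon> j' \<cdot> layer i' s j \<cdot> x"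
  using whisker[OF cap_slide, of i j x] assms
  by (simp add: tens_layer layer_comp comp_assoc add_ac)

lemma cap_symmetric_layer [simp]:
  assumes "arr x" "tgt x = i + 2 + j"
  shows "layer i \<epsilon> j \<cdot> layer i s j \<cdot> x = layer i \<epsilon> j \<cdot> x"
  using whisker[OF cap_symmetric, of i j x] assms
  by (simp add: layer_comp comp_assoc add_ac)

lemma m_slide_layer:
  assumes "arr x" "i' = i + 1" "j' = j + 1" "tgt x = i + 3 + j"
  shows "layer i s j \<cdot> layer i m j' \<cdot> x = layer i' m j \<cdot> layer i s j' \<cdot> layer i' s j \<cdot> x"
  using whisker[OF m_slide, of i j x] assms
  by (simp add: tens_layer layer_comp comp_assoc add_ac)

definition \<sigma> :: 'm
  where "\<sigma> = layer 1 m 0 \<cdot> layer 0 \<eta> 1"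

lemma sigma_tens: "\<sigma> = (idm C 1 \<boxtimes> m) \<cdot> (\<eta> \<boxtimes> idm C 1)"
  by (simp add: \<sigma>_def tens_layer)

lemma sigma_arr [simp]: "arr \<sigma>" "src \<sigma> = 1" "tgt \<sigma> = 2"
  by (simp_all add: \<sigma>_def)

lemma sigma_left:
  assumes "arr x" "i' = i + 1" "j' = j + 1" "tgt x = i + 1 + j"
  shows "layer i' m j \<cdot> layer i \<eta> j' \<cdot> x = layer i \<sigma> j \<cdot> x"
  using whisker[OF \<sigma>_def, of i j x] assms
  by (simp add: tens_layer layer_comp comp_assoc add_ac)

lemma sigma_right:
  assumes "arr x" "i' = i + 1" "j' = j + 1" "tgt x = i + 1 + j"
  shows "layer i m j' \<cdot> layer i' \<eta> j \<cdot> x = layer i \<sigma> j \<cdot> x"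
  using whisker[OF m_rotation, of i j x] assms sigma_left
  by (simp add: tens_layer layer_comp comp_assoc add_ac)

lemma rotate_s:
  assumes "arr x" "tgt x = 2"
  shows "layer 2 \<epsilon> 0 \<cdot> layer 1 s 1 \<cdot> layer 0 \<eta> 2 \<cdot> x = layer 0 s 0 \<cdot> x"
  using assms by (simp add: cap_slide_layer swap_right_first[of s \<eta>])

text \<open>Replace the crossing on the left by its own rotation: the given cup then meets the cap of that
  rotation, and the snake relation removes both.\<close>

lemma cup_slide:
  assumes "arr x" "tgt x = 1"
  shows "layer 0 s 1 \<cdot> layer 1 \<eta> 0 \<cdot> x = layer 1 s 0 \<cdot> layer 0 \<eta> 1 \<cdot> x"
proof -
  have "layer 0 s 0 = layer 2 \<epsilon> 0 \<cdot> layer 1 s 1 \<cdot> layer 0 \<eta> 2"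
    by (rule arr_eqI[of _ _ 2]) (simp_all add: rotate_s comp_assoc)
  from whisker[OF this, of 0 1 "layer 1 \<eta> 0 \<cdot> x"]
  have "layer 0 s 1 \<cdot> layer 1 \<eta> 0 \<cdot> x = layer 2 \<epsilon> 1 \<cdot> layer 1 s 2 \<cdot> layer 0 \<eta> 3 \<cdot> layer 1 \<eta> 0 \<cdot> x"
    using assms by (simp add: layer_comp comp_assoc)
  also have "\<dots> = layer 1 s 0 \<cdot> layer 0 \<eta> 1 \<cdot> x"
    using assms by (simp add: swap_left_first[of \<eta> \<eta>] swap_left_first[of s \<eta>])
  finally show ?thesis .
qed

text \<open>A cup is determined by its snake relation with \<open>\<epsilon>\<close>, and \<open>s \<eta>\<close> satisfies that relation too,
  because \<open>\<epsilon> s = \<epsilon>\<close>.\<close>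

lemma cup_symmetric:
  assumes "arr x" "tgt x = 0"
  shows "layer 0 s 0 \<cdot> layer 0 \<eta> 0 \<cdot> x = layer 0 \<eta> 0 \<cdot> x"
proof -
  have *: "layer 0 \<epsilon> 1 \<cdot> layer 1 s 0 \<cdot> layer 1 \<eta> 0 \<cdot> x = x" if "arr x" "tgt x = 1" for x
  proof -
    have "layer 0 \<epsilon> 1 \<cdot> layer 1 s 0 \<cdot> layer 1 \<eta> 0 \<cdot> x = layer 1 \<epsilon> 0 \<cdot> layer 0 s 1 \<cdot> layer 1 \<eta> 0 \<cdot> x"
      using that by (simp add: cap_slide_layer[of _ 1 0 1 0])
    also have "\<dots> = x"
      using that by (simp add: cup_slide)
    finally show ?thesis .
  qed
  have "layer 0 \<epsilon> 1 \<cdot> layer 1 s 0 \<cdot> layer 1 \<eta> 0 = idm C 1"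
    by (rule arr_eqI[of _ _ 1]) (simp_all add: * comp_assoc)
  from whisker[OF this, of 1 0 "layer 0 \<eta> 0 \<cdot> x"]
  have "layer 0 \<eta> 0 \<cdot> x = layer 1 \<epsilon> 1 \<cdot> layer 2 s 0 \<cdot> layer 2 \<eta> 0 \<cdot> layer 0 \<eta> 0 \<cdot> x"
    using assms by (simp add: layer_comp comp_assoc)
  also have "\<dots> = layer 1 \<epsilon> 1 \<cdot> layer 2 s 0 \<cdot> layer 0 \<eta> 2 \<cdot> layer 0 \<eta> 0 \<cdot> x"
    using assms by (simp add: swap_left_first[of \<eta> \<eta> _ 0 0])
  also have "\<dots> = layer 0 s 0 \<cdot> layer 0 \<eta> 0 \<cdot> x"
    using assms by (simp add: swap_right_first[of s \<eta>])
  finally show ?thesis by simp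
qed

text \<open>Bending a leg of \<open>\<sigma>\<close> gives back \<open>m\<close>, on either side.\<close>

lemma cap_sigma_right:
  assumes "arr x" "i' = i + 1" "j' = j + 1" "tgt x = i + 2 + j"
  shows "layer i' \<epsilon> j \<cdot> layer i \<sigma> j' \<cdot> x = layer i m j \<cdot> x"
  using assms by (simp add: swap_right_first[of \<epsilon> m] flip: sigma_right)

lemma cap_sigma_left:
  assumes "arr x" "i' = i + 1" "j' = j + 1" "tgt x = i + 2 + j"
  shows "layer i \<epsilon> j' \<cdot> layer i' \<sigma> j \<cdot> x = layer i m j \<cdot> x"
  using assms by (simp add: swap_left_first[of \<epsilon> m] flip: sigma_left)

text \<open>The trivalent form \<open>\<epsilon> (m \<otimes> 1)\<close> is cyclically invariant: expand \<open>m\<close> on the left and on the right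
  as a bent \<open>\<sigma>\<close>, and note that the two resulting caps are side by side and interchangeable.\<close>

lemma cap_m:
  assumes "arr x" "i' = i + 1" "j' = j + 1" "tgt x = i + 3 + j"
  shows "layer i \<epsilon> j \<cdot> layer i m j' \<cdot> x = layer i \<epsilon> j \<cdot> layer i' m j \<cdot> x"
proof -
  have "layer i \<epsilon> j \<cdot> layer i m j' \<cdot> x = layer i \<epsilon> j \<cdot> layer i \<epsilon> (j + 2) \<cdot> layer i' \<sigma> j' \<cdot> x"
    using assms by (simp add: cap_sigma_left)
  also have "\<dots> = layer i \<epsilon> j \<cdot> layer (i + 2) \<epsilon> j \<cdot> layer i' \<sigma> j' \<cdot> x"
    using assms by (simp add: swap_left_first[of \<epsilon> \<epsilon> _ i])
  also have "\<dots> = layer i \<epsilon> j \<cdot> layer i' m j \<cdot> x"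
    using assms by (simp add: cap_sigma_right)
  finally show ?thesis .
qed

lemma twisted_snake:
  assumes "arr x" "i' = i + 1" "j' = j + 1" "tgt x = i + 1 + j"
  shows "layer i \<epsilon> j' \<cdot> layer i' s j \<cdot> layer i \<eta> j' \<cdot> x = x"
proof -
  have s\<eta>: "layer 0 s 0 \<cdot> layer 0 \<eta> 0 = layer 0 \<eta> 0"
    by (rule arr_eqI[of _ _ 0]) (simp_all add: cup_symmetric comp_assoc)
  have "layer i' \<epsilon> j \<cdot> layer i s j' \<cdot> layer i \<eta> j' \<cdot> x = x"
    using whisker[OF s\<eta>, of i j' x] assms by (simp add: layer_comp comp_assoc)
  then show ?thesis
    using cap_slide_layer[of "layer i \<eta> j' \<cdot> x" i' i j' j] assms by simp
qed

text \<open>Bending the right leg of \<open>s \<sigma>\<close> back down turns it into \<open>m s = -m\<close>, as \<open>m\<close> slides through the crossing;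
  straightening that leg again gives \<open>-\<sigma>\<close>.\<close>

lemma s_sigma: "layer 0 s 0 \<cdot> layer 0 \<sigma> 0 = (- 1) \<odot>\<^bsub>Hom C 1 2\<^esub> layer 0 \<sigma> 0"
proof (rule arr_eqI[of _ _ 1])
  have *: "layer 1 \<epsilon> 0 \<cdot> layer 0 s 1 \<cdot> layer 0 \<sigma> 1 = (- 1) \<odot>\<^bsub>Hom C 2 1\<^esub> m"
  proof (rule arr_eqI[of _ _ 2])
    fix x assume x: "arr x" "tgt x = 2"
    have "(layer 1 \<epsilon> 0 \<cdot> layer 0 s 1 \<cdot> layer 0 \<sigma> 1) \<cdot> x
        = layer 0 \<epsilon> 1 \<cdot> layer 1 s 0 \<cdot> layer 1 m 1 \<cdot> layer 0 \<eta> 2 \<cdot> x"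
      using x by (simp add: comp_assoc cap_slide_layer[of _ 1 0 1 0] sigma_left)
    also have "\<dots> = layer 0 \<epsilon> 1 \<cdot> layer 2 m 0 \<cdot> layer 1 s 1 \<cdot> layer 0 \<eta> 2 \<cdot> layer 0 s 0 \<cdot> x"
      using x by (simp add: m_slide_layer swap_right_first[of s \<eta>])
    also have "\<dots> = layer 0 m 0 \<cdot> layer 0 s 0 \<cdot> x"
      using x by (simp add: swap_left_first[of \<epsilon> m] twisted_snake)
    also have "\<dots> = ((- 1) \<odot>\<^bsub>Hom C 2 1\<^esub> m) \<cdot> x"
      using x m_skew by (simp add: layer_zero flip: comp_assoc)
    finally show "(layer 1 \<epsilon> 0 \<cdot> layer 0 s 1 \<cdot> layer 0 \<sigma> 1) \<cdot> x = ((- 1) \<odot>\<^bsub>Hom C 2 1\<^esub> m) \<cdot> x" .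
  qed simp_all
  fix x assume x: "arr x" "tgt x = 1"
  have "(layer 0 s 0 \<cdot> layer 0 \<sigma> 0) \<cdot> x
      = layer 1 \<epsilon> 1 \<cdot> layer 2 \<eta> 0 \<cdot> layer 0 s 0 \<cdot> layer 0 \<sigma> 0 \<cdot> x"
    using x by (simp add: comp_assoc)
  also have "\<dots> = layer 1 \<epsilon> 1 \<cdot> layer 0 s 2 \<cdot> layer 0 \<sigma> 2 \<cdot> layer 1 \<eta> 0 \<cdot> x"
    using x by (simp add: swap_right_first[of \<eta> s] swap_right_first[of \<eta> \<sigma>] del: snake_left_layer)
  also have "\<dots> = ((- 1) \<odot>\<^bsub>Hom C 3 2\<^esub> layer 0 m 1) \<cdot> layer 1 \<eta> 0 \<cdot> x"
    using whisker[OF *, of 0 1 "layer 1 \<eta> 0 \<cdot> x"] x by (simp add: layer_comp comp_assoc layer_smult)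
  also have "\<dots> = ((- 1) \<odot>\<^bsub>Hom C 1 2\<^esub> layer 0 \<sigma> 0) \<cdot> x"
    using x by (simp add: comp_smult sigma_right)
  finally show "(layer 0 s 0 \<cdot> layer 0 \<sigma> 0) \<cdot> x = ((- 1) \<odot>\<^bsub>Hom C 1 2\<^esub> layer 0 \<sigma> 0) \<cdot> x" .
qed simp_all

text \<open>The mirror image of the defining relation \<open>m_slide\<close>; it follows since \<open>s\<close> is an involution.\<close>

lemma m_slide_right:
  assumes "arr x" "tgt x = 3"
  shows "layer 0 m 1 \<cdot> layer 1 s 0 \<cdot> x = layer 0 s 0 \<cdot> layer 1 m 0 \<cdot> layer 0 s 1 \<cdot> x"
proof -
  have "layer 0 s 0 \<cdot> layer 0 m 1 \<cdot> layer 1 s 0 \<cdot> x = layer 1 m 0 \<cdot> layer 0 s 1 \<cdot> x"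
    using assms by (simp add: m_slide_layer)
  then show ?thesis
    using assms s_involution_layer[of "layer 0 m 1 \<cdot> layer 1 s 0 \<cdot> x" 0 0] by simp
qed

lemma cap_s_s:
  assumes "arr x" "tgt x = 3"
  shows "layer 1 \<epsilon> 0 \<cdot> layer 0 s 1 \<cdot> layer 1 s 0 \<cdot> x = layer 0 \<epsilon> 1 \<cdot> x"
  using assms by (simp add: cap_slide_layer[of _ 1 0 1 0])

lemma s_s_cup:
  assumes "arr x" "tgt x = 1"
  shows "layer 0 s 1 \<cdot> layer 1 s 0 \<cdot> layer 0 \<eta> 1 \<cdot> x = layer 1 \<eta> 0 \<cdot> x"
  using assms by (simp flip: cup_slide)

section \<open>Rotating and bending diagrams\<close>

definition K :: 'm
  where "K = \<sigma> \<cdot> m"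

definition H :: 'm
  where "H = layer 0 m 1 \<cdot> layer 1 \<sigma> 0"

lemma K_arr [simp]: "arr K" "src K = 2" "tgt K = 2"
  by (simp_all add: K_def)

lemma H_arr [simp]: "arr H" "src H = 2" "tgt H = 2"
  by (simp_all add: H_def)

lemma K_layer:
  assumes "arr x" "tgt x = i + 2 + j"
  shows "layer i K j \<cdot> x = layer i \<sigma> j \<cdot> layer i m j \<cdot> x"
  using assms by (simp add: K_def layer_comp comp_assoc)

lemma H_layer:
  assumes "arr x" "tgt x = i + 2 + j"
  shows "layer i H j \<cdot> x = layer i m (j + 1) \<cdot> layer (i + 1) \<sigma> j \<cdot> x"
  using assms by (simp add: H_def layer_comp comp_assoc add_ac)

text \<open>The symmetric form of \<open>H\<close>: both sides equal \<open>(m \<otimes> m) (1 \<otimes> \<eta> \<otimes> 1)\<close>.\<close>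

lemma H_layer':
  assumes "arr x" "tgt x = i + 2 + j"
  shows "layer i H j \<cdot> x = layer (i + 1) m j \<cdot> layer i \<sigma> (j + 1) \<cdot> x"
proof -
  have "layer i H j \<cdot> x = layer i m (j + 1) \<cdot> layer (i + 2) m j \<cdot> layer (i + 1) \<eta> (j + 1) \<cdot> x"
    using assms by (simp add: H_layer sigma_left)
  also have "\<dots> = layer (i + 1) m j \<cdot> layer i m (j + 2) \<cdot> layer (i + 1) \<eta> (j + 1) \<cdot> x"
    using assms by (simp add: swap_left_first[of m m _ i "i + 2"])
  also have "\<dots> = layer (i + 1) m j \<cdot> layer i \<sigma> (j + 1) \<cdot> x"
    using assms by (simp add: sigma_right)
  finally show ?thesis .
qed

definition U :: 'm
  where "U = \<eta> \<cdot> \<epsilon>"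

lemma U_arr [simp]: "arr U" "src U = 2" "tgt U = 2"
  by (simp_all add: U_def)

lemma U_layer:
  assumes "arr x" "tgt x = i + 2 + j"
  shows "layer i U j \<cdot> x = layer i \<eta> j \<cdot> layer i \<epsilon> j \<cdot> x"
  using assms by (simp add: U_def layer_comp comp_assoc)

lemma s_sigma_layer:
  assumes "arr x" "tgt x = i + 1 + j"
  shows "layer i s j \<cdot> layer i \<sigma> j \<cdot> x = (- 1) \<odot>\<^bsub>Hom C (src x) (i + 2 + j)\<^esub> (layer i \<sigma> j \<cdot> x)"
  using whisker[OF s_sigma, of i j x] assms
  by (simp add: layer_comp comp_assoc layer_smult comp_smult)

text \<open>The quarter turn of an endomorphism of \<open>X \<otimes> X\<close>: the bottom left leg is bent up to the top, the
  top right leg is bent down to the bottom.\<close>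

definition rotate :: "'m \<Rightarrow> 'm"
  where "rotate f = layer 2 \<epsilon> 0 \<cdot> layer 1 f 1 \<cdot> layer 0 \<eta> 2"

lemma rotate_one: "rotate (idm C 2) = layer 0 U 0"
  by (rule arr_eqI[of _ _ 2])
   (simp_all add: rotate_def comp_assoc swap_right_first[of \<epsilon> \<eta>] U_layer)

lemma rotate_U: "rotate U = idm C 2"
  by (rule arr_eqI[of _ _ 2]) (simp_all add: rotate_def comp_assoc U_layer)

lemma rotate_S: "rotate s = layer 0 s 0"
  by (rule arr_eqI[of _ _ 2]) (simp_all add: rotate_def comp_assoc rotate_s)

lemma rotate_K: "rotate K = layer 0 H 0"
  by (rule arr_eqI[of _ _ 2])
   (simp_all add: rotate_def comp_assoc K_layer H_layer' sigma_left cap_sigma_right)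

lemma rotate_H_aux:
  assumes "arr x" "tgt x = 2"
  shows "layer 1 H 1 \<cdot> layer 0 \<eta> 2 \<cdot> x = layer 0 \<sigma> 2 \<cdot> layer 0 \<sigma> 1 \<cdot> x"
  using assms by (simp add: H_layer swap_right_first[of \<sigma> \<eta>] sigma_left)

lemma rotate_H: "rotate H = layer 0 K 0"
  by (rule arr_eqI[of _ _ 2])
   (simp_all add: rotate_def comp_assoc K_layer rotate_H_aux swap_right_first[of \<epsilon> \<sigma>] cap_sigma_right)

text \<open>The sign comes from \<open>s \<sigma> = -\<sigma>\<close>: as a tree with four legs, \<open>s H\<close> joins opposite corners, and a
  quarter turn preserves this pairing but reverses the orientation of one vertex.\<close>

lemma rotate_sH: "rotate (s \<cdot> H) = (- 1) \<odot>\<^bsub>Hom C 2 2\<^esub> (layer 0 s 0 \<cdot> layer 0 H 0)"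
proof (rule arr_eqI[of _ _ 2])
  fix x assume x: "arr x" "tgt x = 2"
  have "rotate (s \<cdot> H) \<cdot> x = layer 2 \<epsilon> 0 \<cdot> layer 1 s 1 \<cdot> layer 0 \<sigma> 2 \<cdot> layer 0 \<sigma> 1 \<cdot> x"
    using x by (simp add: rotate_def comp_assoc layer_comp rotate_H_aux)
  also have "\<dots> = layer 1 \<epsilon> 1 \<cdot> layer 0 \<sigma> 2 \<cdot> layer 1 s 0 \<cdot> layer 0 \<sigma> 1 \<cdot> x"
    using x by (simp add: cap_slide_layer[of _ 2 1 1 0] swap_right_first[of s \<sigma>])
  also have "\<dots> = layer 0 m 1 \<cdot> layer 1 s 0 \<cdot> layer 0 \<sigma> 1 \<cdot> x"
    using x by (simp add: cap_sigma_right)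
  also have "\<dots> = layer 0 s 0 \<cdot> layer 1 m 0 \<cdot> layer 0 s 1 \<cdot> layer 0 \<sigma> 1 \<cdot> x"
    using x by (simp add: m_slide_right)
  also have "\<dots> = (- 1) \<odot>\<^bsub>Hom C (src x) 2\<^esub> (layer 0 s 0 \<cdot> layer 1 m 0 \<cdot> layer 0 \<sigma> 1 \<cdot> x)"
    using x by (simp add: s_sigma_layer comp_smult)
  also have "\<dots> = ((- 1) \<odot>\<^bsub>Hom C 2 2\<^esub> (layer 0 s 0 \<cdot> layer 0 H 0)) \<cdot> x"
    using x by (simp add: comp_smult comp_assoc H_layer')
  finally show "rotate (s \<cdot> H) \<cdot> x = ((- 1) \<odot>\<^bsub>Hom C 2 2\<^esub> (layer 0 s 0 \<cdot> layer 0 H 0)) \<cdot> x" .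
qed (simp_all add: rotate_def)

text \<open>The top right leg is bent down, so that endomorphisms of \<open>X \<otimes> X\<close> become morphisms from
  \<open>X \<otimes> X \<otimes> X\<close> to \<open>X\<close>.\<close>

definition bend :: "'m \<Rightarrow> 'm"
  where "bend f = layer 1 \<epsilon> 0 \<cdot> layer 0 f 1"

lemma bend_one: "bend (idm C 2) = layer 1 \<epsilon> 0"
  by (simp add: bend_def)

lemma bend_U: "bend U = layer 0 \<epsilon> 1"
  by (rule arr_eqI[of _ _ 3]) (simp_all add: bend_def comp_assoc U_layer)

lemma bend_K: "bend K = layer 0 m 0 \<cdot> layer 0 m 1"
  by (rule arr_eqI[of _ _ 3]) (simp_all add: bend_def comp_assoc K_layer cap_sigma_right)

lemma bend_H: "bend H = layer 0 m 0 \<cdot> layer 1 m 0"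
proof (rule arr_eqI[of _ _ 3])
  fix x assume x: "arr x" "tgt x = 3"
  have "bend H \<cdot> x = layer 1 \<epsilon> 0 \<cdot> layer 2 m 0 \<cdot> layer 0 \<sigma> 2 \<cdot> x"
    using x by (simp add: bend_def comp_assoc H_layer' cap_m)
  also have "\<dots> = (layer 0 m 0 \<cdot> layer 1 m 0) \<cdot> x"
    using x by (simp add: comp_assoc swap_right_first[of m \<sigma>] cap_sigma_right)
  finally show "bend H \<cdot> x = (layer 0 m 0 \<cdot> layer 1 m 0) \<cdot> x" .
qed (simp_all add: bend_def)

end


context trivalent_object
begin

section \<open>The braiding generated by the crossing\<close>

primrec braid1 :: "nat \<Rightarrow> 'm"
  where
    "braid1 0 = idm C 1"
  | "braid1 (Suc k) = layer k s 0 \<cdot> layer 0 (braid1 k) 1"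

primrec braid :: "nat \<Rightarrow> nat \<Rightarrow> 'm"
  where
    "braid 0 k = idm C k"
  | "braid (Suc n) k = layer 0 (braid n k) 1 \<cdot> layer n (braid1 k) 0"

lemma braid1_arr [simp]: "arr (braid1 k)" "src (braid1 k) = k + 1" "tgt (braid1 k) = k + 1"
  by (induction k) (simp_all add: braid1.simps)

lemma braid_arr [simp]: "arr (braid n k)" "src (braid n k) = n + k" "tgt (braid n k) = n + k"
  by (induction n) (simp_all add: braid.simps)

declare braid.simps(2) [simp del] braid1.simps(2) [simp del]

lemma braid_plus_one:
  "braid1 (k + 1) = layer k s 0 \<cdot> layer 0 (braid1 k) 1"
  "braid1 (1 + k) = layer k s 0 \<cdot> layer 0 (braid1 k) 1"
  "braid (n + 1) k = layer 0 (braid n k) 1 \<cdot> layer n (braid1 k) 0"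
  "braid (1 + n) k = layer 0 (braid n k) 1 \<cdot> layer n (braid1 k) 0"
  using braid.simps(2)[of n k] braid1.simps(2)[of k] by (simp_all add: Suc_eq_plus1 add.commute)

lemma braid1_eq: "braid1 k = braid 1 k"
  using braid.simps(2)[of 0 k] by (simp add: layer_zero)

lemma braid_one_one: "braid 1 1 = s"
  using braid1.simps(2)[of 0] by (simp add: layer_zero flip: braid1_eq)

lemma braid1_add: "braid1 (k + l) = layer k (braid1 l) 0 \<cdot> layer 0 (braid1 k) l"
proof (induction l)
  case (Suc l)
  then show ?case
    by (simp add: layer_comp comp_assoc add_ac Suc_eq_plus1 braid_plus_one)
qed (simp add: layer_zero)

lemma braid_add_right: "braid n (k + l) = layer k (braid n l) 0 \<cdot> layer 0 (braid n k) l"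
proof (induction n)
  case (Suc n)
  show ?case
  proof (rule arr_eqI[of _ _ "Suc n + k + l"])
    fix x assume x: "arr x" "tgt x = Suc n + k + l"
    have "braid (Suc n) (k + l) \<cdot> x = layer k (braid n l) 1 \<cdot> layer 0 (braid n k) (l + 1)
        \<cdot> layer (n + k) (braid1 l) 0 \<cdot> layer n (braid1 k) l \<cdot> x"
      using x by (simp add: Suc braid1_add layer_comp comp_assoc add_ac Suc_eq_plus1 braid_plus_one)
    also have "\<dots> = layer k (braid n l) 1 \<cdot> layer (k + n) (braid1 l) 0
        \<cdot> layer 0 (braid n k) (1 + l) \<cdot> layer n (braid1 k) l \<cdot> x"
      using x swap_left_first[of "braid n k" "braid1 l" "layer n (braid1 k) l \<cdot> x" 0 "n + k" "l + 1" 0]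
      by (simp add: add_ac)
    also have "\<dots> = (layer k (braid (Suc n) l) 0 \<cdot> layer 0 (braid (Suc n) k) l) \<cdot> x"
      using x by (simp add: layer_comp comp_assoc add_ac Suc_eq_plus1 braid_plus_one)
    finally show "braid (Suc n) (k + l) \<cdot> x = (layer k (braid (Suc n) l) 0 \<cdot> layer 0 (braid (Suc n) k) l) \<cdot> x" .
  qed simp_all
qed (simp add: layer_zero)

lemma braid_add_left: "braid (n + p) k = layer 0 (braid n k) p \<cdot> layer n (braid p k) 0"
proof (induction p)
  case (Suc p)
  then show ?case
    by (simp add: layer_comp comp_assoc add_ac Suc_eq_plus1 braid_plus_one)
qed (simp add: layer_zero)

lemma braid_zero [simp]: "braid n 0 = idm C n"
  by (induction n) (simp_all add: Suc_eq_plus1 braid_plus_one)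

lemma braid_inverse_one: "braid k 1 \<cdot> braid 1 k = idm C (k + 1)"
proof (induction k)
  case (Suc k)
  have s1: "braid1 1 = s"
    by (simp add: braid1_eq braid_one_one)
  have "braid (Suc k) 1 \<cdot> braid 1 (Suc k)
      = layer 0 (braid k 1) 1 \<cdot> layer k s 0 \<cdot> layer k s 0 \<cdot> layer 0 (braid 1 k) 1"
    using braid_add_right[of 1 k 1] s1 by (simp add: comp_assoc braid_one_one Suc_eq_plus1 braid_plus_one(3,4))
  also have "\<dots> = layer 0 (braid k 1 \<cdot> braid 1 k) 1"
    by (simp add: layer_comp)
  finally show ?case
    by (simp add: Suc Suc_eq_plus1)
qed simp

text \<open>Crossing \<open>n\<close> strands over \<open>k\<close> and back can be undone one strand at a time, so the case of a single
  strand suffices.\<close>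

lemma braid_inverse: "braid k n \<cdot> braid n k = idm C (n + k)"
proof -
  have one: "braid 1 k \<cdot> braid k 1 = idm C (k + 1)" for k
  proof (induction k)
    case (Suc k)
    have s1: "braid1 1 = s"
      by (simp add: braid1_eq braid_one_one)
    have "braid 1 (Suc k) \<cdot> braid (Suc k) 1
        = layer k s 0 \<cdot> layer 0 (braid 1 k) 1 \<cdot> layer 0 (braid k 1) 1 \<cdot> layer k s 0"
      using braid_add_right[of 1 k 1] s1 by (simp add: comp_assoc braid_one_one Suc_eq_plus1 braid_plus_one(3,4))
    also have "\<dots> = layer k s 0 \<cdot> layer 0 (braid 1 k \<cdot> braid k 1) 1 \<cdot> layer k s 0"
      by (simp add: layer_comp comp_assoc)
    also have "\<dots> = idm C (Suc k + 1)"
      using s_involution_layer[of "idm C (k + 2)" k 0] by (simp add: Suc Suc_eq_plus1 add.assoc)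
    finally show ?case .
  qed simp
  show ?thesis
  proof (induction n)
    case (Suc n)
    have "braid k (Suc n) \<cdot> braid (Suc n) k = layer n (braid k 1) 0 \<cdot> layer 0 (braid k n) 1
        \<cdot> layer 0 (braid n k) 1 \<cdot> layer n (braid 1 k) 0"
      using braid_add_right[of k n 1] by (simp add: comp_assoc braid1_eq Suc_eq_plus1 braid_plus_one)
    also have "\<dots> = layer n (braid k 1) 0 \<cdot> layer 0 (braid k n \<cdot> braid n k) 1 \<cdot> layer n (braid 1 k) 0"
      by (simp add: layer_comp comp_assoc)
    also have "\<dots> = layer n (braid k 1 \<cdot> braid 1 k) 0"
      by (simp add: Suc layer_comp)
    finally show ?case
      by (simp add: braid_inverse_one Suc_eq_plus1 add_ac)
  qed simp
qed

text \<open>Naturality of the braiding in \<open>f\<close> against a single strand.\<close>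

definition slides :: "'m \<Rightarrow> bool"
  where "slides f \<longleftrightarrow> arr f \<and> braid (tgt f) 1 \<cdot> layer 0 f 1 = layer 1 f 0 \<cdot> braid (src f) 1"

lemma slides_arr: "slides f \<Longrightarrow> arr f"
  by (simp add: slides_def)

lemma slides_layer:
  assumes "slides f" "arr x" "tgt x = i + src f + 1 + j"
  shows "layer i (braid (tgt f) 1) j \<cdot> layer i f (j + 1) \<cdot> x = layer (i + 1) f j \<cdot> layer i (braid (src f) 1) j \<cdot> x"
proof -
  have f: "arr f" and eq: "braid (tgt f) 1 \<cdot> layer 0 f 1 = layer 1 f 0 \<cdot> braid (src f) 1"
    using assms(1) by (simp_all add: slides_def)
  show ?thesis
    using whisker[OF eq, of i j x] f assms(2,3)
    by (simp add: layer_comp comp_assoc add_ac)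
qed

lemma slides_idm: "slides (idm C n)"
  by (simp add: slides_def)

lemma slides_zero: "slides \<zero>\<^bsub>Hom C n k\<^esub>"
  by (simp add: slides_def layer_zero_mor comp_zero add.commute)

lemma slides_comp:
  assumes "slides f" "slides g" "tgt f = src g"
  shows "slides (g \<cdot> f)"
proof -
  have "braid (tgt g) 1 \<cdot> layer 0 (g \<cdot> f) 1 = layer 1 (g \<cdot> f) 0 \<cdot> braid (src f) 1"
  proof (rule arr_eqI[of _ _ "src f + 1"])
    fix x assume "arr x" "tgt x = src f + 1"
    then show "(braid (tgt g) 1 \<cdot> layer 0 (g \<cdot> f) 1) \<cdot> x = (layer 1 (g \<cdot> f) 0 \<cdot> braid (src f) 1) \<cdot> x"
      using assms slides_arr slides_layer[OF assms(1), of x 0 0] 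
         slides_layer[OF assms(2), of "layer 0 f 1 \<cdot> x" 0 0]
      by (simp add: layer_comp comp_assoc layer_zero)
  qed (use assms slides_arr in simp_all)
  then show ?thesis
    using assms slides_arr by (simp add: slides_def)
qed

lemma slides_tens_left:
  assumes "slides f"
  shows "slides (layer 0 f n)"
proof -
  have f: "arr f"
    using assms by (rule slides_arr)
  have "braid (tgt f + n) 1 \<cdot> layer 0 f (n + 1) = layer 1 f n \<cdot> braid (src f + n) 1"
  proof (rule arr_eqI[of _ _ "src f + n + 1"])
    fix x assume x: "arr x" "tgt x = src f + n + 1"
    have "(braid (tgt f + n) 1 \<cdot> layer 0 f (n + 1)) \<cdot> x
        = layer 0 (braid (tgt f) 1) n \<cdot> layer (tgt f) (braid n 1) 0 \<cdot> layer 0 f (n + 1) \<cdot> x"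
      using x f by (simp add: braid_add_left comp_assoc)
    also have "\<dots> = layer 0 (braid (tgt f) 1) n \<cdot> layer 0 f (n + 1) \<cdot> layer (src f) (braid n 1) 0 \<cdot> x"
      using x f by (simp add: swap_right_first[of "braid n 1" f])
    also have "\<dots> = layer 1 f n \<cdot> layer 0 (braid (src f) 1) n \<cdot> layer (src f) (braid n 1) 0 \<cdot> x"
      using x f slides_layer[OF assms, of "layer (src f) (braid n 1) 0 \<cdot> x" 0 n] by simp
    also have "\<dots> = (layer 1 f n \<cdot> braid (src f + n) 1) \<cdot> x"
      using x f by (simp add: braid_add_left comp_assoc)
    finally show "(braid (tgt f + n) 1 \<cdot> layer 0 f (n + 1)) \<cdot> x = (layer 1 f n \<cdot> braid (src f + n) 1) \<cdot> x" .
  qed (use f in simp_all)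
  then show ?thesis
    using f by (simp add: slides_def)
qed

lemma slides_tens_right:
  assumes "slides f"
  shows "slides (layer n f 0)"
proof -
  have f: "arr f"
    using assms by (rule slides_arr)
  have "braid (n + tgt f) 1 \<cdot> layer n f 1 = layer (n + 1) f 0 \<cdot> braid (n + src f) 1"
  proof (rule arr_eqI[of _ _ "n + src f + 1"])
    fix x assume x: "arr x" "tgt x = n + src f + 1"
    have "(braid (n + tgt f) 1 \<cdot> layer n f 1) \<cdot> x
        = layer 0 (braid n 1) (tgt f) \<cdot> layer n (braid (tgt f) 1) 0 \<cdot> layer n f 1 \<cdot> x"
      using x f by (simp add: braid_add_left comp_assoc)
    also have "\<dots> = layer 0 (braid n 1) (tgt f) \<cdot> layer (n + 1) f 0 \<cdot> layer n (braid (src f) 1) 0 \<cdot> x"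
      using x f slides_layer[OF assms, of x n 0] by simp
    also have "\<dots> = layer (n + 1) f 0 \<cdot> layer 0 (braid n 1) (src f) \<cdot> layer n (braid (src f) 1) 0 \<cdot> x"
      using x f by (simp add: swap_left_first[of "braid n 1" f])
    also have "\<dots> = (layer (n + 1) f 0 \<cdot> braid (n + src f) 1) \<cdot> x"
      using x f by (simp add: braid_add_left comp_assoc)
    finally show "(braid (n + tgt f) 1 \<cdot> layer n f 1) \<cdot> x = (layer (n + 1) f 0 \<cdot> braid (n + src f) 1) \<cdot> x" .
  qed (use f in simp_all)
  then show ?thesis
    using f by (simp add: slides_def add_ac)
qed

lemma slides_tens:
  assumes "slides f" "slides g"
  shows "slides (f \<boxtimes> g)"
  using assms slides_arr slides_comp[OF slides_tens_right slides_tens_left, of g f "src f" "tgt g"]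
  by (simp add: tens_eq_layers(1))

lemma slides_add:
  assumes "slides f" "slides g" "src f = n" "tgt f = k" "src g = n" "tgt g = k"
  shows "slides (f \<oplus>\<^bsub>Hom C n k\<^esub> g)"
  using assms slides_arr by (simp add: slides_def layer_add comp_add add_ac)

lemma slides_smult:
  assumes "slides f" "src f = n" "tgt f = k"
  shows "slides (c \<odot>\<^bsub>Hom C n k\<^esub> f)"
  using assms slides_arr by (simp add: slides_def layer_smult comp_smult add_ac)

lemma braid_two_one: "braid 2 1 = layer 0 s 1 \<cdot> layer 1 s 0"
  using braid_add_left[of 1 1 1] by (simp add: braid_one_one)

text \<open>For \<open>m\<close> and \<open>s\<close> this is a defining relation; for \<open>\<epsilon>\<close> and \<open>\<eta>\<close> it follows from \<open>cap_slide\<close>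
  and from its rotated form \<open>cup_slide\<close>.\<close>

lemma slides_generators: "slides m" "slides s" "slides \<eta>" "slides \<epsilon>"
proof -
  have "layer 0 s 0 \<cdot> layer 0 m 1 = layer 1 m 0 \<cdot> layer 0 s 1 \<cdot> layer 1 s 0"
    by (rule arr_eqI[of _ _ 3]) (simp_all add: m_slide_layer comp_assoc)
  then show "slides m"
    by (simp add: slides_def braid_two_one braid_one_one layer_zero)
  show "slides s"
    using s_braid by (simp add: slides_def braid_two_one tens_layer comp_assoc)
  have "layer 0 s 1 \<cdot> layer 1 s 0 \<cdot> layer 0 \<eta> 1 = layer 1 \<eta> 0"
    by (rule arr_eqI[of _ _ 1]) (simp_all add: s_s_cup comp_assoc)
  then show "slides \<eta>"
    by (simp add: slides_def braid_two_one comp_assoc)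
  have "layer 0 \<epsilon> 1 = layer 1 \<epsilon> 0 \<cdot> layer 0 s 1 \<cdot> layer 1 s 0"
    by (rule arr_eqI[of _ _ 3]) (simp_all add: cap_s_s comp_assoc)
  then show "slides \<epsilon>"
    by (simp add: slides_def braid_two_one comp_assoc)
qed

text \<open>Induction on the number of strands extends sliding from one strand to \<open>k\<close>.\<close>

lemma braid_natural_left:
  assumes "slides f"
  shows "braid (tgt f) k \<cdot> layer 0 f k = layer k f 0 \<cdot> braid (src f) k"
proof (induction k)
  case 0
  then show ?case
    using assms slides_arr by simp
next
  case (Suc k)
  have f: "arr f"
    using assms by (rule slides_arr)
  show ?case
  proof (rule arr_eqI[of _ _ "src f + Suc k"])
    fix x assume x: "arr x" "tgt x = src f + Suc k"
    have "(braid (tgt f) (Suc k) \<cdot> layer 0 f (Suc k)) \<cdot> x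
        = layer k (braid (tgt f) 1) 0 \<cdot> layer 0 (braid (tgt f) k \<cdot> layer 0 f k) 1 \<cdot> x"
      using x f braid_add_right[of "tgt f" k 1] by (simp add: layer_comp comp_assoc Suc_eq_plus1)
    also have "\<dots> = layer k (braid (tgt f) 1) 0 \<cdot> layer k f 1 \<cdot> layer 0 (braid (src f) k) 1 \<cdot> x"
      using x f by (simp add: Suc layer_comp comp_assoc add_ac Suc_eq_plus1)
    also have "\<dots> = layer (k + 1) f 0 \<cdot> layer k (braid (src f) 1) 0 \<cdot> layer 0 (braid (src f) k) 1 \<cdot> x"
      using x f slides_layer[OF assms, of "layer 0 (braid (src f) k) 1 \<cdot> x" k 0] by (simp add: add_ac Suc_eq_plus1)
    also have "\<dots> = (layer (Suc k) f 0 \<cdot> braid (src f) (Suc k)) \<cdot> x"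
      using x f braid_add_right[of "src f" k 1] by (simp add: comp_assoc add_ac Suc_eq_plus1)
    finally show "(braid (tgt f) (Suc k) \<cdot> layer 0 f (Suc k)) \<cdot> x
        = (layer (Suc k) f 0 \<cdot> braid (src f) (Suc k)) \<cdot> x" .
  qed (use f in \<open>simp_all add: Suc_eq_plus1\<close>)
qed

text \<open>Naturality in the other argument follows because the braiding is its own inverse.\<close>

lemma braid_natural_right:
  assumes "slides f"
  shows "braid k (tgt f) \<cdot> layer k f 0 = layer 0 f k \<cdot> braid k (src f)"
proof -
  have f: "arr f"
    using assms by (rule slides_arr)
  have "braid k (tgt f) \<cdot> layer k f 0
      = braid k (tgt f) \<cdot> (layer k f 0 \<cdot> braid (src f) k) \<cdot> braid k (src f)"
    using f comp_assoc[of "braid k (src f)" "braid (src f) k" "layer k f 0"]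
    by (simp add: braid_inverse add_ac)
  also have "\<dots> = (braid k (tgt f) \<cdot> braid (tgt f) k) \<cdot> layer 0 f k \<cdot> braid k (src f)"
    using f by (simp add: comp_assoc add_ac flip: braid_natural_left[OF assms])
  also have "\<dots> = layer 0 f k \<cdot> braid k (src f)"
    using f by (simp add: braid_inverse add_ac)
  finally show ?thesis .
qed

lemma symmetric_if_slides:
  assumes slides: "\<And>f. arr f \<Longrightarrow> slides f" and braiding: "\<And>n k. braiding C n k = braid n k"
  shows "symmetric_monoidal_lin_cat C"
proof unfold_locales
  fix n n' k k' l f g
  show "braiding C n k \<in> mor C (n \<boxdot> k) (k \<boxdot> n)"
    by (simp add: braiding mor_iff)
  show "braiding C n (k \<boxdot> l) = (idm C k \<boxtimes> braiding C n l) \<cdot> (braiding C n k \<boxtimes> idm C l)"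
    by (simp add: braiding tens_layer braid_add_right)
  show "braiding C k n \<cdot> braiding C n k = idm C (n \<boxdot> k)"
    by (simp add: braiding braid_inverse)
  assume "f \<in> mor C n n'" "g \<in> mor C k k'"
  then have fg: "arr f" "src f = n" "tgt f = n'" "arr g" "src g = k" "tgt g = k'"
    by (simp_all add: mor_iff)
  have "braid n' k' \<cdot> layer 0 f k' \<cdot> layer n g 0 = layer k' f 0 \<cdot> braid n k' \<cdot> layer n g 0"
    using fg braid_natural_left[OF slides, of f k'] by (simp flip: comp_assoc)
  also have "\<dots> = layer k' f 0 \<cdot> layer 0 g n \<cdot> braid n k"
    using fg braid_natural_right[OF slides, of g n] by simp
  finally show "braiding C n' k' \<cdot> (f \<boxtimes> g) = (g \<boxtimes> f) \<cdot> braiding C n k"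
    using fg tens_eq_layers(1)[of f g] tens_eq_layers(2)[of g f] by (simp add: braiding comp_assoc)
qed

end


section \<open>Linear relations among the five diagrams\<close>

text \<open>Stated for families, not sets, since it is not known in advance that the diagrams are distinct;
  a repeated member gives a relation directly.\<close>

lemma (in vectorspace) family_dependent:
  fixes v :: "nat \<Rightarrow> 'c"
  assumes fin: "fin_dim" and dim: "dim < n" and v: "v \<in> {..<n} \<rightarrow> carrier V"
  shows "\<exists>c. c \<in> {..<n} \<rightarrow> carrier K \<and> (\<exists>i<n. c i \<noteq> \<zero>\<^bsub>K\<^esub>) \<and> (\<Oplus>\<^bsub>V\<^esub>i\<in>{..<n}. c i \<odot>\<^bsub>V\<^esub> v i) = \<zero>\<^bsub>V\<^esub>"
proof (cases "inj_on v {..<n}")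
  case True
  let ?S = "v ` {..<n}"
  have S: "?S \<subseteq> carrier V" "finite ?S"
    using v by auto
  have "card ?S = n"
    using True by (simp add: card_image)
  then have "lin_dep ?S"
    using li_le_dim(2)[OF fin S(1)] dim by force
  then obtain a w where a: "a \<in> ?S \<rightarrow> carrier K" "lincomb a ?S = \<zero>\<^bsub>V\<^esub>" "w \<in> ?S" "a w \<noteq> \<zero>\<^bsub>K\<^esub>"
    using finite_lin_dep[OF S(2) _ S(1)] by blast
  have "lincomb a ?S = (\<Oplus>\<^bsub>V\<^esub>i\<in>{..<n}. a (v i) \<odot>\<^bsub>V\<^esub> v i)"
    unfolding lincomb_def using True a(1) v by (subst finsum_reindex) auto
  then show ?thesis
    using a by (intro exI[of _ "\<lambda>i. a (v i)"]) auto
next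
  case False
  then obtain i j where ij: "i < n" "j < n" "i \<noteq> j" "v i = v j"
    by (auto simp: inj_on_def)
  let ?c = "\<lambda>k. if k = i then \<one>\<^bsub>K\<^esub> else if k = j then \<ominus>\<^bsub>K\<^esub> \<one>\<^bsub>K\<^esub> else \<zero>\<^bsub>K\<^esub>"
  have mem: "v k \<in> carrier V" if "k < n" for k
    using v that by auto
  have "(\<Oplus>\<^bsub>V\<^esub>k\<in>{..<n}. ?c k \<odot>\<^bsub>V\<^esub> v k) = (\<Oplus>\<^bsub>V\<^esub>k\<in>{i, j}. ?c k \<odot>\<^bsub>V\<^esub> v k)"
    using ij mem by (intro add.finprod_mono_neutral_cong_right) auto
  also have "\<dots> = v j \<oplus>\<^bsub>V\<^esub> \<ominus>\<^bsub>V\<^esub> v j"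
    using ij mem by (subst finsum_insert) (auto simp: smult_l_minus)
  finally have "(\<Oplus>\<^bsub>V\<^esub>k\<in>{..<n}. ?c k \<odot>\<^bsub>V\<^esub> v k) = \<zero>\<^bsub>V\<^esub>"
    using ij mem by (simp add: M.r_neg)
  then show ?thesis
    using ij by (intro exI[of _ ?c]) auto
qed

lemma five_vectors_dependent:
  fixes V :: "('k::field, 'v) module"
  assumes vs: "vectorspace class_ring V" and fin_V: "vectorspace.fin_dim class_ring V"
    and dim_V: "vectorspace.dim class_ring V < 5"
    and v: "v1 \<in> carrier V" "v2 \<in> carrier V" "v3 \<in> carrier V" "v4 \<in> carrier V" "v5 \<in> carrier V"
  shows "\<exists>a b c d e. \<not> (a = 0 \<and> b = 0 \<and> c = 0 \<and> d = 0 \<and> e = 0)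
    \<and> a \<odot>\<^bsub>V\<^esub> v1 \<oplus>\<^bsub>V\<^esub> (b \<odot>\<^bsub>V\<^esub> v2 \<oplus>\<^bsub>V\<^esub> (c \<odot>\<^bsub>V\<^esub> v3
      \<oplus>\<^bsub>V\<^esub> (d \<odot>\<^bsub>V\<^esub> v4 \<oplus>\<^bsub>V\<^esub> e \<odot>\<^bsub>V\<^esub> v5))) = \<zero>\<^bsub>V\<^esub>"
proof -
  interpret vectorspace class_ring V by (rule vs)
  let ?v = "\<lambda>i::nat. [v5, v4, v3, v2, v1] ! i"
  have five: "{..<5::nat} = {4, 3, 2, 1, 0}"
    by auto
  have mem: "?v \<in> {..<5} \<rightarrow> carrier V"
    using v by (auto simp: five)
  obtain c where c: "\<exists>i<5. c i \<noteq> \<zero>\<^bsub>class_ring\<^esub>" "(\<Oplus>\<^bsub>V\<^esub>i\<in>{..<5}. c i \<odot>\<^bsub>V\<^esub> ?v i) = \<zero>\<^bsub>V\<^esub>"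
    using family_dependent[OF fin_V dim_V mem] by blast
  have "(\<Oplus>\<^bsub>V\<^esub>i\<in>{..<5}. c i \<odot>\<^bsub>V\<^esub> ?v i) = c 4 \<odot>\<^bsub>V\<^esub> v1 \<oplus>\<^bsub>V\<^esub> (c 3 \<odot>\<^bsub>V\<^esub> v2 \<oplus>\<^bsub>V\<^esub>
      (c 2 \<odot>\<^bsub>V\<^esub> v3 \<oplus>\<^bsub>V\<^esub> (c 1 \<odot>\<^bsub>V\<^esub> v4 \<oplus>\<^bsub>V\<^esub> c 0 \<odot>\<^bsub>V\<^esub> v5)))"
    using v unfolding five by (simp add: smult_closed)
  moreover have "\<not> (c 4 = 0 \<and> c 3 = 0 \<and> c 2 = 0 \<and> c 1 = 0 \<and> c 0 = 0)"
  proof -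
    obtain i where "i < 5" "c i \<noteq> 0" using c(1) by auto
    moreover from this have "i \<in> {4, 3, 2, 1, 0}" unfolding five[symmetric] by simp
    ultimately show ?thesis by auto
  qed
  ultimately show ?thesis
    using c(2) by metis
qed


lemma (in vectorspace) dim_zero_space:
  assumes "carrier V = {\<zero>\<^bsub>V\<^esub>}"
  shows "dim = 0"
proof -
  have "gen_set {}"
    using assms span_empty by simp
  then show ?thesis
    unfolding dim_def by (intro Least_equality) (auto intro!: exI[of _ "{}"])
qed

text \<open>If the identity vanishes, so does every morphism \<open>f = idm C Y \<cdot> f\<close>.\<close>

lemma (in strict_monoidal_lin_cat) idm_nonzero_if_dim:
  assumes "vectorspace.dim class_ring (Hom C Y Y) \<noteq> 0"
  shows "idm C Y \<noteq> \<zero>\<^bsub>Hom C Y Y\<^esub>"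
proof
  interpret M: vectorspace class_ring "Hom C Y Y" by (rule hom_vectorspace)
  assume *: "idm C Y = \<zero>\<^bsub>Hom C Y Y\<^esub>"
  have "f = \<zero>\<^bsub>Hom C Y Y\<^esub>" if "f \<in> mor C Y Y" for f
  proof -
    have f: "arr f" "src f = Y" "tgt f = Y"
      using that by (simp_all add: mor_iff)
    then have "f = \<zero>\<^bsub>Hom C Y Y\<^esub> \<cdot> f"
      using comp_ident(2)[of f Y] * by simp
    then show ?thesis
      using f by (simp add: comp_zero)
  qed
  then have "mor C Y Y = {\<zero>\<^bsub>Hom C Y Y\<^esub>}"
    by auto
  then show False
    using M.dim_zero_space assms by simp
qed

locale trivalent_algebra = trivalent_object C m s \<eta> \<epsilon>
  for C :: "(nat, 'm, 'k::field) lin_cat" (structure) and m s \<eta> \<epsilon> +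
  fixes \<alpha> \<delta> :: 'k
  assumes bigon: "m \<cdot> \<sigma> = \<alpha> \<odot>\<^bsub>Hom C 1 1\<^esub> idm C 1"
    and loop: "\<epsilon> \<cdot> \<eta> = \<delta> \<odot>\<^bsub>Hom C 0 0\<^esub> idm C 0"
begin

lemma bigon_layer:
  assumes "arr x" "tgt x = i + 1 + j"
  shows "layer i m j \<cdot> layer i \<sigma> j \<cdot> x = \<alpha> \<odot>\<^bsub>Hom C (src x) (i + 1 + j)\<^esub> x"
  using whisker[OF bigon, of i j x] assms
  by (simp add: layer_comp comp_assoc layer_smult comp_smult)

lemma loop_layer:
  assumes "arr x" "tgt x = i + j"
  shows "layer i \<epsilon> j \<cdot> layer i \<eta> j \<cdot> x = \<delta> \<odot>\<^bsub>Hom C (src x) (i + j)\<^esub> x"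
  using whisker[OF loop, of i j x] assms
  by (simp add: layer_comp comp_assoc layer_smult comp_smult)

text \<open>The sixth coefficient, of \<open>s H\<close>, makes the family of combinations closed under rotation and under
  composition with \<open>s\<close>.\<close>

definition comb :: "'k \<Rightarrow> 'k \<Rightarrow> 'k \<Rightarrow> 'k \<Rightarrow> 'k \<Rightarrow> 'k \<Rightarrow> 'm"
  where "comb a b c d e p = a \<odot>\<^bsub>Hom C 2 2\<^esub> idm C 2 \<oplus>\<^bsub>Hom C 2 2\<^esub> (b \<odot>\<^bsub>Hom C 2 2\<^esub> s \<oplus>\<^bsub>Hom C 2 2\<^esub>
    (c \<odot>\<^bsub>Hom C 2 2\<^esub> U \<oplus>\<^bsub>Hom C 2 2\<^esub> (d \<odot>\<^bsub>Hom C 2 2\<^esub> K \<oplus>\<^bsub>Hom C 2 2\<^esub>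
      (e \<odot>\<^bsub>Hom C 2 2\<^esub> H \<oplus>\<^bsub>Hom C 2 2\<^esub> p \<odot>\<^bsub>Hom C 2 2\<^esub> (s \<cdot> H)))))"

lemma comb_arr [simp]: "arr (comb a b c d e p)" "src (comb a b c d e p) = 2" "tgt (comb a b c d e p) = 2"
  by (simp_all add: comb_def)

text \<open>Reduces the image of a combination under rotation, bending or composition to the images of the six
  diagrams.\<close>

lemma linear_image_comb:
  fixes \<phi> :: "'m \<Rightarrow> 'm"
  assumes add: "\<And>f g. \<lbrakk>arr f; arr g; src f = 2; src g = 2; tgt f = 2; tgt g = 2\<rbrakk>
      \<Longrightarrow> \<phi> (f \<oplus>\<^bsub>Hom C 2 2\<^esub> g) = \<phi> f \<oplus>\<^bsub>Hom C n k\<^esub> \<phi> g"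
    and smult: "\<And>c f. \<lbrakk>arr f; src f = 2; tgt f = 2\<rbrakk> \<Longrightarrow> \<phi> (c \<odot>\<^bsub>Hom C 2 2\<^esub> f) = c \<odot>\<^bsub>Hom C n k\<^esub> \<phi> f"
  shows "\<phi> (comb a b c d e p) = a \<odot>\<^bsub>Hom C n k\<^esub> \<phi> (idm C 2) \<oplus>\<^bsub>Hom C n k\<^esub> (b \<odot>\<^bsub>Hom C n k\<^esub> \<phi> s \<oplus>\<^bsub>Hom C n k\<^esub>
    (c \<odot>\<^bsub>Hom C n k\<^esub> \<phi> U \<oplus>\<^bsub>Hom C n k\<^esub> (d \<odot>\<^bsub>Hom C n k\<^esub> \<phi> K \<oplus>\<^bsub>Hom C n k\<^esub>
      (e \<odot>\<^bsub>Hom C n k\<^esub> \<phi> H \<oplus>\<^bsub>Hom C n k\<^esub> p \<odot>\<^bsub>Hom C n k\<^esub> \<phi> (s \<cdot> H)))))"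
  by (simp add: comb_def add smult)

lemma smult_plus_add:
  assumes "arr v" "src v = n" "tgt v = k" "arr x" "src x = n" "tgt x = k" "arr y" "src y = n" "tgt y = k"
  shows "(a \<odot>\<^bsub>Hom C n k\<^esub> v \<oplus>\<^bsub>Hom C n k\<^esub> x) \<oplus>\<^bsub>Hom C n k\<^esub> (b \<odot>\<^bsub>Hom C n k\<^esub> v \<oplus>\<^bsub>Hom C n k\<^esub> y)
    = (a + b) \<odot>\<^bsub>Hom C n k\<^esub> v \<oplus>\<^bsub>Hom C n k\<^esub> (x \<oplus>\<^bsub>Hom C n k\<^esub> y)"
proof -
  interpret M: Module.module class_ring "Hom C n k" by (rule hom_module)
  show ?thesis
    using assms by (simp add: smult_plus mor_iff M.a_ac)
qed

lemma comb_add: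
  "comb a b c d e p \<oplus>\<^bsub>Hom C 2 2\<^esub> comb a' b' c' d' e' p'
    = comb (a + a') (b + b') (c + c') (d + d') (e + e') (p + p')"
  unfolding comb_def by (simp add: smult_plus_add smult_plus)

lemma comb_smult:
  "x \<odot>\<^bsub>Hom C 2 2\<^esub> comb a b c d e p = comb (x * a) (x * b) (x * c) (x * d) (x * e) (x * p)"
proof -
  interpret M: Module.module class_ring "Hom C 2 2" by (rule hom_module)
  show ?thesis
    unfolding comb_def by (simp add: M.smult_r_distr mor_iff smult_smult)
qed

lemma rotate_comb: "rotate (comb a b c d e p) = comb c b a e d (- p)"
proof -
  interpret M: Module.module class_ring "Hom C 2 2" by (rule hom_module)
  have "rotate (comb a b c d e p) = a \<odot>\<^bsub>Hom C 2 2\<^esub> rotate (idm C 2) \<oplus>\<^bsub>Hom C 2 2\<^esub> (b \<odot>\<^bsub>Hom C 2 2\<^esub> rotate s \<oplus>\<^bsub>Hom C 2 2\<^esub>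
    (c \<odot>\<^bsub>Hom C 2 2\<^esub> rotate U \<oplus>\<^bsub>Hom C 2 2\<^esub> (d \<odot>\<^bsub>Hom C 2 2\<^esub> rotate K \<oplus>\<^bsub>Hom C 2 2\<^esub>
      (e \<odot>\<^bsub>Hom C 2 2\<^esub> rotate H \<oplus>\<^bsub>Hom C 2 2\<^esub> p \<odot>\<^bsub>Hom C 2 2\<^esub> rotate (s \<cdot> H)))))"
    by (rule linear_image_comb) (simp_all add: rotate_def layer_add layer_smult comp_add comp_smult)
  then show ?thesis
    by (simp add: rotate_one rotate_S rotate_U rotate_K rotate_H rotate_sH layer_zero smult_smult
        comb_def mor_iff M.a_ac)
qed

lemma s_K: "s \<cdot> K = (- 1) \<odot>\<^bsub>Hom C 2 2\<^esub> K"
proof -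
  have "layer 0 s 0 \<cdot> layer 0 K 0 = (- 1) \<odot>\<^bsub>Hom C 2 2\<^esub> layer 0 K 0"
    by (rule arr_eqI[of _ _ 2]) (simp_all add: comp_assoc comp_smult K_layer s_sigma_layer)
  then show ?thesis
    by (simp add: layer_zero)
qed

lemma s_U: "s \<cdot> U = U"
proof -
  have "layer 0 s 0 \<cdot> layer 0 U 0 = layer 0 U 0"
    by (rule arr_eqI[of _ _ 2]) (simp_all add: comp_assoc U_layer cup_symmetric)
  then show ?thesis
    by (simp add: layer_zero)
qed

lemma s_s: "s \<cdot> s = idm C 2"
  using s_involution by (simp add: idm_tens)

lemma s_comb: "s \<cdot> comb a b c d e p = comb b a c (- d) p e"
proof -
  interpret M: Module.module class_ring "Hom C 2 2" by (rule hom_module)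
  have "s \<cdot> comb a b c d e p = a \<odot>\<^bsub>Hom C 2 2\<^esub> (s \<cdot> idm C 2) \<oplus>\<^bsub>Hom C 2 2\<^esub> (b \<odot>\<^bsub>Hom C 2 2\<^esub> (s \<cdot> s) \<oplus>\<^bsub>Hom C 2 2\<^esub>
    (c \<odot>\<^bsub>Hom C 2 2\<^esub> (s \<cdot> U) \<oplus>\<^bsub>Hom C 2 2\<^esub> (d \<odot>\<^bsub>Hom C 2 2\<^esub> (s \<cdot> K) \<oplus>\<^bsub>Hom C 2 2\<^esub>
      (e \<odot>\<^bsub>Hom C 2 2\<^esub> (s \<cdot> H) \<oplus>\<^bsub>Hom C 2 2\<^esub> p \<odot>\<^bsub>Hom C 2 2\<^esub> (s \<cdot> (s \<cdot> H))))))"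
    by (rule linear_image_comb) (simp_all add: comp_add comp_smult)
  moreover have "s \<cdot> (s \<cdot> H) = H"
    using comp_assoc[of H s s] s_s by simp
  ultimately show ?thesis
    by (simp add: s_K s_U s_s smult_smult comb_def mor_iff M.a_ac)
qed

lemma m_cup: 
  assumes "(2::'k) \<noteq> 0"
  shows "m \<cdot> \<eta> = \<zero>\<^bsub>Hom C 0 1\<^esub>"
proof (rule neg_self_zero[OF assms])
  have "s \<cdot> \<eta> = \<eta>"
    using cup_symmetric[of "idm C 0"] by (simp add: layer_zero)
  then have "m \<cdot> \<eta> = (m \<cdot> s) \<cdot> \<eta>"
    by (simp add: comp_assoc)
  then show "m \<cdot> \<eta> = (- 1) \<odot>\<^bsub>Hom C 0 1\<^esub> (m \<cdot> \<eta>)"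
    by (simp add: m_skew comp_smult)
qed simp_all

lemma cap_sigma:
  assumes "(2::'k) \<noteq> 0"
  shows "\<epsilon> \<cdot> \<sigma> = \<zero>\<^bsub>Hom C 1 0\<^esub>"
proof (rule neg_self_zero[OF assms])
  have "\<epsilon> \<cdot> \<sigma> = \<epsilon> \<cdot> (s \<cdot> \<sigma>)"
    using cap_symmetric by (simp flip: comp_assoc)
  then show "\<epsilon> \<cdot> \<sigma> = (- 1) \<odot>\<^bsub>Hom C 1 0\<^esub> (\<epsilon> \<cdot> \<sigma>)"
    using s_sigma by (simp add: layer_zero comp_smult)
qed simp_all

text \<open>By cyclic invariance of \<open>\<epsilon> (m \<otimes> 1)\<close> the two vertices of \<open>H\<close> form a bigon.\<close>

lemma cap_H: "\<epsilon> \<cdot> H = \<alpha> \<odot>\<^bsub>Hom C 2 0\<^esub> \<epsilon>"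
proof -
  have "layer 0 \<epsilon> 0 \<cdot> layer 0 H 0 = \<alpha> \<odot>\<^bsub>Hom C 2 0\<^esub> layer 0 \<epsilon> 0"
    by (rule arr_eqI[of _ _ 2]) (simp_all add: comp_assoc comp_smult H_layer cap_m bigon_layer)
  then show ?thesis
    by (simp add: layer_zero)
qed

lemma cap_U: "\<epsilon> \<cdot> U = \<delta> \<odot>\<^bsub>Hom C 2 0\<^esub> \<epsilon>"
proof -
  have "layer 0 \<epsilon> 0 \<cdot> layer 0 U 0 = \<delta> \<odot>\<^bsub>Hom C 2 0\<^esub> layer 0 \<epsilon> 0"
    by (rule arr_eqI[of _ _ 2]) (simp_all add: comp_assoc comp_smult U_layer loop_layer)
  then show ?thesis
    by (simp add: layer_zero)
qed

lemma cap_comb: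
  assumes "(2::'k) \<noteq> 0"
  shows "\<epsilon> \<cdot> comb a b c d e 0 = (a + b + \<delta> * c + \<alpha> * e) \<odot>\<^bsub>Hom C 2 0\<^esub> \<epsilon>"
proof -
  interpret M: Module.module class_ring "Hom C 2 0" by (rule hom_module)
  have "\<epsilon> \<cdot> comb a b c d e 0 = a \<odot>\<^bsub>Hom C 2 0\<^esub> (\<epsilon> \<cdot> idm C 2) \<oplus>\<^bsub>Hom C 2 0\<^esub> (b \<odot>\<^bsub>Hom C 2 0\<^esub> (\<epsilon> \<cdot> s) \<oplus>\<^bsub>Hom C 2 0\<^esub>
    (c \<odot>\<^bsub>Hom C 2 0\<^esub> (\<epsilon> \<cdot> U) \<oplus>\<^bsub>Hom C 2 0\<^esub> (d \<odot>\<^bsub>Hom C 2 0\<^esub> (\<epsilon> \<cdot> K) \<oplus>\<^bsub>Hom C 2 0\<^esub>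
      (e \<odot>\<^bsub>Hom C 2 0\<^esub> (\<epsilon> \<cdot> H) \<oplus>\<^bsub>Hom C 2 0\<^esub> 0 \<odot>\<^bsub>Hom C 2 0\<^esub> (\<epsilon> \<cdot> (s \<cdot> H))))))"
    by (rule linear_image_comb) (simp_all add: comp_add comp_smult)
  moreover have "\<epsilon> \<cdot> K = \<zero>\<^bsub>Hom C 2 0\<^esub>"
    using comp_assoc[of m \<sigma> \<epsilon>] by (simp add: K_def cap_sigma[OF assms] comp_zero)
  ultimately show ?thesis
    using M.smult_r_null
    by (simp add: cap_symmetric cap_H cap_U smult_smult smult_plus smult_zero mor_iff M.a_ac mult.commute)
qed

lemma m_comb:
  assumes "(2::'k) \<noteq> 0"
  shows "m \<cdot> comb a b c d 0 0 = (a - b + \<alpha> * d) \<odot>\<^bsub>Hom C 2 1\<^esub> m"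
proof -
  interpret M: Module.module class_ring "Hom C 2 1" by (rule hom_module)
  have "m \<cdot> comb a b c d 0 0 = a \<odot>\<^bsub>Hom C 2 1\<^esub> (m \<cdot> idm C 2) \<oplus>\<^bsub>Hom C 2 1\<^esub> (b \<odot>\<^bsub>Hom C 2 1\<^esub> (m \<cdot> s) \<oplus>\<^bsub>Hom C 2 1\<^esub>
    (c \<odot>\<^bsub>Hom C 2 1\<^esub> (m \<cdot> U) \<oplus>\<^bsub>Hom C 2 1\<^esub> (d \<odot>\<^bsub>Hom C 2 1\<^esub> (m \<cdot> K) \<oplus>\<^bsub>Hom C 2 1\<^esub>
      (0 \<odot>\<^bsub>Hom C 2 1\<^esub> (m \<cdot> H) \<oplus>\<^bsub>Hom C 2 1\<^esub> 0 \<odot>\<^bsub>Hom C 2 1\<^esub> (m \<cdot> (s \<cdot> H))))))"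
    by (rule linear_image_comb) (simp_all add: comp_add comp_smult)
  moreover have "m \<cdot> U = \<zero>\<^bsub>Hom C 2 1\<^esub>"
    using comp_assoc[of \<epsilon> \<eta> m] by (simp add: U_def m_cup[OF assms] comp_zero)
  moreover have "m \<cdot> K = \<alpha> \<odot>\<^bsub>Hom C 2 1\<^esub> m"
    using comp_assoc[of m \<sigma> m] by (simp add: K_def bigon comp_smult)
  moreover have "(a - b + \<alpha> * d) \<odot>\<^bsub>Hom C 2 1\<^esub> m
      = a \<odot>\<^bsub>Hom C 2 1\<^esub> m \<oplus>\<^bsub>Hom C 2 1\<^esub> ((- b) \<odot>\<^bsub>Hom C 2 1\<^esub> m \<oplus>\<^bsub>Hom C 2 1\<^esub> (\<alpha> * d) \<odot>\<^bsub>Hom C 2 1\<^esub> m)"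
    using smult_plus[of m 2 1 a "- b + \<alpha> * d"] smult_plus[of m 2 1 "- b" "\<alpha> * d"] by (simp add: algebra_simps)
  ultimately show ?thesis
    using M.smult_r_null by (simp add: m_skew smult_smult smult_zero mor_iff mult.commute)
qed

lemma comb_zero: "comb 0 0 0 0 0 0 = \<zero>\<^bsub>Hom C 2 2\<^esub>"
  using comb_smult[of 0 0 0 0 0 0 0] by (simp add: smult_zero)

text \<open>By the snake and the bigon relation, vanishing of \<open>\<epsilon>\<close> or of \<open>m\<close> would make the identity of \<open>X\<close> vanish.\<close>

lemma nonzero_generators:
  assumes "idm C 2 \<noteq> \<zero>\<^bsub>Hom C 2 2\<^esub>" "\<alpha> \<noteq> 0"
  shows "\<epsilon> \<noteq> \<zero>\<^bsub>Hom C 2 0\<^esub>" "m \<noteq> \<zero>\<^bsub>Hom C 2 1\<^esub>"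
proof -
  have one: "idm C 1 \<noteq> \<zero>\<^bsub>Hom C 1 1\<^esub>"
  proof
    assume "idm C 1 = \<zero>\<^bsub>Hom C 1 1\<^esub>"
    then have "layer 0 (idm C 1) 1 = layer 0 \<zero>\<^bsub>Hom C 1 1\<^esub> 1"
      by (rule arg_cong)
    then show False
      using assms(1) by (simp add: layer_zero_mor)
  qed
  show "\<epsilon> \<noteq> \<zero>\<^bsub>Hom C 2 0\<^esub>"
  proof
    assume "\<epsilon> = \<zero>\<^bsub>Hom C 2 0\<^esub>"
    then have "idm C 1 = layer 0 \<zero>\<^bsub>Hom C 2 0\<^esub> 1 \<cdot> layer 1 \<eta> 0 \<cdot> idm C 1"
      using snake_left_layer[of "idm C 1" 1 0 1 0] by simp
    then show False
      using one by (simp add: layer_zero_mor comp_zero)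
  qed
  show "m \<noteq> \<zero>\<^bsub>Hom C 2 1\<^esub>"
  proof
    assume "m = \<zero>\<^bsub>Hom C 2 1\<^esub>"
    then have "m \<cdot> \<sigma> = \<zero>\<^bsub>Hom C 2 1\<^esub> \<cdot> \<sigma>"
      by (rule arg_cong)
    then have "\<alpha> \<odot>\<^bsub>Hom C 1 1\<^esub> idm C 1 = \<zero>\<^bsub>Hom C 1 1\<^esub>"
      by (simp add: bigon comp_zero)
    then show False
      using smult_eq_zeroD[where c = \<alpha> and f = "idm C 1" and n = 1 and k = 1] one assms(2) by simp
  qed
qed

text \<open>The coefficients \<open>(\<alpha>, -2\<alpha>, \<alpha>, 1 - \<delta>, 1 - \<delta>)\<close> are those of the skein relation multiplied by
  \<open>1 - \<delta>\<close>.\<close>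

theorem five_diagrams_relation:
  assumes two: "(2::'k) \<noteq> 0" and delta: "\<delta> \<noteq> - 2" and alpha: "\<alpha> \<noteq> 0"
    and nz: "idm C 2 \<noteq> \<zero>\<^bsub>Hom C 2 2\<^esub>"
    and rel: "comb a b c d e 0 = \<zero>\<^bsub>Hom C 2 2\<^esub>"
    and nontrivial: "\<not> (a = 0 \<and> b = 0 \<and> c = 0 \<and> d = 0 \<and> e = 0)"
  shows "\<delta> \<noteq> 1 \<and> comb \<alpha> (- 2 * \<alpha>) \<alpha> (1 - \<delta>) (1 - \<delta>) 0 = \<zero>\<^bsub>Hom C 2 2\<^esub>"
proof -
  interpret M: Module.module class_ring "Hom C 2 2" by (rule hom_module)
  define R where "R a b c d e p \<longleftrightarrow> comb a b c d e p = \<zero>\<^bsub>Hom C 2 2\<^esub>" for a b c d e p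
  have add: "R (a + a') (b + b') (c + c') (d + d') (e + e') (p + p')"
    if "R a b c d e p" "R a' b' c' d' e' p'" for a b c d e p a' b' c' d' e' p'
    using that unfolding R_def comb_add[symmetric] by simp
  have scale: "R (x * a) (x * b) (x * c) (x * d) (x * e) (x * p)" if "R a b c d e p" for x a b c d e p
    using that M.smult_r_null unfolding R_def comb_smult[symmetric] by simp
  have rot: "R c b a e d (- p)" if "R a b c d e p" for a b c d e p
    using that rotate_comb[of 0 0 0 0 0 0] unfolding R_def
    by (metis rotate_comb comb_zero minus_zero)
  have swap: "R b a c (- d) p e" if "R a b c d e p" for a b c d e p
    using that unfolding R_def s_comb[symmetric] by (simp add: comp_zero)
  have cap: "a + b + \<delta> * c + \<alpha> * e = 0" if "R a b c d e 0" for a b c d e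
  proof (rule smult_eq_zeroD)
    show "(a + b + \<delta> * c + \<alpha> * e) \<odot>\<^bsub>Hom C 2 0\<^esub> \<epsilon> = \<zero>\<^bsub>Hom C 2 0\<^esub>"
      using that cap_comb[OF two, of a b c d e] by (simp add: R_def comp_zero)
  qed (simp_all add: nonzero_generators nz alpha)
  have mul: "a - b + \<alpha> * d = 0" if "R a b c d 0 0" for a b c d
  proof (rule smult_eq_zeroD)
    show "(a - b + \<alpha> * d) \<odot>\<^bsub>Hom C 2 1\<^esub> m = \<zero>\<^bsub>Hom C 2 1\<^esub>"
      using that m_comb[OF two, of a b c d] by (simp add: R_def comp_zero)
  qed (simp_all add: nonzero_generators nz alpha)
  (* Composition with s followed by rotation: the two relations have opposite coefficients at s H. *)
  have mix: "R (b + c) (2 * a) (b + c) (- d) (- d) 0" if "R a b c d e 0" for a b c d e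
    using add[OF swap[OF that] rot[OF swap[OF that]]] by (simp add: add.commute)
  have R0: "R a b c d e 0"
    using rel by (simp add: R_def)
  (* A relation among 1, s and U: composing it and its rotation with m gives a = b = c. *)
  have de: "\<not> (d = 0 \<and> e = 0)"
  proof
    assume *: "d = 0 \<and> e = 0"
    then have "a = b" "c = b" "a + b + \<delta> * c = 0"
      using mul[of a b c 0] mul[of c b a 0] cap[of a b c 0 0] R0 rot[OF R0] by auto
    then have "(2 + \<delta>) * a = 0"
      by (simp add: algebra_simps)
    then show False
      using delta nontrivial * \<open>a = b\<close> \<open>c = b\<close> by (auto simp: add_eq_0_iff)
  qed
  (* The symmetrised relation has r = -d; rotating first gives r = -e instead. *)
  obtain p q r where r: "r \<noteq> 0" "R p q p r r 0"
  proof (cases "d = 0")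
    case True
    then show ?thesis
      using that[of "- e"] mix[OF rot[OF R0, simplified]] de by auto
  next
    case False
    then show ?thesis
      using that[of "- d"] mix[OF R0] by auto
  qed
  have "R (q + 2 * p) (q + 2 * p) (q + 2 * p) 0 0 0"
    using add[OF r(2) mix[OF r(2)]] by (simp add: algebra_simps)
  then have "(2 + \<delta>) * (q + 2 * p) = 0"
    using cap by (fastforce simp: algebra_simps)
  moreover have "2 + \<delta> \<noteq> 0"
    using delta by (metis add.commute eq_neg_iff_add_eq_0)
  ultimately have q: "q = - 2 * p"
    by (simp add: eq_neg_iff_add_eq_0)
  then have p: "p * (1 - \<delta>) = \<alpha> * r"
    using cap[OF r(2)] by (simp add: algebra_simps)
  then have "\<delta> \<noteq> 1"
    using alpha r(1) by auto
  moreover have "R \<alpha> (- 2 * \<alpha>) \<alpha> (1 - \<delta>) (1 - \<delta>) 0"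
  proof -
    define y where "y = (1 - \<delta>) / r"
    have "y * p = \<alpha>" "y * r = 1 - \<delta>"
      using p r(1) by (simp_all add: y_def mult.commute)
    moreover from this have "y * q = - 2 * \<alpha>"
      by (simp add: q mult.left_commute)
    ultimately show ?thesis
      using scale[OF r(2), of y] by simp
  qed
  ultimately show ?thesis
    by (simp add: R_def)
qed

section \<open>The skein relation and the vector product identity\<close>

lemma K_plus_H_comb: "K \<oplus>\<^bsub>Hom C 2 2\<^esub> H = comb 0 0 0 1 1 0"
proof -
  interpret M: Module.module class_ring "Hom C 2 2" by (rule hom_module)
  show ?thesis
    by (simp add: comb_def smult_zero smult_one mor_iff)
qed

lemma K_plus_H:
  assumes "\<delta> \<noteq> 1" "comb \<alpha> (- 2 * \<alpha>) \<alpha> (1 - \<delta>) (1 - \<delta>) 0 = \<zero>\<^bsub>Hom C 2 2\<^esub>"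
  shows "K \<oplus>\<^bsub>Hom C 2 2\<^esub> H = comb (- (\<alpha> / (1 - \<delta>))) (2 * (\<alpha> / (1 - \<delta>))) (- (\<alpha> / (1 - \<delta>))) 0 0 0"
proof -
  interpret M: Module.module class_ring "Hom C 2 2" by (rule hom_module)
  let ?c = "\<alpha> / (1 - \<delta>)"
  have "comb (- ?c) (2 * ?c) (- ?c) 0 0 0 = comb (- ?c) (2 * ?c) (- ?c) 0 0 0
      \<oplus>\<^bsub>Hom C 2 2\<^esub> (1 / (1 - \<delta>)) \<odot>\<^bsub>Hom C 2 2\<^esub> comb \<alpha> (- 2 * \<alpha>) \<alpha> (1 - \<delta>) (1 - \<delta>) 0"
    using assms(2) M.smult_r_null by (simp add: mor_iff)
  also have "\<dots> = comb 0 0 0 1 1 0"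
    unfolding comb_smult comb_add using assms(1) by simp
  finally show ?thesis
    by (simp add: K_plus_H_comb)
qed

text \<open>The dimension enters twice: five diagrams are dependent because it is less than five, and the
  identity is nonzero because it is positive.\<close>

theorem skein_if_dim_four:
  assumes two: "(2::'k) \<noteq> 0" and delta: "\<delta> \<noteq> - 2" and alpha: "\<alpha> \<noteq> 0"
    and fin: "vectorspace.fin_dim class_ring (Hom C 2 2)"
    and dim: "vectorspace.dim class_ring (Hom C 2 2) = 4"
  shows "\<delta> \<noteq> 1"
    and "K \<oplus>\<^bsub>Hom C 2 2\<^esub> H = comb (- (\<alpha> / (1 - \<delta>))) (2 * (\<alpha> / (1 - \<delta>))) (- (\<alpha> / (1 - \<delta>))) 0 0 0"
proof -
  interpret M: Module.module class_ring "Hom C 2 2" by (rule hom_module)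
  have nz: "idm C 2 \<noteq> \<zero>\<^bsub>Hom C 2 2\<^esub>"
    by (rule idm_nonzero_if_dim) (simp add: dim)
  have dim5: "vectorspace.dim class_ring (Hom C 2 2) < 5"
    using dim by simp
  have diagrams: "idm C 2 \<in> mor C 2 2" "s \<in> mor C 2 2" "U \<in> mor C 2 2" "K \<in> mor C 2 2" "H \<in> mor C 2 2"
    by (simp_all add: mor_iff)
  obtain a b c d e where nontrivial: "\<not> (a = 0 \<and> b = 0 \<and> c = 0 \<and> d = 0 \<and> e = 0)"
    and rel: "a \<odot>\<^bsub>Hom C 2 2\<^esub> idm C 2 \<oplus>\<^bsub>Hom C 2 2\<^esub> (b \<odot>\<^bsub>Hom C 2 2\<^esub> s \<oplus>\<^bsub>Hom C 2 2\<^esub>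
      (c \<odot>\<^bsub>Hom C 2 2\<^esub> U \<oplus>\<^bsub>Hom C 2 2\<^esub> (d \<odot>\<^bsub>Hom C 2 2\<^esub> K \<oplus>\<^bsub>Hom C 2 2\<^esub>
        e \<odot>\<^bsub>Hom C 2 2\<^esub> H))) = \<zero>\<^bsub>Hom C 2 2\<^esub>"
    using five_vectors_dependent[OF hom_vectorspace fin dim5 diagrams] by blast
  have "comb a b c d e 0 = \<zero>\<^bsub>Hom C 2 2\<^esub>"
    using rel by (simp add: comb_def smult_zero mor_iff)
  then have main: "\<delta> \<noteq> 1" "comb \<alpha> (- 2 * \<alpha>) \<alpha> (1 - \<delta>) (1 - \<delta>) 0 = \<zero>\<^bsub>Hom C 2 2\<^esub>"
    using five_diagrams_relation[OF two delta alpha nz _ nontrivial] by blast+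
  show "\<delta> \<noteq> 1"
    by (rule main(1))
  show "K \<oplus>\<^bsub>Hom C 2 2\<^esub> H = comb (- (\<alpha> / (1 - \<delta>))) (2 * (\<alpha> / (1 - \<delta>))) (- (\<alpha> / (1 - \<delta>))) 0 0 0"
    by (rule K_plus_H[OF main])
qed

lemma skein_comb:
  "comb (- c) (2 * c) (- c) 0 0 0 = c \<odot>\<^bsub>Hom C 2 2\<^esub>
    (2 \<odot>\<^bsub>Hom C 2 2\<^esub> s \<ominus>\<^bsub>Hom C 2 2\<^esub> idm C 2 \<ominus>\<^bsub>Hom C 2 2\<^esub> U)"
proof -
  interpret M: Module.module class_ring "Hom C 2 2" by (rule hom_module)
  show ?thesis
    by (simp add: comb_def smult_zero minus_smult M.smult_r_distr smult_smult mor_iff M.a_ac mult.commute)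
qed

lemma bend_comb:
  "bend (comb a b c d e 0) = a \<odot>\<^bsub>Hom C 3 1\<^esub> layer 1 \<epsilon> 0 \<oplus>\<^bsub>Hom C 3 1\<^esub> (b \<odot>\<^bsub>Hom C 3 1\<^esub> bend s
    \<oplus>\<^bsub>Hom C 3 1\<^esub> (c \<odot>\<^bsub>Hom C 3 1\<^esub> layer 0 \<epsilon> 1 \<oplus>\<^bsub>Hom C 3 1\<^esub> (d \<odot>\<^bsub>Hom C 3 1\<^esub> (layer 0 m 0 \<cdot> layer 0 m 1)
      \<oplus>\<^bsub>Hom C 3 1\<^esub> e \<odot>\<^bsub>Hom C 3 1\<^esub> (layer 0 m 0 \<cdot> layer 1 m 0))))"
proof -
  interpret M: Module.module class_ring "Hom C 3 1" by (rule hom_module)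
  have "bend (comb a b c d e 0) = a \<odot>\<^bsub>Hom C 3 1\<^esub> bend (idm C 2) \<oplus>\<^bsub>Hom C 3 1\<^esub> (b \<odot>\<^bsub>Hom C 3 1\<^esub> bend s
    \<oplus>\<^bsub>Hom C 3 1\<^esub> (c \<odot>\<^bsub>Hom C 3 1\<^esub> bend U \<oplus>\<^bsub>Hom C 3 1\<^esub> (d \<odot>\<^bsub>Hom C 3 1\<^esub> bend K
      \<oplus>\<^bsub>Hom C 3 1\<^esub> (e \<odot>\<^bsub>Hom C 3 1\<^esub> bend H \<oplus>\<^bsub>Hom C 3 1\<^esub> 0 \<odot>\<^bsub>Hom C 3 1\<^esub> bend (s \<cdot> H)))))"
    by (rule linear_image_comb) (simp_all add: bend_def layer_add layer_smult comp_add comp_smult)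
  moreover have "0 \<odot>\<^bsub>Hom C 3 1\<^esub> bend (s \<cdot> H) = \<zero>\<^bsub>Hom C 3 1\<^esub>"
    by (rule smult_zero) (simp_all add: bend_def)
  ultimately show ?thesis
    by (simp add: bend_one bend_U bend_K bend_H mor_iff)
qed

text \<open>Rescaling the cap by \<open>c\<close> and the cup by the inverse of \<open>c\<close> preserves the snake relations and all
  relations that are linear in the cap or the cup; bending the skein relation gives the remaining
  identity.\<close>

theorem vector_product_algebra_if_skein:
  assumes sym: "symmetric_monoidal_lin_cat C" and braiding: "braiding C 1 1 = s"
    and c: "c \<noteq> 0" and skein: "K \<oplus>\<^bsub>Hom C 2 2\<^esub> H = comb (- c) (2 * c) (- c) 0 0 0"
  shows "vector_product_algebra C 1 m (inverse c \<odot>\<^bsub>Hom C 0 2\<^esub> \<eta>) (c \<odot>\<^bsub>Hom C 2 0\<^esub> \<epsilon>)"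
proof -
  interpret symmetric_monoidal_lin_cat C by (rule sym)
  interpret M: Module.module class_ring "Hom C 3 1" by (rule hom_module)
  have "m \<cdot> (m \<boxtimes> idm C 1) \<oplus>\<^bsub>Hom C 3 1\<^esub> m \<cdot> (idm C 1 \<boxtimes> m) = bend (comb 0 0 0 1 1 0)"
    unfolding bend_comb by (simp add: bend_def smult_zero smult_one mor_iff tens_layer layer_zero)
  also have "\<dots> = bend (comb (- c) (2 * c) (- c) 0 0 0)"
    using skein by (simp add: K_plus_H_comb)
  also have "\<dots> = (2 * c) \<odot>\<^bsub>Hom C 3 1\<^esub> bend s \<oplus>\<^bsub>Hom C 3 1\<^esub> ((- c) \<odot>\<^bsub>Hom C 3 1\<^esub> layer 1 \<epsilon> 0
      \<oplus>\<^bsub>Hom C 3 1\<^esub> (- c) \<odot>\<^bsub>Hom C 3 1\<^esub> layer 0 \<epsilon> 1)"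
    unfolding bend_comb by (simp add: bend_def smult_zero mor_iff M.a_ac)
  finally have vp: "m \<cdot> (m \<boxtimes> idm C 1) \<oplus>\<^bsub>Hom C 3 1\<^esub> m \<cdot> (idm C 1 \<boxtimes> m)
    = 2 \<odot>\<^bsub>Hom C 3 1\<^esub> (c \<odot>\<^bsub>Hom C 3 1\<^esub> bend s) \<ominus>\<^bsub>Hom C 3 1\<^esub> c \<odot>\<^bsub>Hom C 3 1\<^esub> layer 1 \<epsilon> 0
      \<ominus>\<^bsub>Hom C 3 1\<^esub> c \<odot>\<^bsub>Hom C 3 1\<^esub> layer 0 \<epsilon> 1"
    by (simp add: minus_smult smult_smult bend_def mor_iff M.a_assoc)
  show ?thesis
  proof unfold_locales
    show "m \<cdot> (m \<boxtimes> idm C 1) \<oplus>\<^bsub>Hom C (1 \<boxdot> 1 \<boxdot> 1) 1\<^esub> m \<cdot> (idm C 1 \<boxtimes> m)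
       = 2 \<odot>\<^bsub>Hom C (1 \<boxdot> 1 \<boxdot> 1) 1\<^esub> ((idm C 1 \<boxtimes> (c \<odot>\<^bsub>Hom C 2 0\<^esub> \<epsilon>)) \<cdot> (braiding C 1 1 \<boxtimes> idm C 1))
         \<ominus>\<^bsub>Hom C (1 \<boxdot> 1 \<boxdot> 1) 1\<^esub> (idm C 1 \<boxtimes> (c \<odot>\<^bsub>Hom C 2 0\<^esub> \<epsilon>))
         \<ominus>\<^bsub>Hom C (1 \<boxdot> 1 \<boxdot> 1) 1\<^esub> ((c \<odot>\<^bsub>Hom C 2 0\<^esub> \<epsilon>) \<boxtimes> idm C 1)"
      using vp by (simp add: braiding tensor_smult layer_smult comp_smult tens_layer bend_def)
  qed (use c in \<open>simp_all add: braiding mor_iff tensor_smult comp_smult smult_smult smult_one snake_left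
      snake_right m_rotation cap_slide cap_symmetric m_skew neg_one_smult\<close>)
qed

end


section \<open>The category presented by generators and relations is symmetric monoidal\<close>

text \<open>Source, target and well-formedness by recursion, so that typing of expressions is computed by
  simplification.\<close>

primrec source :: "'k expr \<Rightarrow> nat"
  where
    "source (EId n) = n" | "source EMult = 2" | "source ESwap = 2" | "source ECup = 0" | "source ECap = 2"
  | "source (EComp t u) = source u" | "source (ETens t u) = source t + source u"
  | "source (EZero n k) = n" | "source (EAdd t u) = source t" | "source (EScale c t) = source t"

primrec target :: "'k expr \<Rightarrow> nat"
  where
    "target (EId n) = n" | "target EMult = 1" | "target ESwap = 2" | "target ECup = 2" | "target ECap = 0"
  | "target (EComp t u) = target t" | "target (ETens t u) = target t + target u"
  | "target (EZero n k) = k" | "target (EAdd t u) = target t" | "target (EScale c t) = target t"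

primrec well_formed :: "'k expr \<Rightarrow> bool"
  where
    "well_formed (EId n) = True" | "well_formed EMult = True" | "well_formed ESwap = True" | "well_formed ECup = True" | "well_formed ECap = True"
  | "well_formed (EComp t u) \<longleftrightarrow> well_formed t \<and> well_formed u \<and> target u = source t"
  | "well_formed (ETens t u) \<longleftrightarrow> well_formed t \<and> well_formed u"
  | "well_formed (EZero n k) = True"
  | "well_formed (EAdd t u) \<longleftrightarrow> well_formed t \<and> well_formed u \<and> source t = source u \<and> target t = target u"
  | "well_formed (EScale c t) \<longleftrightarrow> well_formed t"

lemma well_formed_typed: "well_formed t \<Longrightarrow> typed t (source t) (target t)"
  by (induction t) (auto intro: typed.intros)

lemma typed_iff: "typed t n k \<longleftrightarrow> well_formed t \<and> source t = n \<and> target t = k"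
proof
  show "typed t n k \<Longrightarrow> well_formed t \<and> source t = n \<and> target t = k"
    by (induction rule: typed.induct) auto
qed (auto dest: well_formed_typed)

lemma T_rel_typed: "T_rel \<delta> \<alpha> t u \<Longrightarrow> well_formed t \<and> well_formed u \<and> source t = source u \<and> target t = target u"
  by (induction rule: T_rel.induct) auto

lemma T_eq_typed: "T_eq \<delta> \<alpha> t u \<Longrightarrow> well_formed t \<and> well_formed u \<and> source t = source u \<and> target t = target u"
proof (induction rule: T_eq.induct)
  case (4 t u)
  then show ?case by (rule T_rel_typed)
qed (auto simp: typed_iff)

lemma T_eq_refl: "well_formed t \<Longrightarrow> T_eq \<delta> \<alpha> t t"
  by (auto intro: T_eq.intros(1) well_formed_typed)

lemma T_class_eqI: "T_eq \<delta> \<alpha> t u \<Longrightarrow> T_class \<delta> \<alpha> t = T_class \<delta> \<alpha> u"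
  unfolding T_class_def by (auto intro: T_eq.intros(2,3))

lemma T_class_mem: "well_formed t \<Longrightarrow> t \<in> T_class \<delta> \<alpha> t"
  by (simp add: T_class_def T_eq_refl)

lemma T_class_eqD: "T_class \<delta> \<alpha> t = T_class \<delta> \<alpha> u \<Longrightarrow> well_formed u \<Longrightarrow> T_eq \<delta> \<alpha> t u"
  using T_class_mem[of u \<delta> \<alpha>] by (auto simp: T_class_def)

text \<open>The operations of \<open>T_cat\<close> are unions over representatives; when all representatives give the same
  value, the union is that value.\<close>

lemma T_class_UN2:
  assumes "well_formed t" "well_formed u" "\<And>t' u'. T_eq \<delta> \<alpha> t t' \<Longrightarrow> T_eq \<delta> \<alpha> u u' \<Longrightarrow> F t' u' = F t u"
  shows "(\<Union>t'\<in>T_class \<delta> \<alpha> t. \<Union>u'\<in>T_class \<delta> \<alpha> u. F t' u') = F t u"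
proof -
  have "(\<Union>t'\<in>T_class \<delta> \<alpha> t. \<Union>u'\<in>T_class \<delta> \<alpha> u. F t' u')
      = (\<Union>t'\<in>T_class \<delta> \<alpha> t. \<Union>u'\<in>T_class \<delta> \<alpha> u. F t u)"
    by (intro SUP_cong refl assms(3)) (simp_all add: T_class_def)
  also have "\<dots> = F t u"
    using T_class_mem[OF assms(1), of \<delta> \<alpha>] T_class_mem[OF assms(2), of \<delta> \<alpha>] by blast
  finally show ?thesis .
qed

lemma T_objects [simp]: "ounit (T_cat \<delta> \<alpha>) = 0" "n \<boxdot>\<^bsub>T_cat \<delta> \<alpha>\<^esub> k = n + k"
  by (simp_all add: T_cat_def)

lemma T_idm: "idm (T_cat \<delta> \<alpha>) n = T_class \<delta> \<alpha> (EId n)"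
  by (simp add: T_cat_def)

lemma T_braiding: "braiding (T_cat \<delta> \<alpha>) n k = T_class \<delta> \<alpha> (EBraid n k)"
  by (simp add: T_cat_def)

lemma T_mor_iff: "A \<in> mor (T_cat \<delta> \<alpha>) n k \<longleftrightarrow> (\<exists>t. well_formed t \<and> source t = n \<and> target t = k \<and> A = T_class \<delta> \<alpha> t)"
  by (auto simp: T_cat_def typed_iff)

lemma T_zero: "\<zero>\<^bsub>Hom (T_cat \<delta> \<alpha>) n k\<^esub> = T_class \<delta> \<alpha> (EZero n k)"
  by (simp add: T_cat_def)

lemma T_comp:
  assumes "well_formed t" "well_formed u" "target u = source t"
  shows "T_class \<delta> \<alpha> t \<cdot>\<^bsub>T_cat \<delta> \<alpha>\<^esub> T_class \<delta> \<alpha> u = T_class \<delta> \<alpha> (EComp t u)"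
proof -
  have "(\<Union>t'\<in>T_class \<delta> \<alpha> t. \<Union>u'\<in>T_class \<delta> \<alpha> u. T_class \<delta> \<alpha> (EComp t' u')) = T_class \<delta> \<alpha> (EComp t u)"
    using assms by (intro T_class_UN2 T_class_eqI[OF T_eq.intros(2)[OF T_eq.intros(5)]]) (simp_all add: typed_iff)
  then show ?thesis
    by (simp add: T_cat_def)
qed

lemma T_tens:
  assumes "well_formed t" "well_formed u"
  shows "T_class \<delta> \<alpha> t \<boxtimes>\<^bsub>T_cat \<delta> \<alpha>\<^esub> T_class \<delta> \<alpha> u = T_class \<delta> \<alpha> (ETens t u)"
proof -
  have "(\<Union>t'\<in>T_class \<delta> \<alpha> t. \<Union>u'\<in>T_class \<delta> \<alpha> u. T_class \<delta> \<alpha> (ETens t' u')) = T_class \<delta> \<alpha> (ETens t u)"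
    using assms by (intro T_class_UN2 T_class_eqI[OF T_eq.intros(2)[OF T_eq.intros(6)]]) (simp_all add: typed_iff)
  then show ?thesis
    by (simp add: T_cat_def)
qed

lemma T_add:
  assumes "well_formed t" "well_formed u" "source t = source u" "target t = target u"
  shows "T_class \<delta> \<alpha> t \<oplus>\<^bsub>Hom (T_cat \<delta> \<alpha>) n k\<^esub> T_class \<delta> \<alpha> u = T_class \<delta> \<alpha> (EAdd t u)"
proof -
  have "(\<Union>t'\<in>T_class \<delta> \<alpha> t. \<Union>u'\<in>T_class \<delta> \<alpha> u. T_class \<delta> \<alpha> (EAdd t' u')) = T_class \<delta> \<alpha> (EAdd t u)"
    using assms by (intro T_class_UN2 T_class_eqI[OF T_eq.intros(2)[OF T_eq.intros(7)]]) (simp_all add: typed_iff)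
  then show ?thesis
    by (simp add: T_cat_def)
qed

lemma T_smult:
  assumes "well_formed t"
  shows "c \<odot>\<^bsub>Hom (T_cat \<delta> \<alpha>) n k\<^esub> T_class \<delta> \<alpha> t = T_class \<delta> \<alpha> (EScale c t)"
proof -
  have "T_class \<delta> \<alpha> (EScale c t') = T_class \<delta> \<alpha> (EScale c t)" if "t' \<in> T_class \<delta> \<alpha> t" for t'
    using that by (intro T_class_eqI[OF T_eq.intros(2)[OF T_eq.intros(8)]]) (simp add: T_class_def)
  then have "(\<Union>t'\<in>T_class \<delta> \<alpha> t. T_class \<delta> \<alpha> (EScale c t')) = T_class \<delta> \<alpha> (EScale c t)"
    using T_class_mem[OF assms, of \<delta> \<alpha>] by blast
  then show ?thesis
    by (simp add: T_cat_def)
qed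

lemmas T_ops = T_idm T_zero T_comp T_tens T_add T_smult

lemma T_hom_vectorspace: "vectorspace class_ring (Hom (T_cat \<delta> \<alpha>) n k)" (is "vectorspace _ ?V")
proof -
  have "abelian_group ?V"
  proof (rule abelian_groupI)
    fix A assume "A \<in> carrier ?V"
    then obtain t where t: "well_formed t" "source t = n" "target t = k" "A = T_class \<delta> \<alpha> t"
      by (auto simp: T_mor_iff)
    have "T_class \<delta> \<alpha> (EAdd (EScale (- 1) t) t) = T_class \<delta> \<alpha> (EZero n k)"
      using t by (intro T_class_eqI T_eq.intros(3)[OF T_eq.intros(10) T_eq.intros(12)]) (auto simp: typed_iff)
    then have "T_class \<delta> \<alpha> (EScale (- 1) t) \<oplus>\<^bsub>?V\<^esub> A = \<zero>\<^bsub>?V\<^esub>"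
      using t by (simp add: T_ops)
    moreover have "T_class \<delta> \<alpha> (EScale (- 1) t) \<in> carrier ?V"
      using t by (auto simp: T_mor_iff intro!: exI[of _ "EScale (- 1) t"])
    ultimately show "\<exists>B\<in>carrier ?V. B \<oplus>\<^bsub>?V\<^esub> A = \<zero>\<^bsub>?V\<^esub>"
      by blast
    have "T_class \<delta> \<alpha> (EAdd (EZero n k) t) = T_class \<delta> \<alpha> t"
      using t by (intro T_class_eqI T_eq.intros(3)[OF T_eq.intros(10) T_eq.intros(11)]) (auto simp: typed_iff)
    then show "\<zero>\<^bsub>?V\<^esub> \<oplus>\<^bsub>?V\<^esub> A = A"
      using t by (simp add: T_ops)
  next
    show "\<zero>\<^bsub>?V\<^esub> \<in> carrier ?V"
      by (auto simp: T_mor_iff T_zero intro!: exI[of _ "EZero n k"])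
  next
    fix A B assume "A \<in> carrier ?V" "B \<in> carrier ?V"
    then obtain t u where tu: "well_formed t" "source t = n" "target t = k" "A = T_class \<delta> \<alpha> t"
      "well_formed u" "source u = n" "target u = k" "B = T_class \<delta> \<alpha> u"
      by (auto simp: T_mor_iff)
    then show "A \<oplus>\<^bsub>?V\<^esub> B \<in> carrier ?V"
      by (auto simp: T_mor_iff T_add intro!: exI[of _ "EAdd t u"])
    show "A \<oplus>\<^bsub>?V\<^esub> B = B \<oplus>\<^bsub>?V\<^esub> A"
      using tu by (auto simp: T_add typed_iff intro!: T_class_eqI T_eq.intros(10))
    fix D assume "D \<in> carrier ?V"
    then obtain v where "well_formed v" "source v = n" "target v = k" "D = T_class \<delta> \<alpha> v"
      by (auto simp: T_mor_iff)
    then show "A \<oplus>\<^bsub>?V\<^esub> B \<oplus>\<^bsub>?V\<^esub> D = A \<oplus>\<^bsub>?V\<^esub> (B \<oplus>\<^bsub>?V\<^esub> D)"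
      using tu by (auto simp: T_add typed_iff intro!: T_class_eqI T_eq.intros(9))
  qed
  moreover have "module_axioms class_ring ?V"
  proof (rule module_axioms.intro)
    fix a b A assume "A \<in> carrier ?V"
    then obtain t where t: "well_formed t" "source t = n" "target t = k" "A = T_class \<delta> \<alpha> t"
      by (auto simp: T_mor_iff)
    then show "a \<odot>\<^bsub>?V\<^esub> A \<in> carrier ?V"
      by (auto simp: T_mor_iff T_smult intro!: exI[of _ "EScale a t"])
    show "(a \<oplus>\<^bsub>class_ring\<^esub> b) \<odot>\<^bsub>?V\<^esub> A = a \<odot>\<^bsub>?V\<^esub> A \<oplus>\<^bsub>?V\<^esub> b \<odot>\<^bsub>?V\<^esub> A"
      using t by (auto simp: T_ops typed_iff intro!: T_class_eqI T_eq.intros(14))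
    show "(a \<otimes>\<^bsub>class_ring\<^esub> b) \<odot>\<^bsub>?V\<^esub> A = a \<odot>\<^bsub>?V\<^esub> (b \<odot>\<^bsub>?V\<^esub> A)"
      using t by (auto simp: T_ops typed_iff intro!: T_class_eqI T_eq.intros(15))
    show "\<one>\<^bsub>class_ring\<^esub> \<odot>\<^bsub>?V\<^esub> A = A"
      using t by (auto simp: T_ops typed_iff intro!: T_class_eqI T_eq.intros(16))
    fix B assume "B \<in> carrier ?V"
    then obtain u where "well_formed u" "source u = n" "target u = k" "B = T_class \<delta> \<alpha> u"
      by (auto simp: T_mor_iff)
    then show "a \<odot>\<^bsub>?V\<^esub> (A \<oplus>\<^bsub>?V\<^esub> B) = a \<odot>\<^bsub>?V\<^esub> A \<oplus>\<^bsub>?V\<^esub> a \<odot>\<^bsub>?V\<^esub> B"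
      using t by (auto simp: T_ops typed_iff intro!: T_class_eqI T_eq.intros(13))
  qed
  ultimately show ?thesis
    using class_field by (auto simp: vectorspace_def Module.module_def field_def domain_def)
qed

theorem T_strict_monoidal: "strict_monoidal_lin_cat (T_cat \<delta> \<alpha>)"
proof (rule strict_monoidal_lin_cat.intro, goal_cases)
  case (1 Y Z)
  show ?case by (rule T_hom_vectorspace)
next
  case (2 f Y Z Y' Z')
  then show ?case
    by (auto simp: T_mor_iff dest!: T_class_eqD T_eq_typed)
next
  case (3 Y)
  then show ?case by (auto simp: T_mor_iff T_idm intro!: exI[of _ "EId Y"])
next
  case (4 f Y Z g W)
  then show ?case by (fastforce simp: T_mor_iff T_comp intro: exI[of _ "EComp _ _"])
next
  case (5 f Y Z)
  then show ?case by (clarsimp simp: T_mor_iff T_ops) (rule T_class_eqI, rule T_eq.intros(17), auto simp: typed_iff)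
next
  case (6 f Y Z)
  then show ?case by (clarsimp simp: T_mor_iff T_ops) (rule T_class_eqI, rule T_eq.intros(18), auto simp: typed_iff)
next
  case (7 f Y Z g W h V)
  then show ?case by (clarsimp simp: T_mor_iff T_ops) (rule T_class_eqI, rule T_eq.intros(19), auto simp: typed_iff)
next
  case (8 f Y Z g W g')
  then show ?case by (clarsimp simp: T_mor_iff T_ops) (rule T_class_eqI, rule T_eq.intros(25), auto simp: typed_iff)
next
  case (9 f Y Z f' g W)
  then show ?case by (clarsimp simp: T_mor_iff T_ops) (rule T_class_eqI, rule T_eq.intros(26), auto simp: typed_iff)
next
  case (10 f Y Z g W c)
  then show ?case by (clarsimp simp: T_mor_iff T_ops) (rule T_class_eqI, rule T_eq.intros(27), auto simp: typed_iff)
next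
  case (11 f Y Z g W c)
  then show ?case by (clarsimp simp: T_mor_iff T_ops) (rule T_class_eqI, rule T_eq.intros(28), auto simp: typed_iff)
next
  case (15 f Y Z g Y' Z')
  then show ?case by (fastforce simp: T_mor_iff T_tens intro: exI[of _ "ETens _ _"])
next
  case (16 Y Z)
  then show ?case by (clarsimp simp: T_mor_iff T_ops) (rule T_class_eqI, rule T_eq.intros(20))
next
  case (17 f Y Z g W f' Y' Z' g' W')
  then show ?case by (clarsimp simp: T_mor_iff T_ops) (rule T_class_eqI, rule T_eq.intros(21), auto simp: typed_iff)
next
  case (18 f Y Z g Y' Z' h Y'' Z'')
  then show ?case by (clarsimp simp: T_mor_iff T_ops) (rule T_class_eqI, rule T_eq.intros(22), auto simp: typed_iff)
next
  case (19 f Y Z)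
  then show ?case by (clarsimp simp: T_mor_iff T_ops) (rule T_class_eqI, rule T_eq.intros(23), auto simp: typed_iff)
next
  case (20 f Y Z)
  then show ?case by (clarsimp simp: T_mor_iff T_ops) (rule T_class_eqI, rule T_eq.intros(24), auto simp: typed_iff)
next
  case (21 f Y Z f' g Y' Z')
  then show ?case by (clarsimp simp: T_mor_iff T_ops) (rule T_class_eqI, rule T_eq.intros(29), auto simp: typed_iff)
next
  case (22 f Y Z g Y' Z' g')
  then show ?case by (clarsimp simp: T_mor_iff T_ops) (rule T_class_eqI, rule T_eq.intros(30), auto simp: typed_iff)
next
  case (23 f Y Z g Y' Z' c)
  then show ?case by (clarsimp simp: T_mor_iff T_ops) (rule T_class_eqI, rule T_eq.intros(31), auto simp: typed_iff)
next
  case (24 f Y Z g Y' Z' c)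
  then show ?case by (clarsimp simp: T_mor_iff T_ops) (rule T_class_eqI, rule T_eq.intros(32), auto simp: typed_iff)
qed simp_all

theorem T_trivalent: "trivalent_object (T_cat \<delta> \<alpha>) (T_m \<delta> \<alpha>) (T_s \<delta> \<alpha>) (T_cup \<delta> \<alpha>) (T_cap \<delta> \<alpha>)"
proof -
  interpret strict_monoidal_lin_cat "T_cat \<delta> \<alpha>"
    by (rule T_strict_monoidal)
  show ?thesis
  proof (unfold_locales, unfold T_m_def T_s_def T_cup_def T_cap_def, goal_cases)
    case 3
    show ?case by (auto simp: T_mor_iff intro!: exI[of _ EMult])
  next
    case 4
    show ?case by (auto simp: T_mor_iff intro!: exI[of _ ESwap])
  next
    case 5
    show ?case by (auto simp: T_mor_iff intro!: exI[of _ ECup])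
  next
    case 6
    show ?case by (auto simp: T_mor_iff intro!: exI[of _ ECap])
  next
    case 7
    show ?case by (simp add: T_ops) (intro T_class_eqI T_eq.intros(4) T_rel.intros)
  next
    case 8
    show ?case by (simp add: T_ops) (intro T_class_eqI T_eq.intros(4) T_rel.intros)
  next
    case 9
    show ?case by (simp add: T_ops) (intro T_class_eqI T_eq.intros(4) T_rel.intros)
  next
    case 10
    show ?case by (simp add: T_ops) (intro T_class_eqI T_eq.intros(4) T_rel.intros)
  next
    case 11
    show ?case by (simp add: T_ops) (intro T_class_eqI T_eq.intros(4) T_rel.intros)
  next
    case 12
    show ?case by (simp add: T_ops) (intro T_class_eqI T_eq.intros(4) T_rel.intros)
  next
    case 13
    show ?case by (simp add: T_ops) (intro T_class_eqI T_eq.intros(4) T_rel.intros)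
  next
    case 14
    show ?case by (simp add: T_ops) (intro T_class_eqI T_eq.intros(4) T_rel.intros)
  next
    case 15
    show ?case by (simp add: T_ops) (intro T_class_eqI T_eq.intros(4) T_rel.intros)
  qed simp_all
qed


theorem T_trivalent_algebra:
  "trivalent_algebra (T_cat \<delta> \<alpha>) (T_m \<delta> \<alpha>) (T_s \<delta> \<alpha>) (T_cup \<delta> \<alpha>) (T_cap \<delta> \<alpha>) \<alpha> \<delta>"
proof -
  interpret trivalent_object "T_cat \<delta> \<alpha>" "T_m \<delta> \<alpha>" "T_s \<delta> \<alpha>" "T_cup \<delta> \<alpha>" "T_cap \<delta> \<alpha>"
    by (rule T_trivalent)
  show ?thesis
  proof unfold_locales
    have "T_class \<delta> \<alpha> (EComp EMult ESigma) = T_class \<delta> \<alpha> (EScale \<alpha> (EId 1))"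
      by (intro T_class_eqI T_eq.intros(4) T_rel.intros)
    then show "T_m \<delta> \<alpha> \<cdot>\<^bsub>T_cat \<delta> \<alpha>\<^esub> \<sigma> = \<alpha> \<odot>\<^bsub>Hom (T_cat \<delta> \<alpha>) 1 1\<^esub> idm (T_cat \<delta> \<alpha>) 1"
      unfolding sigma_tens by (simp add: T_ops T_m_def T_cup_def)
    have "T_class \<delta> \<alpha> (EComp ECap ECup) = T_class \<delta> \<alpha> (EScale \<delta> (EId 0))"
      by (intro T_class_eqI T_eq.intros(4) T_rel.intros)
    then show "T_cap \<delta> \<alpha> \<cdot>\<^bsub>T_cat \<delta> \<alpha>\<^esub> T_cup \<delta> \<alpha> = \<delta> \<odot>\<^bsub>Hom (T_cat \<delta> \<alpha>) 0 0\<^esub> idm (T_cat \<delta> \<alpha>) 0"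
      by (simp add: T_ops T_cap_def T_cup_def)
  qed
qed

lemma EBraid1_well_formed [simp]:
  "well_formed (EBraid1 k :: 'a expr)" "source (EBraid1 k :: 'a expr) = k + 1" "target (EBraid1 k :: 'a expr) = k + 1"
  by (induction k) auto

lemma EBraid_well_formed [simp]:
  "well_formed (EBraid n k :: 'a expr)" "source (EBraid n k :: 'a expr) = n + k" "target (EBraid n k :: 'a expr) = n + k"
  by (induction n) auto

lemma T_braiding_eq_braid: "braiding (T_cat \<delta> \<alpha>) n k = trivalent_object.braid (T_cat \<delta> \<alpha>) (T_s \<delta> \<alpha>) n k"
proof -
  interpret trivalent_object "T_cat \<delta> \<alpha>" "T_m \<delta> \<alpha>" "T_s \<delta> \<alpha>" "T_cup \<delta> \<alpha>" "T_cap \<delta> \<alpha>"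
    by (rule T_trivalent)
  have braid1_T: "T_class \<delta> \<alpha> (EBraid1 k) = braid1 k" for k
  proof (induction k)
    case (Suc k)
    have "braid1 (Suc k) = (idm (T_cat \<delta> \<alpha>) k \<boxtimes>\<^bsub>T_cat \<delta> \<alpha>\<^esub> T_s \<delta> \<alpha>)
        \<cdot>\<^bsub>T_cat \<delta> \<alpha>\<^esub> (T_class \<delta> \<alpha> (EBraid1 k) \<boxtimes>\<^bsub>T_cat \<delta> \<alpha>\<^esub> idm (T_cat \<delta> \<alpha>) 1)"
      by (simp add: braid1.simps tens_layer Suc)
    then show ?case
      by (simp add: T_s_def T_ops)
  qed (simp add: T_idm)
  have "T_class \<delta> \<alpha> (EBraid n k) = braid n k"
  proof (induction n)
    case (Suc n)
    have "braid (Suc n) k = (T_class \<delta> \<alpha> (EBraid n k) \<boxtimes>\<^bsub>T_cat \<delta> \<alpha>\<^esub> idm (T_cat \<delta> \<alpha>) 1)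
        \<cdot>\<^bsub>T_cat \<delta> \<alpha>\<^esub> (idm (T_cat \<delta> \<alpha>) n \<boxtimes>\<^bsub>T_cat \<delta> \<alpha>\<^esub> T_class \<delta> \<alpha> (EBraid1 k))"
      by (simp add: braid.simps tens_layer Suc braid1_T)
    then show ?case
      by (simp add: T_ops)
  qed (simp add: T_idm)
  then show ?thesis
    by (simp add: T_braiding)
qed

lemma T_braiding_generator: "braiding (T_cat \<delta> \<alpha>) 1 1 = T_s \<delta> \<alpha>"
proof -
  interpret trivalent_object "T_cat \<delta> \<alpha>" "T_m \<delta> \<alpha>" "T_s \<delta> \<alpha>" "T_cup \<delta> \<alpha>" "T_cap \<delta> \<alpha>"
    by (rule T_trivalent)
  show ?thesis
    using T_braiding_eq_braid braid_one_one by (rule trans)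
qed

text \<open>Every morphism is the class of an expression, so naturality follows by induction on expressions.\<close>

theorem T_symmetric: "symmetric_monoidal_lin_cat (T_cat \<delta> \<alpha>)"
proof -
  interpret trivalent_object "T_cat \<delta> \<alpha>" "T_m \<delta> \<alpha>" "T_s \<delta> \<alpha>" "T_cup \<delta> \<alpha>" "T_cap \<delta> \<alpha>"
    by (rule T_trivalent)
  have arr_T: "arr (T_class \<delta> \<alpha> t)" "src (T_class \<delta> \<alpha> t) = source t" "tgt (T_class \<delta> \<alpha> t) = target t"
    if "well_formed t" for t
  proof -
    have "T_class \<delta> \<alpha> t \<in> mor (T_cat \<delta> \<alpha>) (source t) (target t)"
      using that by (auto simp: T_mor_iff)
    then show "arr (T_class \<delta> \<alpha> t)" "src (T_class \<delta> \<alpha> t) = source t" "tgt (T_class \<delta> \<alpha> t) = target t"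
      by (simp_all add: mor_iff)
  qed
  have slides_T: "well_formed t \<Longrightarrow> slides (T_class \<delta> \<alpha> t)" for t
  proof (induction t)
    case (EId n)
    then show ?case using slides_idm[of n] by (simp add: T_idm)
  next
    case EMult
    then show ?case using slides_generators(1) by (simp add: T_m_def)
  next
    case ESwap
    then show ?case using slides_generators(2) by (simp add: T_s_def)
  next
    case ECup
    then show ?case using slides_generators(3) by (simp add: T_cup_def)
  next
    case ECap
    then show ?case using slides_generators(4) by (simp add: T_cap_def)
  next
    case (EComp t u)
    then show ?case
      using slides_comp[of "T_class \<delta> \<alpha> u" "T_class \<delta> \<alpha> t"] by (simp add: T_ops arr_T)
  next
    case (ETens t u)
    then show ?case
      using slides_tens[of "T_class \<delta> \<alpha> t" "T_class \<delta> \<alpha> u"] by (simp add: T_ops)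
  next
    case (EZero n k)
    then show ?case using slides_zero[of n k] by (simp add: T_zero)
  next
    case (EAdd t u)
    then show ?case
      using slides_add[of "T_class \<delta> \<alpha> t" "T_class \<delta> \<alpha> u" "source t" "target t"]
      by (simp add: T_ops arr_T)
  next
    case (EScale c t)
    then show ?case
      using slides_smult[of "T_class \<delta> \<alpha> t" "source t" "target t" c] by (simp add: T_ops arr_T)
  qed
  have "slides f" if f: "arr f" for f
  proof -
    obtain u where "well_formed u" "f = T_class \<delta> \<alpha> u"
      using f unfolding arr_def T_mor_iff by blast
    then show ?thesis
      using slides_T by simp
  qed
  then show ?thesis
    using T_braiding_eq_braid by (rule symmetric_if_slides)
qed


section \<open>Quotients by tensor ideals\<close>

locale tensor_ideal_quotient = strict_monoidal_lin_cat C for C :: "('o, 'm, 'k::field) lin_cat" (structure) +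
  fixes I :: "'o \<Rightarrow> 'o \<Rightarrow> 'm set"
  assumes ideal: "tensor_ideal C I"
begin

abbreviation Q where "Q \<equiv> quot_cat C I"

abbreviation P where "P \<equiv> proj C I"

lemma ideal_submodule: "submodule class_ring (I Y Z) (Hom C Y Z)"
  using ideal by (auto simp: tensor_ideal_def VectorSpace.subspace_def)

lemma ideal_arr: "f \<in> I Y Z \<Longrightarrow> arr f \<and> src f = Y \<and> tgt f = Z"
  using submodule.subset[OF ideal_submodule] mor_iff by blast

lemma ideal_zero: "\<zero>\<^bsub>Hom C Y Z\<^esub> \<in> I Y Z"
  by (rule submodule.zero_closed[OF ideal_submodule])

lemma ideal_add: "f \<in> I Y Z \<Longrightarrow> g \<in> I Y Z \<Longrightarrow> f \<oplus>\<^bsub>Hom C Y Z\<^esub> g \<in> I Y Z"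
  by (rule submodule.m_closed[OF ideal_submodule])

lemma ideal_smult: "f \<in> I Y Z \<Longrightarrow> c \<odot>\<^bsub>Hom C Y Z\<^esub> f \<in> I Y Z"
  using submodule.smult_closed[OF ideal_submodule] by simp

lemma ideal_comp_left: "f \<in> I Y Z \<Longrightarrow> arr g \<Longrightarrow> src g = Z \<Longrightarrow> g \<cdot> f \<in> I Y (tgt g)"
  using ideal unfolding tensor_ideal_def mor_iff by blast

lemma ideal_comp_right: "g \<in> I Z W \<Longrightarrow> arr f \<Longrightarrow> tgt f = Z \<Longrightarrow> g \<cdot> f \<in> I (src f) W"
  using ideal unfolding tensor_ideal_def mor_iff by blast

text \<open>The definition of a tensor ideal asks for closure under tensoring with identities only; composing with
  \<open>1 \<otimes> g\<close> extends it to arbitrary morphisms \<open>g\<close>.\<close>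

lemma ideal_tens_left:
  assumes "f \<in> I Y Z" "arr g"
  shows "f \<boxtimes> g \<in> I (Y \<boxdot> src g) (Z \<boxdot> tgt g)"
proof -
  have "f \<boxtimes> idm C (src g) \<in> I (Y \<boxdot> src g) (Z \<boxdot> src g)"
    using ideal assms(1) unfolding tensor_ideal_def by blast
  then have "(idm C Z \<boxtimes> g) \<cdot> (f \<boxtimes> idm C (src g)) \<in> I (Y \<boxdot> src g) (Z \<boxdot> tgt g)"
    using ideal_comp_left[of _ _ _ "idm C Z \<boxtimes> g"] assms(2) by simp
  then show ?thesis
    using assms(2) ideal_arr[OF assms(1)] by (simp flip: tens_comp)
qed

lemma ideal_tens_right:
  assumes "f \<in> I Y Z" "arr g"
  shows "g \<boxtimes> f \<in> I (src g \<boxdot> Y) (tgt g \<boxdot> Z)"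
proof -
  have "idm C (src g) \<boxtimes> f \<in> I (src g \<boxdot> Y) (src g \<boxdot> Z)"
    using ideal assms(1) unfolding tensor_ideal_def by blast
  then have "(g \<boxtimes> idm C Z) \<cdot> (idm C (src g) \<boxtimes> f) \<in> I (src g \<boxdot> Y) (tgt g \<boxdot> Z)"
    using ideal_comp_left[of _ _ _ "g \<boxtimes> idm C Z"] assms(2) by simp
  then show ?thesis
    using assms(2) ideal_arr[OF assms(1)] by (simp flip: tens_comp)
qed

lemma hom_abelian_subgroup: "abelian_subgroup (I Y Z) (Hom C Y Z)"
proof -
  interpret M: Module.module class_ring "Hom C Y Z" by (rule hom_module)
  interpret S: submodule class_ring "I Y Z" "Hom C Y Z" by (rule ideal_submodule)
  have "\<ominus>\<^bsub>Hom C Y Z\<^esub> f \<in> I Y Z" if f: "f \<in> I Y Z" for f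
  proof -
    have "\<ominus>\<^bsub>Hom C Y Z\<^esub> f = (- 1) \<odot>\<^bsub>Hom C Y Z\<^esub> f"
      using M.smult_l_minus[of 1 f] M.smult_one[of f] S.subset f by (auto simp: class_ring_simps)
    then show ?thesis
      using ideal_smult[OF f] by simp
  qed
  moreover have "I Y Z \<noteq> {}"
    using ideal_zero by blast
  ultimately show ?thesis
    by (intro abelian_subgroupI3 additive_subgroup.intro M.abelian_group_axioms M.add.subgroupI)
      (use S.subset in \<open>auto intro: ideal_add simp: a_inv_def\<close>)
qed

lemma P_eq: "arr f \<Longrightarrow> P f = I (src f) (tgt f) +>\<^bsub>Hom C (src f) (tgt f)\<^esub> f"
  unfolding proj_def by (auto simp: mor_iff)

lemma P_mem_iff: "arr f \<Longrightarrow> a \<in> P f \<longleftrightarrow> (\<exists>h\<in>I (src f) (tgt f). a = h \<oplus>\<^bsub>Hom C (src f) (tgt f)\<^esub> f)"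
  by (auto simp: P_eq a_r_coset_def')

lemma P_self: "arr f \<Longrightarrow> f \<in> P f"
  using abelian_subgroup.a_rcos_self[OF hom_abelian_subgroup arr_mor] by (simp add: P_eq)

lemma P_eqI:
  assumes "arr f" "h \<in> I (src f) (tgt f)" "g = h \<oplus>\<^bsub>Hom C (src f) (tgt f)\<^esub> f"
  shows "P g = P f"
proof -
  have g: "arr g" "src g = src f" "tgt g = tgt f"
    using assms ideal_arr[OF assms(2)] by simp_all
  have "g \<in> I (src f) (tgt f) +>\<^bsub>Hom C (src f) (tgt f)\<^esub> f"
    using assms P_mem_iff[of f g] P_eq by auto
  then have "I (src f) (tgt f) +>\<^bsub>Hom C (src f) (tgt f)\<^esub> f = I (src f) (tgt f) +>\<^bsub>Hom C (src f) (tgt f)\<^esub> g"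
    using abelian_subgroup.a_repr_independence'[OF hom_abelian_subgroup] arr_mor[OF assms(1)] by blast
  then show ?thesis
    using assms(1) g by (simp add: P_eq)
qed

lemma P_typed: "arr f \<Longrightarrow> a \<in> P f \<Longrightarrow> arr a \<and> src a = src f \<and> tgt a = tgt f"
  using ideal_arr P_mem_iff by fastforce

lemma Q_objects [simp]: "ounit Q = ounit C" "Y \<boxdot>\<^bsub>Q\<^esub> Z = Y \<boxdot> Z"
  by (simp_all add: quot_cat_def)

lemma Q_mor_iff: "A \<in> mor Q Y Z \<longleftrightarrow> (\<exists>f. arr f \<and> src f = Y \<and> tgt f = Z \<and> A = P f)"
  by (auto simp: quot_cat_def quot_module_def A_RCOSETS_def' P_eq mor_iff)

lemma Q_idm: "idm Q Y = P (idm C Y)"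
  by (simp add: quot_cat_def)

lemma Q_zero: "\<zero>\<^bsub>Hom Q Y Z\<^esub> = P \<zero>\<^bsub>Hom C Y Z\<^esub>"
proof -
  interpret M: Module.module class_ring "Hom C Y Z" by (rule hom_module)
  have "I Y Z +>\<^bsub>Hom C Y Z\<^esub> \<zero>\<^bsub>Hom C Y Z\<^esub> = I Y Z"
    using ideal_arr by (force simp: a_r_coset_def' mor_iff)
  then show ?thesis
    by (simp add: quot_cat_def quot_module_def P_eq)
qed

lemma Q_add:
  assumes "arr f" "arr g" "src f = Y" "src g = Y" "tgt f = Z" "tgt g = Z"
  shows "P f \<oplus>\<^bsub>Hom Q Y Z\<^esub> P g = P (f \<oplus>\<^bsub>Hom C Y Z\<^esub> g)"
  using abelian_subgroup.a_rcos_sum[OF hom_abelian_subgroup, of f Y Z g] assms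
  by (simp add: quot_cat_def quot_module_def P_eq mor_iff)

lemma UN_constant2: "A \<noteq> {} \<Longrightarrow> B \<noteq> {} \<Longrightarrow> (\<And>a b. a \<in> A \<Longrightarrow> b \<in> B \<Longrightarrow> F a b = D) \<Longrightarrow> (\<Union>a\<in>A. \<Union>b\<in>B. F a b) = D"
  by auto

lemma Q_smult:
  assumes "arr f" "src f = Y" "tgt f = Z"
  shows "c \<odot>\<^bsub>Hom Q Y Z\<^esub> P f = P (c \<odot>\<^bsub>Hom C Y Z\<^esub> f)"
proof -
  interpret M: Module.module class_ring "Hom C Y Z" by (rule hom_module)
  have "I Y Z +>\<^bsub>Hom C Y Z\<^esub> (c \<odot>\<^bsub>Hom C Y Z\<^esub> a) = P (c \<odot>\<^bsub>Hom C Y Z\<^esub> f)" if a: "a \<in> P f" for a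
  proof -
    obtain h where h: "h \<in> I Y Z" "a = h \<oplus>\<^bsub>Hom C Y Z\<^esub> f"
      using a assms by (auto simp: P_mem_iff)
    then have "c \<odot>\<^bsub>Hom C Y Z\<^esub> a = c \<odot>\<^bsub>Hom C Y Z\<^esub> h \<oplus>\<^bsub>Hom C Y Z\<^esub> c \<odot>\<^bsub>Hom C Y Z\<^esub> f"
      using assms ideal_arr[OF h(1)] M.smult_r_distr[of c h f] by (simp add: mor_iff)
    then have "P (c \<odot>\<^bsub>Hom C Y Z\<^esub> a) = P (c \<odot>\<^bsub>Hom C Y Z\<^esub> f)"
      using assms ideal_smult[OF h(1)] by (intro P_eqI) auto
    moreover have "arr (c \<odot>\<^bsub>Hom C Y Z\<^esub> a)" "src (c \<odot>\<^bsub>Hom C Y Z\<^esub> a) = Y" "tgt (c \<odot>\<^bsub>Hom C Y Z\<^esub> a) = Z"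
      using P_typed[OF assms(1) a] assms by simp_all
    ultimately show ?thesis
      by (simp add: P_eq)
  qed
  then show ?thesis
    using P_self[OF assms(1)] by (auto simp: quot_cat_def quot_module_def)
qed

text \<open>Changing \<open>g\<close> by \<open>h\<close> and \<open>f\<close> by \<open>k\<close> in the ideal changes the composite by \<open>h a + g k\<close>, where \<open>a = k + f\<close>;
  this again lies in the ideal.\<close>

lemma Q_comp:
  assumes "arr f" "arr g" "tgt f = src g"
  shows "P g \<cdot>\<^bsub>Q\<^esub> P f = P (g \<cdot> f)"
proof -
  have "P (b \<cdot> a) = P (g \<cdot> f)" if ab: "b \<in> P g" "a \<in> P f" for a b
  proof -
    let ?V = "Hom C (src f) (tgt g)"
    interpret M: Module.module class_ring ?V by (rule hom_module)
    obtain h where h: "h \<in> I (src g) (tgt g)" "b = h \<oplus>\<^bsub>Hom C (src g) (tgt g)\<^esub> g"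
      using ab assms by (auto simp: P_mem_iff)
    obtain k where k: "k \<in> I (src f) (tgt f)" "a = k \<oplus>\<^bsub>Hom C (src f) (tgt f)\<^esub> f"
      using ab assms by (auto simp: P_mem_iff)
    have a: "arr a" "src a = src f" "tgt a = src g"
      using P_typed[OF assms(1) ab(2)] assms by simp_all
    have hk: "arr h" "src h = src g" "tgt h = tgt g" "arr k" "src k = src f" "tgt k = tgt f"
      using ideal_arr h(1) k(1) by blast+
    have "b \<cdot> a = h \<cdot> a \<oplus>\<^bsub>?V\<^esub> g \<cdot> a"
      using a h(2) hk assms by (simp add: comp_add)
    also have "g \<cdot> a = g \<cdot> k \<oplus>\<^bsub>?V\<^esub> g \<cdot> f"
      using k(2) hk assms by (simp add: comp_add)
    finally have "b \<cdot> a = (h \<cdot> a \<oplus>\<^bsub>?V\<^esub> g \<cdot> k) \<oplus>\<^bsub>?V\<^esub> g \<cdot> f"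
      using a hk assms by (simp add: M.a_assoc mor_iff)
    moreover have "h \<cdot> a \<oplus>\<^bsub>?V\<^esub> g \<cdot> k \<in> I (src f) (tgt g)"
      using ideal_comp_right[OF h(1), of a] ideal_comp_left[OF k(1), of g] a assms by (simp add: ideal_add)
    ultimately show ?thesis
      using assms by (intro P_eqI) auto
  qed
  moreover have "P f \<noteq> {}" "P g \<noteq> {}"
    using P_self[OF assms(1)] P_self[OF assms(2)] by blast+
  ultimately have "(\<Union>b\<in>P g. \<Union>a\<in>P f. P (b \<cdot> a)) = P (g \<cdot> f)"
    by (intro UN_constant2)
  then show ?thesis
    by (simp add: quot_cat_def)
qed

lemma Q_tens:
  assumes "arr f" "arr g"
  shows "P f \<boxtimes>\<^bsub>Q\<^esub> P g = P (f \<boxtimes> g)"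
proof -
  have "P (a \<boxtimes> b) = P (f \<boxtimes> g)" if ab: "a \<in> P f" "b \<in> P g" for a b
  proof -
    let ?V = "Hom C (src f \<boxdot> src g) (tgt f \<boxdot> tgt g)"
    interpret M: Module.module class_ring ?V by (rule hom_module)
    obtain h where h: "h \<in> I (src g) (tgt g)" "b = h \<oplus>\<^bsub>Hom C (src g) (tgt g)\<^esub> g"
      using ab assms by (auto simp: P_mem_iff)
    obtain k where k: "k \<in> I (src f) (tgt f)" "a = k \<oplus>\<^bsub>Hom C (src f) (tgt f)\<^esub> f"
      using ab assms by (auto simp: P_mem_iff)
    have b: "arr b" "src b = src g" "tgt b = tgt g"
      using P_typed[OF assms(2) ab(2)] by simp_all
    have hk: "arr h" "src h = src g" "tgt h = tgt g" "arr k" "src k = src f" "tgt k = tgt f"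
      using ideal_arr h(1) k(1) by blast+
    have "a \<boxtimes> b = k \<boxtimes> b \<oplus>\<^bsub>?V\<^esub> f \<boxtimes> b"
      using b k(2) hk assms by (simp add: tensor_add)
    also have "f \<boxtimes> b = f \<boxtimes> h \<oplus>\<^bsub>?V\<^esub> f \<boxtimes> g"
      using h(2) hk assms by (simp add: tensor_add)
    finally have "a \<boxtimes> b = (k \<boxtimes> b \<oplus>\<^bsub>?V\<^esub> f \<boxtimes> h) \<oplus>\<^bsub>?V\<^esub> f \<boxtimes> g"
      using b hk assms by (simp add: M.a_assoc mor_iff)
    moreover have "k \<boxtimes> b \<oplus>\<^bsub>?V\<^esub> f \<boxtimes> h \<in> I (src f \<boxdot> src g) (tgt f \<boxdot> tgt g)"
      using ideal_tens_left[OF k(1), of b] ideal_tens_right[OF h(1), of f] b assms by (simp add: ideal_add)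
    ultimately show ?thesis
      using assms by (intro P_eqI) auto
  qed
  moreover have "P f \<noteq> {}" "P g \<noteq> {}"
    using P_self[OF assms(1)] P_self[OF assms(2)] by blast+
  ultimately have "(\<Union>a\<in>P f. \<Union>b\<in>P g. P (a \<boxtimes> b)) = P (f \<boxtimes> g)"
    by (intro UN_constant2)
  then show ?thesis
    by (simp add: quot_cat_def)
qed

lemmas Q_ops = Q_idm Q_zero Q_add Q_smult Q_comp Q_tens

lemma Q_hom_vectorspace: "vectorspace class_ring (Hom Q Y Z)"
proof -
  interpret M: Module.module class_ring "Hom C Y Z" by (rule hom_module)
  have "abelian_group (Hom Q Y Z)"
  proof (rule abelian_groupI)
    fix A assume "A \<in> mor Q Y Z"
    then obtain f where f: "arr f" "src f = Y" "tgt f = Z" "A = P f"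
      by (auto simp: Q_mor_iff)
    have neg: "arr (\<ominus>\<^bsub>Hom C Y Z\<^esub> f)" "src (\<ominus>\<^bsub>Hom C Y Z\<^esub> f) = Y" "tgt (\<ominus>\<^bsub>Hom C Y Z\<^esub> f) = Z"
      using f M.a_inv_closed[of f] by (simp_all add: mor_iff)
    have "P (\<ominus>\<^bsub>Hom C Y Z\<^esub> f) \<in> mor Q Y Z" "P (\<ominus>\<^bsub>Hom C Y Z\<^esub> f) \<oplus>\<^bsub>Hom Q Y Z\<^esub> A = \<zero>\<^bsub>Hom Q Y Z\<^esub>"
      using f neg by (auto simp: Q_mor_iff Q_ops M.l_neg mor_iff)
    then show "\<exists>B\<in>mor Q Y Z. B \<oplus>\<^bsub>Hom Q Y Z\<^esub> A = \<zero>\<^bsub>Hom Q Y Z\<^esub>"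
      by blast
    show "\<zero>\<^bsub>Hom Q Y Z\<^esub> \<oplus>\<^bsub>Hom Q Y Z\<^esub> A = A"
      using f by (simp add: Q_ops mor_iff)
  next
    show "\<zero>\<^bsub>Hom Q Y Z\<^esub> \<in> mor Q Y Z"
      unfolding Q_mor_iff Q_zero by (intro exI[of _ "\<zero>\<^bsub>Hom C Y Z\<^esub>"]) simp
  next
    fix A B assume "A \<in> mor Q Y Z" "B \<in> mor Q Y Z"
    then obtain f g where fg: "arr f" "src f = Y" "tgt f = Z" "A = P f" "arr g" "src g = Y" "tgt g = Z" "B = P g"
      by (auto simp: Q_mor_iff)
    then show "A \<oplus>\<^bsub>Hom Q Y Z\<^esub> B \<in> mor Q Y Z"
      by (auto simp: Q_mor_iff Q_add intro!: exI[of _ "f \<oplus>\<^bsub>Hom C Y Z\<^esub> g"])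
    show "A \<oplus>\<^bsub>Hom Q Y Z\<^esub> B = B \<oplus>\<^bsub>Hom Q Y Z\<^esub> A"
      using fg by (simp add: Q_add M.a_comm mor_iff)
    fix D assume "D \<in> mor Q Y Z"
    then obtain h where "arr h" "src h = Y" "tgt h = Z" "D = P h"
      by (auto simp: Q_mor_iff)
    then show "A \<oplus>\<^bsub>Hom Q Y Z\<^esub> B \<oplus>\<^bsub>Hom Q Y Z\<^esub> D = A \<oplus>\<^bsub>Hom Q Y Z\<^esub> (B \<oplus>\<^bsub>Hom Q Y Z\<^esub> D)"
      using fg by (simp add: Q_add M.a_assoc mor_iff)
  qed
  moreover have "module_axioms class_ring (Hom Q Y Z)"
  proof (rule module_axioms.intro)
    fix a b A assume "A \<in> mor Q Y Z"
    then obtain f where f: "arr f" "src f = Y" "tgt f = Z" "A = P f"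
      by (auto simp: Q_mor_iff)
    then show "a \<odot>\<^bsub>Hom Q Y Z\<^esub> A \<in> mor Q Y Z"
      by (auto simp: Q_mor_iff Q_smult intro!: exI[of _ "a \<odot>\<^bsub>Hom C Y Z\<^esub> f"])
    show "(a \<oplus>\<^bsub>class_ring\<^esub> b) \<odot>\<^bsub>Hom Q Y Z\<^esub> A = a \<odot>\<^bsub>Hom Q Y Z\<^esub> A \<oplus>\<^bsub>Hom Q Y Z\<^esub> b \<odot>\<^bsub>Hom Q Y Z\<^esub> A"
      using f by (simp add: Q_ops smult_plus)
    show "(a \<otimes>\<^bsub>class_ring\<^esub> b) \<odot>\<^bsub>Hom Q Y Z\<^esub> A = a \<odot>\<^bsub>Hom Q Y Z\<^esub> (b \<odot>\<^bsub>Hom Q Y Z\<^esub> A)"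
      using f by (simp add: Q_ops smult_smult)
    show "\<one>\<^bsub>class_ring\<^esub> \<odot>\<^bsub>Hom Q Y Z\<^esub> A = A"
      using f by (simp add: Q_ops smult_one)
    fix B assume "B \<in> mor Q Y Z"
    then obtain g where "arr g" "src g = Y" "tgt g = Z" "B = P g"
      by (auto simp: Q_mor_iff)
    then show "a \<odot>\<^bsub>Hom Q Y Z\<^esub> (A \<oplus>\<^bsub>Hom Q Y Z\<^esub> B) = a \<odot>\<^bsub>Hom Q Y Z\<^esub> A \<oplus>\<^bsub>Hom Q Y Z\<^esub> a \<odot>\<^bsub>Hom Q Y Z\<^esub> B"
      using f M.smult_r_distr[of a f g] by (simp add: Q_ops mor_iff)
  qed
  ultimately show ?thesis
    using class_field by (auto simp: vectorspace_def Module.module_def field_def domain_def)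
qed

theorem quotient_strict_monoidal: "strict_monoidal_lin_cat Q"
proof (rule strict_monoidal_lin_cat.intro, goal_cases)
  case 1
  show ?case by (rule Q_hom_vectorspace)
next
  case (2 A Y Z Y' Z')
  then obtain f f' where "arr f" "src f = Y" "tgt f = Z" "A = P f" "arr f'" "src f' = Y'" "tgt f' = Z'" "A = P f'"
    by (auto simp: Q_mor_iff)
  then show ?case
    using P_typed[of f' f] P_self[of f] by auto
next
  case (3 Y)
  then show ?case by (auto simp: Q_mor_iff Q_idm intro!: exI[of _ "idm C Y"])
next
  case (4 A Y Z B W)
  then obtain f g where "arr f" "src f = Y" "tgt f = Z" "A = P f" "arr g" "src g = Z" "tgt g = W" "B = P g"
    by (auto simp: Q_mor_iff)
  then show ?case by (auto simp: Q_mor_iff Q_comp intro!: exI[of _ "g \<cdot> f"])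
next
  case (15 A Y Z B Y' Z')
  then obtain f g where "arr f" "src f = Y" "tgt f = Z" "A = P f" "arr g" "src g = Y'" "tgt g = Z'" "B = P g"
    by (auto simp: Q_mor_iff)
  then show ?case by (auto simp: Q_mor_iff Q_tens intro!: exI[of _ "f \<boxtimes> g"])
qed (clarsimp simp: Q_mor_iff Q_ops comp_add comp_smult tensor_add tensor_smult comp_assoc tensor_assoc
      tens_idm otens_assoc otens_unit_left otens_unit_right simp flip: tens_comp)+

lemma Q_minus:
  assumes "arr f" "arr g" "src f = Y" "src g = Y" "tgt f = Z" "tgt g = Z"
  shows "P f \<ominus>\<^bsub>Hom Q Y Z\<^esub> P g = P (f \<ominus>\<^bsub>Hom C Y Z\<^esub> g)"
proof -
  interpret Q: strict_monoidal_lin_cat Q by (rule quotient_strict_monoidal)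
  have "P f \<in> mor Q Y Z" "P g \<in> mor Q Y Z"
    using assms Q_mor_iff by blast+
  then show ?thesis
    using assms by (simp add: Q.minus_smult Q.mor_iff minus_smult Q_smult Q_add)
qed

end

lemma quotient_symmetric:
  assumes sym: "symmetric_monoidal_lin_cat C" and ideal: "tensor_ideal C I"
  shows "symmetric_monoidal_lin_cat (quot_cat C I)"
proof -
  interpret symmetric_monoidal_lin_cat C by (rule sym)
  interpret tensor_ideal_quotient C I by unfold_locales (rule ideal)
  interpret Q: strict_monoidal_lin_cat "quot_cat C I" by (rule quotient_strict_monoidal)
  have braiding: "braiding (quot_cat C I) Y Z = P (braiding C Y Z)" for Y Z
    by (simp add: quot_cat_def)
  have arr: "arr (braiding C Y Z)" "src (braiding C Y Z) = Y \<boxdot>\<^bsub>C\<^esub> Z" "tgt (braiding C Y Z) = Z \<boxdot>\<^bsub>C\<^esub> Y" for Y Z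
    using braiding_mor[of Y Z] by (simp_all add: mor_iff)
  show ?thesis
  proof unfold_locales
    fix Y Z Y' Z' W A B
    show "braiding Q Y Z \<in> mor Q (Y \<boxdot>\<^bsub>Q\<^esub> Z) (Z \<boxdot>\<^bsub>Q\<^esub> Y)"
      unfolding Q_mor_iff braiding by (intro exI[of _ "braiding C Y Z"]) (simp add: arr)
    show "braiding Q Y (Z \<boxdot>\<^bsub>Q\<^esub> W) = (idm Q Z \<boxtimes>\<^bsub>Q\<^esub> braiding Q Y W) \<cdot>\<^bsub>Q\<^esub> (braiding Q Y Z \<boxtimes>\<^bsub>Q\<^esub> idm Q W)"
      by (simp add: braiding Q_ops arr braiding_hexagon otens_assoc)
    show "braiding Q Z Y \<cdot>\<^bsub>Q\<^esub> braiding Q Y Z = idm Q (Y \<boxdot>\<^bsub>Q\<^esub> Z)"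
      by (simp add: braiding Q_ops arr braiding_symmetric)
    assume "A \<in> mor Q Y Y'" "B \<in> mor Q Z Z'"
    then obtain f g where fg: "arr f" "src f = Y" "tgt f = Y'" "A = P f" "arr g" "src g = Z" "tgt g = Z'" "B = P g"
      by (auto simp: Q_mor_iff)
    then show "braiding Q Y' Z' \<cdot>\<^bsub>Q\<^esub> (A \<boxtimes>\<^bsub>Q\<^esub> B) = (B \<boxtimes>\<^bsub>Q\<^esub> A) \<cdot>\<^bsub>Q\<^esub> braiding Q Y Z"
      using braiding_natural[of f Y Y' g Z Z'] by (simp add: braiding Q_ops arr mor_iff)
  qed
qed


text \<open>All defining relations are equations between composites of generators, which the projection
  preserves.\<close>

lemma quotient_trivalent_algebra:
  assumes triv: "trivalent_algebra C m s \<eta> \<epsilon> \<alpha> \<delta>" and ideal: "tensor_ideal C I"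
  shows "trivalent_algebra (quot_cat C I) (proj C I m) (proj C I s) (proj C I \<eta>) (proj C I \<epsilon>) \<alpha> \<delta>"
proof -
  interpret trivalent_algebra C m s \<eta> \<epsilon> \<alpha> \<delta> by (rule triv)
  interpret tensor_ideal_quotient C I by unfold_locales (rule ideal)
  interpret Q: strict_monoidal_lin_cat "quot_cat C I" by (rule quotient_strict_monoidal)
  interpret Q: trivalent_object "quot_cat C I" "P m" "P s" "P \<eta>" "P \<epsilon>"
  proof unfold_locales
    show "P m \<in> mor Q 2 1"
      unfolding Q_mor_iff by (intro exI[of _ m]) simp
    show "P s \<in> mor Q 2 2"
      unfolding Q_mor_iff by (intro exI[of _ s]) simp
    show "P \<eta> \<in> mor Q 0 2"
      unfolding Q_mor_iff by (intro exI[of _ \<eta>]) simp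
    show "P \<epsilon> \<in> mor Q 2 0"
      unfolding Q_mor_iff by (intro exI[of _ \<epsilon>]) simp
  qed (simp_all add: Q_ops snake_left snake_right m_rotation cap_slide s_involution s_braid m_slide
      cap_symmetric m_skew)
  have "Q.\<sigma> = P \<sigma>"
    unfolding Q.sigma_tens sigma_tens by (simp add: Q_ops)
  then show ?thesis
    by unfold_locales (simp_all add: Q_ops bigon loop)
qed


section \<open>Quotients with four-dimensional endomorphism space\<close>

lemma two_nonzero_if_char:
  assumes "CHAR('k::field) \<noteq> 2"
  shows "(2::'k) \<noteq> 0"
proof
  assume "(2::'k) = 0"
  then have dvd: "CHAR('k) dvd 2"
    using of_nat_eq_0_iff_char_dvd[of 2, where 'a = 'k] by simp
  have "CHAR('k) \<noteq> 1"
  proof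
    assume "CHAR('k) = 1"
    then have "of_nat 1 = (0::'k)"
      using of_nat_CHAR[where 'a = 'k] by metis
    then show False by simp
  qed
  moreover have "CHAR('k) \<noteq> 0"
    using dvd_pos_nat[OF _ dvd] by simp
  ultimately show False
    using assms dvd_imp_le[OF dvd] by linarith
qed

theorem proposition3p13:
  fixes \<delta> \<alpha> :: "'k::field"
    and I :: "nat \<Rightarrow> nat \<Rightarrow> 'k expr set set"
  defines "T \<equiv> T_cat \<delta> \<alpha>"
  defines "Q \<equiv> quot_cat T I"
  assumes char: "CHAR('k) \<noteq> 2"
    and delta: "\<delta> \<noteq> - 2"
    and alpha: "\<alpha> \<noteq> 0"
    and ideal: "tensor_ideal T I"
    and fin: "vectorspace.fin_dim class_ring (Hom Q 2 2)"
    and dim4: "vectorspace.dim class_ring (Hom Q 2 2) = 4"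
  shows "\<delta> \<noteq> 1
    \<and> proj T I (T_K \<delta> \<alpha> \<oplus>\<^bsub>Hom T 2 2\<^esub> T_H \<delta> \<alpha>)
      = proj T I ((\<alpha> / (1 - \<delta>)) \<odot>\<^bsub>Hom T 2 2\<^esub>
          (2 \<odot>\<^bsub>Hom T 2 2\<^esub> T_s \<delta> \<alpha> \<ominus>\<^bsub>Hom T 2 2\<^esub> idm T 2
             \<ominus>\<^bsub>Hom T 2 2\<^esub> (T_cup \<delta> \<alpha> \<cdot>\<^bsub>T\<^esub> T_cap \<delta> \<alpha>)))
    \<and> (\<exists>\<eta>' \<epsilon>'. vector_product_algebra Q 1 (proj T I (T_m \<delta> \<alpha>)) \<eta>' \<epsilon>')"
proof -
  have two: "(2::'k) \<noteq> 0"
    using char by (rule two_nonzero_if_char)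
  interpret T: trivalent_algebra T "T_m \<delta> \<alpha>" "T_s \<delta> \<alpha>" "T_cup \<delta> \<alpha>" "T_cap \<delta> \<alpha>" \<alpha> \<delta>
    unfolding T_def by (rule T_trivalent_algebra)
  interpret tensor_ideal_quotient T I
    by unfold_locales (rule ideal)
  interpret Q: trivalent_algebra Q "P (T_m \<delta> \<alpha>)" "P (T_s \<delta> \<alpha>)" "P (T_cup \<delta> \<alpha>)" "P (T_cap \<delta> \<alpha>)" \<alpha> \<delta>
    unfolding Q_def by (rule quotient_trivalent_algebra[OF T.trivalent_algebra_axioms ideal])
  have sigma_Q: "Q.\<sigma> = P T.\<sigma>"
    unfolding Q.sigma_tens T.sigma_tens by (simp add: Q_def Q_ops)
  have K_Q: "Q.K = P T.K"
    unfolding Q.K_def T.K_def sigma_Q by (simp add: Q_def Q_ops)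
  have "Q.H = (P (T_m \<delta> \<alpha>) \<boxtimes>\<^bsub>Q\<^esub> idm Q 1) \<cdot>\<^bsub>Q\<^esub> (idm Q 1 \<boxtimes>\<^bsub>Q\<^esub> P T.\<sigma>)"
    using Q.H_def sigma_Q Q.tens_layer[of "P T.\<sigma>"] Q.tens_layer[of "P (T_m \<delta> \<alpha>)"] Q.sigma_arr by simp
  moreover have H_T: "T.H = (T_m \<delta> \<alpha> \<boxtimes>\<^bsub>T\<^esub> idm T 1) \<cdot>\<^bsub>T\<^esub> (idm T 1 \<boxtimes>\<^bsub>T\<^esub> T.\<sigma>)"
    by (simp add: T.H_def T.tens_layer)
  ultimately have H_Q: "Q.H = P T.H"
    by (simp add: Q_def Q_ops)
  have U_Q: "Q.U = P T.U"
    unfolding Q.U_def T.U_def by (simp add: Q_def Q_ops)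
  have sigma_T: "T_sigma \<delta> \<alpha> = T.\<sigma>"
    unfolding T_sigma_def T.sigma_tens by (simp only: T_def)
  have T_diagrams: "T_K \<delta> \<alpha> = T.K" "T_H \<delta> \<alpha> = T.H"
    unfolding T_K_def T_H_def sigma_T H_T T.K_def by (simp_all only: T_def)
  let ?c = "\<alpha> / (1 - \<delta>)"
  note main = Q.skein_if_dim_four[OF two delta alpha fin dim4]
  note skein = main(2)
  have "proj T I (T_K \<delta> \<alpha> \<oplus>\<^bsub>Hom T 2 2\<^esub> T_H \<delta> \<alpha>) = Q.K \<oplus>\<^bsub>Hom Q 2 2\<^esub> Q.H"
    unfolding T_diagrams K_Q H_Q by (simp add: Q_def Q_add)
  also have "\<dots> = ?c \<odot>\<^bsub>Hom Q 2 2\<^esub>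
      (2 \<odot>\<^bsub>Hom Q 2 2\<^esub> P (T_s \<delta> \<alpha>) \<ominus>\<^bsub>Hom Q 2 2\<^esub> idm Q 2 \<ominus>\<^bsub>Hom Q 2 2\<^esub> Q.U)"
    unfolding skein Q.skein_comb ..
  also have "\<dots> = proj T I (?c \<odot>\<^bsub>Hom T 2 2\<^esub>
      (2 \<odot>\<^bsub>Hom T 2 2\<^esub> T_s \<delta> \<alpha> \<ominus>\<^bsub>Hom T 2 2\<^esub> idm T 2
         \<ominus>\<^bsub>Hom T 2 2\<^esub> (T_cup \<delta> \<alpha> \<cdot>\<^bsub>T\<^esub> T_cap \<delta> \<alpha>)))"
    unfolding U_Q T.U_def by (simp add: Q_def Q_ops Q_minus)
  finally have relation: "proj T I (T_K \<delta> \<alpha> \<oplus>\<^bsub>Hom T 2 2\<^esub> T_H \<delta> \<alpha>) = \<dots>" .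
  have sym: "symmetric_monoidal_lin_cat Q"
    unfolding Q_def using T_symmetric ideal by (intro quotient_symmetric) (simp_all add: T_def)
  have "braiding T 1 1 = T_s \<delta> \<alpha>"
    unfolding T_def by (rule T_braiding_generator)
  then have "braiding Q 1 1 = P (T_s \<delta> \<alpha>)"
    by (simp add: Q_def quot_cat_def)
  moreover have "?c \<noteq> 0"
    using alpha main(1) by simp
  ultimately have "vector_product_algebra Q 1 (P (T_m \<delta> \<alpha>))
      (inverse ?c \<odot>\<^bsub>Hom Q 0 2\<^esub> P (T_cup \<delta> \<alpha>)) (?c \<odot>\<^bsub>Hom Q 2 0\<^esub> P (T_cap \<delta> \<alpha>))"
    using Q.vector_product_algebra_if_skein[OF sym _ _ skein] by simp
  then show ?thesis
    using main(1) relation by blast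
qed

end
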